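(* There exist a constant $\gamma \ge 1$ and a reallocating scheduler for unit-length jobs such that, for every number of machines $m \ge 1$ and every $m$-machine $\gamma$-underallocated sequence of scheduling requests, the following holds for every $i$. Let $n_i$ be the number of jobs in the schedule and $\Delta_i$ the largest window span at the time the $i$th request is processed. Then processing the $i$th request (1) has reallocation cost $O(\min\{\log^* n_i, \log^* \Delta_i\})$, and (2) has migration cost at most $1$, i.e. at most one job changes machine.
   Context: There are $m$ identical machines and discrete unit timeslots. Each job has length (processing time) $1$, an integer arrival time $a_j$ and an integer deadline $d_j > a_j$. Its window is $[a_j,d_j]$, and the span of the window (and of the job) is $d_j - a_j$. A feasible schedule assigns each job to a machine and to a unit timeslot lying inside the job's window, with no two jobs on the same machine in the same timeslot. An online sequence of requests consists of operations InsertJob(name, arrival, deadline) and DeleteJob(name). The active jobs after a request are those inserted and not yet deleted. A reallocating scheduler processes the requests one at a time and, after each request, outputs a feasible schedule of all currently active jobs; previously scheduled jobs may be moved. The reallocation cost of a request is the number of jobs whose scheduled position (time or machine) changes when the request is processed. The migration cost is the number of jobs whose machine changes. A set of jobs is $m$-machine $\gamma$-underallocated ($\gamma \ge 1$) if it has a feasible non-preemptive schedule on $m$ machines even when every job's processing time is multiplied by $\gamma$, with each job executed entirely within its window. A request sequence is $\gamma$-underallocated if the set of active jobs is $\gamma$-underallocated after every request. $\log^*$ denotes the iterated logarithm. *)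

theory Defs imports Complex_Main begin

text \<open>Job names are natural numbers; they only serve as identifiers.\<close>

type_synonym job = nat
type_synonym window = "int \<times> int"
type_synonym jobs = "job \<rightharpoonup> window"

datatype request = InsertJob job int int | DeleteJob job

fun process :: "request \<Rightarrow> jobs \<Rightarrow> jobs" where
  "process (InsertJob j a d) A = A(j \<mapsto> (a, d))"
| "process (DeleteJob j) A = A(j := None)"

definition active :: "request list \<Rightarrow> jobs" where
  "active rs = fold process rs Map.empty"

fun valid_request :: "jobs \<Rightarrow> request \<Rightarrow> bool" where
  "valid_request A (InsertJob j a d) \<longleftrightarrow> j \<notin> dom A \<and> a < d"
| "valid_request A (DeleteJob j) \<longleftrightarrow> j \<in> dom A"

definition request_sequence :: "request list \<Rightarrow> bool" where
  "request_sequence rs \<longleftrightarrow> (\<forall>i<length rs. valid_request (active (take i rs)) (rs ! i))"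

text \<open>A position \<open>(p, t)\<close> consists of a machine \<open>p\<close>, one of \<open>0, \<dots>, m - 1\<close>, and the unit
  timeslot \<open>[t, t + 1]\<close>.\<close>

type_synonym schedule = "job \<rightharpoonup> nat \<times> int"

definition feasible :: "nat \<Rightarrow> jobs \<Rightarrow> schedule \<Rightarrow> bool" where
  "feasible m A \<sigma> \<longleftrightarrow>
     dom \<sigma> = dom A \<and>
     (\<forall>j a d p t. A j = Some (a, d) \<longrightarrow> \<sigma> j = Some (p, t) \<longrightarrow> p < m \<and> a \<le> t \<and> t + 1 \<le> d) \<and>
     inj_on \<sigma> (dom \<sigma>)"

text \<open>Start times of the stretched jobs may be arbitrary reals, as \<open>\<gamma>\<close> need not be an integer.\<close>

definition underallocated :: "nat \<Rightarrow> real \<Rightarrow> jobs \<Rightarrow> bool" where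
  "underallocated m \<gamma> A \<longleftrightarrow>
     (\<exists>(mach :: job \<Rightarrow> nat) (start :: job \<Rightarrow> real).
        (\<forall>j a d. A j = Some (a, d) \<longrightarrow>
           mach j < m \<and> real_of_int a \<le> start j \<and> start j + \<gamma> \<le> real_of_int d) \<and>
        (\<forall>j\<in>dom A. \<forall>k\<in>dom A. j \<noteq> k \<longrightarrow> mach j = mach k \<longrightarrow>
           start j + \<gamma> \<le> start k \<or> start k + \<gamma> \<le> start j))"

definition underallocated_sequence :: "nat \<Rightarrow> real \<Rightarrow> request list \<Rightarrow> bool" where
  "underallocated_sequence m \<gamma> rs \<longleftrightarrow> (\<forall>i\<le>length rs. underallocated m \<gamma> (active (take i rs)))"

text \<open>An online algorithm for \<open>m\<close> machines is a function of \<open>m\<close> and of the requests received so far;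
  its value is the schedule output after the last of them. Every set of active jobs that can be
  scheduled at all has to be scheduled feasibly.\<close>

type_synonym scheduler = "nat \<Rightarrow> request list \<Rightarrow> schedule"

definition reallocating_scheduler :: "scheduler \<Rightarrow> bool" where
  "reallocating_scheduler S \<longleftrightarrow>
     (\<forall>m\<ge>1. \<forall>rs. request_sequence rs \<longrightarrow> (\<exists>\<sigma>. feasible m (active rs) \<sigma>) \<longrightarrow>
        feasible m (active rs) (S m rs))"

text \<open>Only jobs scheduled both before and after a request can change position: the job being
  inserted or deleted is not counted.\<close>

definition reallocation_cost :: "schedule \<Rightarrow> schedule \<Rightarrow> nat" where
  "reallocation_cost \<sigma> \<sigma>' = card {j \<in> dom \<sigma> \<inter> dom \<sigma>'. \<sigma> j \<noteq> \<sigma>' j}"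

definition migration_cost :: "schedule \<Rightarrow> schedule \<Rightarrow> nat" where
  "migration_cost \<sigma> \<sigma>' = card {j \<in> dom \<sigma> \<inter> dom \<sigma>'. fst (the (\<sigma> j)) \<noteq> fst (the (\<sigma>' j))}"

text \<open>The jobs present while request \<open>rs ! i\<close> is processed are those active before or after it, so
  a job being inserted or deleted by this request is included; in particular there is at least one.\<close>

definition present :: "request list \<Rightarrow> nat \<Rightarrow> jobs" where
  "present rs i = active (take i rs) ++ active (take (Suc i) rs)"

definition num_jobs :: "request list \<Rightarrow> nat \<Rightarrow> nat" where
  "num_jobs rs i = card (dom (present rs i))"

definition max_span :: "request list \<Rightarrow> nat \<Rightarrow> int" where
  "max_span rs i = Max ((\<lambda>(a, d). d - a) ` ran (present rs i))"

definition log_star :: "real \<Rightarrow> nat" where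
  "log_star x = (LEAST k. (log 2 ^^ k) x \<le> 1)"

lemma log_star_le_1: "x \<le> 1 \<Longrightarrow> log_star x = 0"
  unfolding log_star_def by (rule Least_equality) auto

lemma log_star_terminates: "\<exists>k. (log 2 ^^ k) x \<le> 1"
proof -
  have "\<exists>k. (log 2 ^^ k) x \<le> 1" if "x \<le> 2 ^ n" for n :: nat and x
    using that
  proof (induction n arbitrary: x)
    case 0
    then show ?case by (intro exI[of _ 0]) simp
  next
    case (Suc n)
    show ?case
    proof (cases "x \<le> 1")
      case True
      then show ?thesis by (intro exI[of _ 0]) simp
    next
      case False
      have "log 2 x \<le> log 2 (2 ^ Suc n)"
        using False Suc.prems by (subst log_le_cancel_iff) auto
      also have "\<dots> = real (Suc n)" by (simp only: log_pow_cancel)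
      also have "\<dots> \<le> 2 ^ n"
        by (metis Suc_leI less_exp of_nat_le_iff of_nat_numeral of_nat_power)
      finally obtain k where "(log 2 ^^ k) (log 2 x) \<le> 1" using Suc.IH by blast
      then show ?thesis by (intro exI[of _ "Suc k"]) (simp add: funpow_swap1)
    qed
  qed
  moreover obtain n :: nat where "x \<le> 2 ^ n"
    using real_arch_pow[of 2 x] by (auto intro: less_imp_le)
  ultimately show ?thesis by blast
qed

lemma log_star_gt_1: "x > 1 \<Longrightarrow> log_star x = Suc (log_star (log 2 x))"
proof -
  assume "x > 1"
  obtain k where "(log 2 ^^ k) x \<le> 1" using log_star_terminates by blast
  moreover have "\<not> (log 2 ^^ 0) x \<le> 1" using \<open>x > 1\<close> by simp
  ultimately show ?thesis
    unfolding log_star_def by (subst Least_Suc) (auto simp: funpow_swap1)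
qed

lemma underallocated_imp_feasible:
  assumes "\<gamma> \<ge> 1" and "underallocated m \<gamma> A"
  shows "\<exists>\<sigma>. feasible m A \<sigma>"
proof -
  obtain mach start where
    w: "\<And>j a d. A j = Some (a, d) \<Longrightarrow>
          mach j < m \<and> real_of_int a \<le> start j \<and> start j + \<gamma> \<le> real_of_int d" and
    s: "\<And>j k. j \<in> dom A \<Longrightarrow> k \<in> dom A \<Longrightarrow> j \<noteq> k \<Longrightarrow> mach j = mach k \<Longrightarrow>
          start j + \<gamma> \<le> start k \<or> start k + \<gamma> \<le> start j"
    using assms(2) unfolding underallocated_def by blast
  define \<sigma> where "\<sigma> = (\<lambda>j. if j \<in> dom A then Some (mach j, \<lfloor>start j\<rfloor>) else None)"
  have "dom \<sigma> = dom A" by (auto simp: \<sigma>_def split: if_splits)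
  moreover have "inj_on \<sigma> (dom A)"
  proof (rule inj_onI, rule ccontr)
    fix j k assume jk: "j \<in> dom A" "k \<in> dom A" "\<sigma> j = \<sigma> k" "j \<noteq> k"
    then have "mach j = mach k" "\<lfloor>start j\<rfloor> = \<lfloor>start k\<rfloor>" by (auto simp: \<sigma>_def)
    then show False using s[of j k] jk assms(1) by linarith
  qed
  moreover have "p < m \<and> a \<le> t \<and> t + 1 \<le> d" if "A j = Some (a, d)" "\<sigma> j = Some (p, t)" for j a d p t
  proof -
    have "p = mach j" "t = \<lfloor>start j\<rfloor>" using that by (auto simp: \<sigma>_def split: if_splits)
    then show ?thesis using w[OF that(1)] assms(1) by (auto simp: le_floor_iff) linarith
  qed
  ultimately have "feasible m A \<sigma>" unfolding feasible_def by auto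
  then show ?thesis by blast
qed

end

theory Submission imports Defs "HOL-Combinatorics.Transposition" begin

text \<open>
  Shrink every window to an aligned dyadic one and distribute the jobs of each dyadic window evenly
  over the machines: a deletion then forces at most one migration, and on every machine the number
  of jobs whose window lies in a dyadic interval is at most a small constant fraction of its length.

  On one machine the jobs carry distinct numbers \<open>0, \<dots>, n - 1\<close>, and the window of job number \<open>q\<close> is
  trimmed to length \<open>O(q + 1)\<close>. So few jobs have small numbers that the density stays small, while
  all lengths become \<open>O(min \<Delta> n)\<close>; a deletion changes the number of one other job only.

  The exponents of the window lengths are grouped into \<open>O(log\<^sup>* )\<close> levels, and a window is regarded as
  a union of intervals whose length is the first one of its level. Each window reserves slots in all
  its intervals, about twice as many as it has jobs; an interval grants reservations to short
  windows first, from a quarter of its slots, less those needed for jobs of lower levels. By Markov's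
  inequality at least half of the intervals of a window grant everything, so there is a grant for
  every job. The grants depend only on the current set of jobs, and one request decreases them by
  \<open>O(1)\<close> per level. A job that loses its grant moves to another interval of its window, swapping places
  with a job of a higher level if necessary; such a job does not leave its own interval. A new job
  displaces at most one job on each higher level.
\<close>

subsection \<open>Levels\<close>

text \<open>A chain of displacements with one link per window length would cost the logarithm of the
  span; grouping leaves one link per level. What limits a level is rounding: each of its exponents
  claims one additional reservation in every interval, so a level that starts at b has room for only
  a fraction of 2 ^ b exponents. Spending a sixteenth of the interval on them makes the levels grow
  like a tower of powers, whence the iterated logarithm. Short windows go first because then only
  jobs inside a window compete with its reservations, and the density of that one window controls
  all of them. The quarter is chosen so that old and new grants together fill at most half of an
  interval, which leaves room while jobs are moved. The densities, in jobs per slot and machine, are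
  1/256 for aligned windows, 1/128 after dividing the jobs among machines and 1/64 after trimming.
  The original windows of the jobs aligned into a dyadic interval lie in a range five times as long,
  and 2048 exceeds 5 * 256. At density 1/64 the window of a job has at least 64 = 2 ^ 6 slots, where
  the first level starts.\<close>

fun lev :: "nat \<Rightarrow> nat" where
  "lev 0 = 6"
| "lev (Suc l) = lev l + 2 ^ lev l div 16"

declare lev.simps(2)[simp del]

lemma lev_ge_6: "6 \<le> lev l"
  by (induction l) (auto simp: lev.simps(2))

lemma power_lev_ge: "4 \<le> (2::nat) ^ lev l div 16"
proof -
  have "(2::nat) ^ 6 \<le> 2 ^ lev l" using lev_ge_6 by (intro power_increasing) auto
  then show ?thesis by simp
qed

lemma lev_Suc_ge: "lev l + 4 \<le> lev (Suc l)"
  using power_lev_ge[of l] by (simp add: lev.simps(2))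

lemma strict_mono_lev: "strict_mono lev"
  unfolding strict_mono_Suc_iff using lev_Suc_ge by (metis add_leE less_add_same_cancel1 order_less_le_trans zero_less_numeral)

lemma lev_gt_index: "l < lev l"
proof (induction l)
  case (Suc l)
  then show ?case using lev_Suc_ge[of l] by linarith
qed simp

text \<open>One step is not enough because of the division by 16. The first step adds at least 4 to
  the exponent, so the power gains a factor 16, which cancels the division in the second
  step.\<close>

lemma lev_Suc_Suc_ge: "2 ^ lev l \<le> lev (Suc (Suc l))"
proof -
  have "(2::nat) ^ lev l * 16 = 2 ^ (lev l + 4)" by (simp add: power_add)
  also have "\<dots> \<le> 2 ^ lev (Suc l)" using lev_Suc_ge by (intro power_increasing) auto
  finally have "2 ^ lev l \<le> 2 ^ lev (Suc l) div (16::nat)" by (simp add: less_eq_div_iff_mult_less_eq)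
  then show ?thesis using trans_le_add2 by (simp only: lev.simps(2)[of "Suc l"])
qed

text \<open>The first exponent of the level of \<open>e\<close>; junk value \<open>0\<close> for \<open>e < 6\<close>, but jobs of such a
  short window do not occur, the density being small.\<close>

definition base :: "nat \<Rightarrow> nat" where
  "base e = Max (insert 0 (lev ` {l. lev l \<le> e}))"

lemma finite_lev_le: "finite {l. lev l \<le> e}"
  by (rule finite_subset[of _ "{..e}"]) (use lev_gt_index in \<open>auto intro: less_imp_le order.trans\<close>)

lemma base_le: "base e \<le> e"
  unfolding base_def using finite_lev_le by (subst Max_le_iff) auto

lemma base_mono: "e \<le> e' \<Longrightarrow> base e \<le> base e'"
  unfolding base_def using finite_lev_le by (intro Max_mono) auto

lemma lev_le_base: "lev l \<le> e \<Longrightarrow> lev l \<le> base e"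
  unfolding base_def using finite_lev_le by (intro Max_ge) auto

lemma base_in: "base e \<in> insert 0 (lev ` {l. lev l \<le> e})"
  unfolding base_def using finite_lev_le by (intro Max_in) auto

lemma base_base: "base (base e) = base e"
  using base_in[of e] base_le[of "base e"] lev_le_base[of _ "base e"] by (auto intro: antisym)

text \<open>Swaps across levels rest on this: an interval of a higher level is longer than any
  window of a lower one, and being dyadic it contains each such window that it meets.\<close>

lemma base_less_imp: "base e < base e' \<Longrightarrow> e < base e'"
  using base_mono[of "base e'" e] base_base by (metis leD not_le_imp_less)

text \<open>This is the budget for the summand \<open>+ 1\<close> in \<open>demand\<close>: one slot
  for each exponent of the level up to \<open>e\<close> takes at most a sixteenth of an
  interval.\<close>

lemma base_height:
  assumes "6 \<le> e"
  shows "6 \<le> base e" and "16 * (Suc e - base e) \<le> 2 ^ base e"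
proof -
  show b6: "6 \<le> base e" using lev_le_base[of 0 e] assms by simp
  then obtain l where l: "base e = lev l" using base_in[of e] by auto
  have "\<not> lev (Suc l) \<le> e"
    using lev_le_base[of "Suc l" e] l lev_Suc_ge[of l] by auto
  then have "Suc e \<le> lev l + 2 ^ lev l div 16" by (simp add: lev.simps(2))
  then have "Suc e - base e \<le> 2 ^ lev l div 16" using l by simp
  then show "16 * (Suc e - base e) \<le> 2 ^ base e" using l by simp
qed

section \<open>The number of levels and the iterated logarithm\<close>

definition levels :: "nat \<Rightarrow> nat" where
  "levels M = card (base ` {e. 2 ^ e \<le> M})"

lemma finite_exps: "finite {e. (2::nat) ^ e \<le> M}"
  by (rule finite_subset[of _ "{..M}"]) (auto intro: order.trans[OF less_imp_le[OF less_exp]])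

text \<open>By \<open>lev_Suc_Suc_ge\<close> one logarithm of \<open>x\<close> pays for two levels,
  hence the factor 2 in the bounds that follow.\<close>

lemma lev_le_log_star: "0 < x \<Longrightarrow> real (lev (2 * i)) \<le> log 2 x \<Longrightarrow> i \<le> log_star x"
proof (induction i arbitrary: x)
  case (Suc i)
  have "(2::real) ^ lev (2 * i) \<le> real (lev (2 * Suc i))"
    using lev_Suc_Suc_ge[of "2 * i"] by (metis add_2_eq_Suc' mult_Suc_right add.commute of_nat_le_iff of_nat_numeral of_nat_power)
  then have a: "2 ^ lev (2 * i) \<le> log 2 x" using Suc.prems by linarith
  moreover have "(1::real) \<le> 2 ^ lev (2 * i)" by simp
  ultimately have l1: "1 \<le> log 2 x" by linarith
  have "x > 1"
  proof (rule ccontr)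
    assume "\<not> x > 1"
    then have "log 2 x \<le> 0" using Suc.prems by simp
    then show False using l1 by simp
  qed
  have "real (lev (2 * i)) \<le> log 2 (log 2 x)"
    using a l1 by (subst le_log_iff) (auto simp: powr_realpow)
  then show ?case using Suc.IH[of "log 2 x"] l1 log_star_gt_1[OF \<open>x > 1\<close>] by simp
qed simp

lemma lev_le_log_star':
  assumes "0 < x" "real (lev l) \<le> log 2 x" shows "l \<le> 2 * log_star x + 1"
proof -
  have "lev (2 * (l div 2)) \<le> lev l"
    using strict_mono_lev by (simp add: strict_mono_less_eq)
  then have "l div 2 \<le> log_star x" using assms by (intro lev_le_log_star) linarith+
  then show ?thesis by linarith
qed

lemma levels_le_log_star:
  assumes "1 \<le> n" "1 \<le> D" "real M \<le> D" "M \<le> 256 * n"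
  shows "levels M \<le> 2 * min (log_star (real n)) (log_star D) + 5"
proof -
  \<comment> \<open>The levels 0 to \<open>?k\<close> and the junk value 0 of \<open>base\<close>
    make \<open>?k + 2\<close> values.\<close>
  let ?k = "2 * min (log_star (real n)) (log_star D) + 3"
  have "base ` {e. 2 ^ e \<le> M} \<subseteq> insert 0 (lev ` {..?k})"
  proof
    fix b assume "b \<in> base ` {e. 2 ^ e \<le> M}"
    then obtain e where e: "2 ^ e \<le> M" "b = base e" by auto
    show "b \<in> insert 0 (lev ` {..?k})"
    proof (cases "b = 0")
      case False
      then obtain l where l: "b = lev l" "lev l \<le> e" using base_in[of e] e by auto
      have "(2::real) ^ e \<le> real M"
        using e(1) by (metis of_nat_le_iff of_nat_numeral of_nat_power)
      moreover have "real M \<le> 256 * real n" using assms(4) by linarith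
      ultimately have "(2::real) ^ e \<le> D" "(2::real) ^ e \<le> 256 * real n"
        using assms(3) by linarith+
      then have eD: "real e \<le> log 2 D" and en: "real e \<le> log 2 (256 * real n)"
        using assms(1,2) by (auto simp: le_log_iff powr_realpow)
      have "l \<le> 2 * log_star D + 1" using eD l(2) assms(2) by (intro lev_le_log_star') linarith+
      moreover have "l \<le> 2 * log_star (real n) + 3"
      proof (cases "l < 2")
        case False
        then obtain l' where l': "l = Suc (Suc l')" by (metis add_2_eq_Suc le_Suc_ex not_less)
        \<comment> \<open>Each step of \<open>lev\<close> adds at least 4. Two levels down, the
          exponent has dropped by 8, the logarithm of 256, and the factor 256 is absorbed.\<close>
        have "lev l' + 8 \<le> e" using lev_Suc_ge[of l'] lev_Suc_ge[of "Suc l'"] l(2) l' by simp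
        moreover have "log 2 (256 * real n) = 8 + log 2 (real n)"
        proof -
          have "log 2 (256::real) = 8" using log_pow_cancel[of 2 8] by simp
          then show ?thesis using assms(1) by (simp add: log_mult)
        qed
        ultimately have "real (lev l') \<le> log 2 (real n)" using en by linarith
        then show ?thesis using lev_le_log_star'[of "real n" l'] l' assms(1) by simp
      qed simp
      ultimately have "l \<le> ?k" by linarith
      then show ?thesis using l(1) by simp
    qed simp
  qed
  then have "levels M \<le> card (insert 0 (lev ` {..?k}))"
    unfolding levels_def by (intro card_mono) auto
  also have "\<dots> \<le> Suc (card (lev ` {..?k}))" by (rule card_insert_le_m1[THEN le_trans]) (auto simp: card_insert_if)
  also have "\<dots> \<le> Suc (Suc ?k)" using card_image_le[of "{..?k}" lev] by simp
  finally show ?thesis by simp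
qed

subsection \<open>Reservations\<close>

text \<open>The pair \<open>(e, k)\<close> stands for the dyadic window of the slots \<open>t\<close> with \<open>t div 2 ^ e = k\<close>.\<close>

type_synonym djobs = "job \<rightharpoonup> nat \<times> int"

definition inside :: "nat \<times> int \<Rightarrow> nat \<times> int \<Rightarrow> bool" where
  "inside W V \<longleftrightarrow> fst W \<le> fst V \<and> snd W div 2 ^ (fst V - fst W) = snd V"

definition sparse :: "nat \<Rightarrow> djobs \<Rightarrow> bool" where
  "sparse K B \<longleftrightarrow> finite (dom B) \<and>
     (\<forall>V. K * card {j. \<exists>W. B j = Some W \<and> inside W V} \<le> 2 ^ fst V)"

definition weight :: "djobs \<Rightarrow> nat \<times> int \<Rightarrow> nat" where
  "weight B W = card {j. B j = Some W}"

text \<open>A dyadic window of exponent below \<open>b\<close> lies inside the interval or is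
  disjoint from it, so these jobs use slots of the interval wherever they are placed. Counting
  windows instead of positions keeps the grants independent of the schedule.\<close>

definition low_load :: "djobs \<Rightarrow> nat \<Rightarrow> int \<Rightarrow> nat" where
  "low_load B b \<kappa> = card {j. \<exists>e k. B j = Some (e, k) \<and> e < b \<and> inside (e, k) (b, \<kappa>)}"

text \<open>Below, \<open>b\<close> is the first exponent of a level, \<open>\<kappa>\<close> an interval \<open>(b, \<kappa>)\<close>, and \<open>e \<ge> b\<close> selects the window
  of exponent \<open>e\<close> around this interval. A window with \<open>x\<close> jobs and \<open>N = 2 ^ (e - b)\<close> intervals makes
  \<open>2 * x + N\<close> reservations, spread as evenly as possible.\<close>

definition demand :: "djobs \<Rightarrow> nat \<Rightarrow> nat \<Rightarrow> int \<Rightarrow> nat" where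
  "demand B b e \<kappa> =
     (2 * weight B (e, \<kappa> div 2 ^ (e - b)) + nat (\<kappa> mod 2 ^ (e - b))) div 2 ^ (e - b) + 1"

text \<open>Subtracting the demands of the shorter windows leaves the same remainder as subtracting
  their grants would, since the truncated difference is 0 as soon as a demand has been cut; the
  definition thus needs no recursion.\<close>

definition grant_at :: "djobs \<Rightarrow> nat \<Rightarrow> nat \<Rightarrow> int \<Rightarrow> nat" where
  "grant_at B b e \<kappa> = min (demand B b e \<kappa>) ((2 ^ b div 4 - low_load B b \<kappa>) - (\<Sum>e'\<in>{b..<e}. demand B b e' \<kappa>))"

definition grant :: "djobs \<Rightarrow> nat \<Rightarrow> int \<Rightarrow> nat" where
  "grant B e \<kappa> = grant_at B (base e) e \<kappa>"

section \<open>Arithmetic of dyadic intervals\<close>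

lemma div_power_div: "b \<le> e \<Longrightarrow> (t::int) div 2 ^ b div 2 ^ (e - b) = t div 2 ^ e"
  by (metis le_add_diff_inverse power_add zdiv_zmult2_eq zero_le_numeral zero_le_power)

lemma div_power_eq_mono: "(s::int) div 2 ^ b = t div 2 ^ b \<Longrightarrow> b \<le> e \<Longrightarrow> s div 2 ^ e = t div 2 ^ e"
  by (metis div_power_div)

lemma inside_refl: "inside W W" by (simp add: inside_def)

lemma inside_trans:
  assumes "inside U V" "inside V W" shows "inside U W"
proof -
  have "snd U div 2 ^ (fst V - fst U) div 2 ^ (fst W - fst V) = snd U div 2 ^ (fst W - fst U)"
    using div_power_div[of "fst V - fst U" "fst W - fst U" "snd U"] assms
    by (auto simp: inside_def diff_le_mono)
  then show ?thesis using assms by (simp add: inside_def)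
qed

lemma inside_slot: "t div 2 ^ e = k \<Longrightarrow> inside (e, k) (v, c) \<Longrightarrow> t div 2 ^ v = c"
  unfolding inside_def using div_power_div by auto

lemma div_fiber_eq:
  fixes p :: int
  assumes "0 < p"
  shows "{\<kappa>. \<kappa> div p = k} = {k * p..<k * p + p}"
proof (intro set_eqI iffI)
  fix \<kappa> assume "\<kappa> \<in> {\<kappa>. \<kappa> div p = k}"
  then have "k * p + \<kappa> mod p = \<kappa>" using div_mult_mod_eq[of \<kappa> p] by simp
  then show "\<kappa> \<in> {k * p..<k * p + p}"
    using pos_mod_bound[of p \<kappa>] pos_mod_sign[of p \<kappa>] assms
    unfolding atLeastLessThan_iff by linarith
next
  fix \<kappa> assume \<kappa>: "\<kappa> \<in> {k * p..<k * p + p}"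
  have "\<kappa> = p * k + (\<kappa> - k * p)" by simp
  moreover have "0 \<le> \<kappa> - k * p" "\<kappa> - k * p < p" using \<kappa> by auto
  ultimately have "\<kappa> div p = k" by (rule int_div_pos_eq)
  then show "\<kappa> \<in> {\<kappa>. \<kappa> div p = k}" by blast
qed

lemma div_power_fiber_eq: "{\<kappa>::int. \<kappa> div 2 ^ n = k} = {k * 2 ^ n..<k * 2 ^ n + 2 ^ n}"
  by (rule div_fiber_eq) simp

lemma finite_div_power_fiber [simp]: "finite {\<kappa>::int. \<kappa> div 2 ^ n = k}"
  by (simp add: div_power_fiber_eq)

lemma card_div_power_fiber [simp]: "card {\<kappa>::int. \<kappa> div 2 ^ n = k} = 2 ^ n"
  by (simp add: div_power_fiber_eq nat_power_eq)

lemma sum_div_power_fiber_reindex: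
  "(\<Sum>\<kappa> | \<kappa> div 2 ^ n = (k::int). f (nat (\<kappa> mod 2 ^ n))) = (\<Sum>q<2 ^ n. f q)"
proof (rule sum.reindex_bij_witness[of _ "\<lambda>q. k * 2 ^ n + int q" "\<lambda>\<kappa>. nat (\<kappa> mod 2 ^ n)"])
  fix \<kappa> :: int assume "\<kappa> \<in> {\<kappa>. \<kappa> div 2 ^ n = k}"
  then show "k * 2 ^ n + int (nat (\<kappa> mod 2 ^ n)) = \<kappa>" using div_mult_mod_eq by auto
  have "\<kappa> mod 2 ^ n < 2 ^ n" by simp
  then show "nat (\<kappa> mod 2 ^ n) \<in> {..<2 ^ n}"
    by (metis lessThan_iff nat_less_iff of_nat_numeral of_nat_power pos_mod_sign zero_less_numeral zero_less_power)
next
  fix q :: nat assume "q \<in> {..<2 ^ n}"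
  then have q: "int q < 2 ^ n" by (metis lessThan_iff of_nat_less_iff of_nat_numeral of_nat_power)
  then show "nat ((k * 2 ^ n + int q) mod 2 ^ n) = q" by simp
  show "k * 2 ^ n + int q \<in> {\<kappa>. \<kappa> div 2 ^ n = k}" using q by simp
qed simp

text \<open>Hermite's identity. Raising \<open>y\<close> by one drops the term
  \<open>y div N\<close> and gains \<open>(y + N) div N\<close>, which is larger by one.\<close>

lemma sum_div_shift: "0 < N \<Longrightarrow> (\<Sum>q<N. (y + q) div N) = (y::nat)"
proof (induction y)
  case (Suc y)
  have "(\<Sum>q<N. (Suc y + q) div N) + y div N = (\<Sum>q<Suc N. (y + q) div N)"
    by (subst sum.lessThan_Suc_shift) simp
  also have "\<dots> = y + (y + N) div N" using Suc by simp
  finally show ?case using Suc.prems by simp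
qed simp

lemma sum_card_fibers:
  assumes "finite K" "finite J"
  shows "(\<Sum>k\<in>K. card {j \<in> J. f j = k}) = card {j \<in> J. f j \<in> K}"
proof -
  have "{j \<in> J. f j \<in> K} = (\<Union>k\<in>K. {j \<in> J. f j = k})" by auto
  then show ?thesis using assms by (subst card_UN_disjoint[symmetric]) auto
qed

text \<open>The intervals of a window run through all residues once, so Hermite's identity applies.
  Because the total is exact, one more job raises it by exactly 2.\<close>

lemma sum_demand:
  assumes "b \<le> e"
  shows "(\<Sum>\<kappa> | \<kappa> div 2 ^ (e - b) = k. demand B b e \<kappa>) = 2 * weight B (e, k) + 2 ^ (e - b)"
proof -
  have "(\<Sum>\<kappa> | \<kappa> div 2 ^ (e - b) = k. demand B b e \<kappa>) =
        (\<Sum>\<kappa> | \<kappa> div 2 ^ (e - b) = k.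
           (2 * weight B (e, k) + nat (\<kappa> mod 2 ^ (e - b))) div 2 ^ (e - b) + 1)"
    by (rule sum.cong) (auto simp: demand_def)
  also have "\<dots> = (\<Sum>q<2 ^ (e - b). (2 * weight B (e, k) + q) div 2 ^ (e - b) + 1)"
    by (rule sum_div_power_fiber_reindex)
  also have "\<dots> = 2 * weight B (e, k) + 2 ^ (e - b)"
    by (subst sum.distrib) (simp add: sum_div_shift)
  finally show ?thesis .
qed

lemma sum_div_power_fiber_group:
  fixes f :: "int \<Rightarrow> nat"
  assumes "b \<le> e'" "e' \<le> e"
  shows "(\<Sum>\<kappa> | \<kappa> div 2 ^ (e - b) = k. f \<kappa>) =
         (\<Sum>k' | k' div 2 ^ (e - e') = k. \<Sum>\<kappa> | \<kappa> div 2 ^ (e' - b) = k'. f \<kappa>)"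
proof -
  have dd: "\<kappa> div 2 ^ (e' - b) div 2 ^ (e - e') = \<kappa> div 2 ^ (e - b)" for \<kappa> :: int
    using div_power_div[of "e' - b" "e - b" \<kappa>] assms by simp
  have "(\<Sum>\<kappa> | \<kappa> div 2 ^ (e - b) = k. f \<kappa>) =
        (\<Sum>k' | k' div 2 ^ (e - e') = k.
           \<Sum>\<kappa> \<in> {\<kappa> \<in> {\<kappa>. \<kappa> div 2 ^ (e - b) = k}. \<kappa> div 2 ^ (e' - b) = k'}. f \<kappa>)"
    by (rule sum.group[symmetric]) (auto simp: dd)
  also have "\<dots> = (\<Sum>k' | k' div 2 ^ (e - e') = k. \<Sum>\<kappa> | \<kappa> div 2 ^ (e' - b) = k'. f \<kappa>)"
    by (intro sum.cong refl) (auto simp: dd[symmetric])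
  finally show ?thesis .
qed

text \<open>A window of exponent between \<open>b\<close> and \<open>e\<close> around an interval of
  \<open>(e, k)\<close> lies inside \<open>(e, k)\<close>. It reserves two slots per job and one per
  interval; so each job inside \<open>(e, k)\<close> counts at most twice, and each of the
  \<open>Suc e - b\<close> exponents contributes the number of intervals once.\<close>

lemma sum_total_demand:
  assumes fin: "finite (dom B)" and "b \<le> e"
  shows "(\<Sum>\<kappa> | \<kappa> div 2 ^ (e - b) = k. low_load B b \<kappa> + (\<Sum>e'\<in>{b..<Suc e}. demand B b e' \<kappa>))
         \<le> 2 * card {j. \<exists>W. B j = Some W \<and> inside W (e, k)} + 2 ^ (e - b) * (Suc e - b)"
proof -
  define w where "w j = the (B j)" for j
  define J where "J = {j. \<exists>W. B j = Some W \<and> inside W (e, k)}"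
  have finJ: "finite J" unfolding J_def by (rule finite_subset[OF _ fin]) auto
  have low_load: "low_load B b \<kappa> = card {j \<in> {j \<in> J. fst (w j) < b}. snd (w j) div 2 ^ (b - fst (w j)) = \<kappa>}"
    if "\<kappa> div 2 ^ (e - b) = k" for \<kappa>
  proof -
    have i: "inside (b, \<kappa>) (e, k)" using that assms(2) by (simp add: inside_def)
    have ib: "inside W (b, \<kappa>) \<longleftrightarrow> snd W div 2 ^ (b - fst W) = \<kappa>" if "fst W < b" for W
      using that by (simp add: inside_def)
    have "{j. \<exists>e k. B j = Some (e, k) \<and> e < b \<and> inside (e, k) (b, \<kappa>)} =
          {j. \<exists>W. B j = Some W \<and> inside W (e, k) \<and> fst W < b \<and> snd W div 2 ^ (b - fst W) = \<kappa>}"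
      using inside_trans[OF _ i] by (auto simp: ib) (simp add: inside_def)
    also have "\<dots> = {j \<in> {j \<in> J. fst (w j) < b}. snd (w j) div 2 ^ (b - fst (w j)) = \<kappa>}"
      by (auto simp: J_def w_def)
    finally show ?thesis unfolding low_load_def by simp
  qed
  have wt: "weight B (e', k') = card {j \<in> {j \<in> J. fst (w j) = e'}. snd (w j) = k'}"
    if "k' div 2 ^ (e - e') = k" "e' \<le> e" for e' k'
  proof -
    have "inside (e', k') (e, k)" using that by (simp add: inside_def)
    then have "{j. B j = Some (e', k')} = {j \<in> {j \<in> J. fst (w j) = e'}. snd (w j) = k'}"
      by (auto simp: J_def w_def)
    then show ?thesis unfolding weight_def by simp
  qed
  have s1: "(\<Sum>\<kappa> | \<kappa> div 2 ^ (e - b) = k. low_load B b \<kappa>) \<le> card {j \<in> J. fst (w j) < b}"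
  proof -
    have "(\<Sum>\<kappa> | \<kappa> div 2 ^ (e - b) = k. low_load B b \<kappa>) =
      (\<Sum>\<kappa> | \<kappa> div 2 ^ (e - b) = k.
         card {j \<in> {j \<in> J. fst (w j) < b}. snd (w j) div 2 ^ (b - fst (w j)) = \<kappa>})"
      using low_load by (intro sum.cong) auto
    also have "\<dots> \<le> card {j \<in> J. fst (w j) < b}"
      using finJ by (subst sum_card_fibers) (auto intro!: card_mono)
    finally show ?thesis .
  qed
  have s2: "(\<Sum>\<kappa> | \<kappa> div 2 ^ (e - b) = k. demand B b e' \<kappa>)
            \<le> 2 * card {j \<in> J. fst (w j) = e'} + 2 ^ (e - b)"
    if e': "e' \<in> {b..<Suc e}" for e'
  proof -
    have "(\<Sum>\<kappa> | \<kappa> div 2 ^ (e - b) = k. demand B b e' \<kappa>) =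
          (\<Sum>k' | k' div 2 ^ (e - e') = k. 2 * weight B (e', k') + 2 ^ (e' - b))"
    proof -
      have "b \<le> e'" "e' \<le> e" using e' by auto
      then show ?thesis by (simp only: sum_div_power_fiber_group[of b e' e] sum_demand)
    qed
    also have "\<dots> = 2 * (\<Sum>k' | k' div 2 ^ (e - e') = k. weight B (e', k')) + 2 ^ (e - e') * 2 ^ (e' - b)"
      by (simp add: sum.distrib sum_distrib_left)
    also have "2 ^ (e - e') * 2 ^ (e' - b) = (2::nat) ^ (e - b)"
      using e' by (simp add: power_add[symmetric])
    also have "(\<Sum>k' | k' div 2 ^ (e - e') = k. weight B (e', k')) =
               (\<Sum>k' | k' div 2 ^ (e - e') = k. card {j \<in> {j \<in> J. fst (w j) = e'}. snd (w j) = k'})"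
      using wt e' by (intro sum.cong) auto
    also have "\<dots> \<le> card {j \<in> J. fst (w j) = e'}"
      using finJ by (subst sum_card_fibers) (auto intro!: card_mono)
    finally show ?thesis by simp
  qed
  have "(\<Sum>\<kappa> | \<kappa> div 2 ^ (e - b) = k. low_load B b \<kappa> + (\<Sum>e'\<in>{b..<Suc e}. demand B b e' \<kappa>)) =
        (\<Sum>\<kappa> | \<kappa> div 2 ^ (e - b) = k. low_load B b \<kappa>) +
        (\<Sum>e'\<in>{b..<Suc e}. \<Sum>\<kappa> | \<kappa> div 2 ^ (e - b) = k. demand B b e' \<kappa>)"
    using sum.distrib[of "low_load B b" "\<lambda>\<kappa>. \<Sum>e'\<in>{b..<Suc e}. demand B b e' \<kappa>" "{\<kappa>. \<kappa> div 2 ^ (e - b) = k}"]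
      sum.swap[of "\<lambda>\<kappa> e'. demand B b e' \<kappa>" "{b..<Suc e}" "{\<kappa>. \<kappa> div 2 ^ (e - b) = k}"]
    by argo
  also have "\<dots> \<le> card {j \<in> J. fst (w j) < b} +
        (\<Sum>e'\<in>{b..<Suc e}. 2 * card {j \<in> J. fst (w j) = e'} + 2 ^ (e - b))"
    using s1 s2 by (intro add_mono sum_mono) auto
  finally have A: "(\<Sum>\<kappa> | \<kappa> div 2 ^ (e - b) = k. low_load B b \<kappa> + (\<Sum>e'\<in>{b..<Suc e}. demand B b e' \<kappa>))
    \<le> card {j \<in> J. fst (w j) < b} +
        (\<Sum>e'\<in>{b..<Suc e}. 2 * card {j \<in> J. fst (w j) = e'} + 2 ^ (e - b))" .
  have "(\<Sum>e'\<in>{b..<Suc e}. 2 * card {j \<in> J. fst (w j) = e'} + 2 ^ (e - b)) =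
        2 * (\<Sum>e'\<in>{b..<Suc e}. card {j \<in> J. fst (w j) = e'}) + 2 ^ (e - b) * (Suc e - b)"
    by (simp only: sum.distrib sum_distrib_left sum_constant card_atLeastLessThan) simp
  also have "(\<Sum>e'\<in>{b..<Suc e}. card {j \<in> J. fst (w j) = e'}) =
             card {j \<in> J. fst (w j) \<in> {b..<Suc e}}"
    using finJ by (intro sum_card_fibers) auto
  finally have D: "(\<Sum>e'\<in>{b..<Suc e}. 2 * card {j \<in> J. fst (w j) = e'} + 2 ^ (e - b)) =
    2 * card {j \<in> J. fst (w j) \<in> {b..<Suc e}} + 2 ^ (e - b) * (Suc e - b)" .
  have "card {j \<in> J. fst (w j) < b} + card {j \<in> J. fst (w j) \<in> {b..<Suc e}} =
        card ({j \<in> J. fst (w j) < b} \<union> {j \<in> J. fst (w j) \<in> {b..<Suc e}})"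
    using finJ by (intro card_Un_disjoint[symmetric]) auto
  also have "\<dots> \<le> card J"
    using finJ by (intro card_mono) auto
  finally show ?thesis using A D unfolding J_def[symmetric] by linarith
qed

text \<open>Every interval demands at least \<open>dm\<close>, and \<open>dm\<close> times the
  number of intervals is at least twice the number of jobs. So it does not matter which half of the
  intervals refuses. Here the summand \<open>+ 1\<close> in \<open>demand\<close> is essential:
  otherwise a window with few jobs would demand slots in a few intervals only, and all of these
  could refuse.\<close>

lemma grants_cover:
  assumes "sparse 64 B" "6 \<le> e"
  shows "weight B (e, k) \<le> (\<Sum>\<kappa> | \<kappa> div 2 ^ (e - base e) = k. grant B e \<kappa>)"
proof -
  define b where "b = base e"
  define N :: nat where "N = 2 ^ (e - b)"
  define C :: nat where "C = 2 ^ b div 4"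
  define x where "x = weight B (e, k)"
  define dm where "dm = 2 * x div N + 1"
  define T where "T \<kappa> = low_load B b \<kappa> + (\<Sum>e'\<in>{b..<Suc e}. demand B b e' \<kappa>)" for \<kappa>
  define W where "W = {\<kappa>::int. \<kappa> div 2 ^ (e - b) = k}"
  have b: "6 \<le> b" "16 * (Suc e - b) \<le> 2 ^ b" "b \<le> e"
    using base_height[OF assms(2)] base_le b_def by auto
  have C: "2 ^ b = 4 * C"
  proof -
    have "(2::nat) ^ 2 dvd 2 ^ b" using b(1) by (intro le_imp_power_dvd) auto
    then show ?thesis unfolding C_def by simp
  qed
  have cardW: "card W = N" "finite W" unfolding W_def N_def by auto
  have Cpos: "0 < C" using C by (cases "C = 0") auto
  have Npos: "0 < N" by (simp add: N_def)
  have "64 * card {j. \<exists>W. B j = Some W \<and> inside W (e, k)} \<le> 2 ^ e"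
    using assms(1) unfolding sparse_def by (auto dest!: conjunct2 spec[of _ "(e, k)"])
  also have "2 ^ e = N * 2 ^ b" using b(3) by (simp add: N_def power_add[symmetric])
  finally have J: "64 * card {j. \<exists>W. B j = Some W \<and> inside W (e, k)} \<le> N * (4 * C)" using C by simp
  have "(\<Sum>\<kappa>\<in>W. T \<kappa>) \<le> 2 * card {j. \<exists>W. B j = Some W \<and> inside W (e, k)} + N * (Suc e - b)"
    unfolding T_def W_def N_def using assms(1) b(3) by (intro sum_total_demand) (auto simp: sparse_def)
  moreover have "N * (16 * (Suc e - b)) \<le> N * (4 * C)" using b(2) C by simp
  \<comment> \<open>On average \<open>T\<close> is at most 3/8 of \<open>C\<close>: twice the
    density 1/64 is an eighth of \<open>C\<close>, and the rounding surplus is at most a quarter of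
    it.\<close>
  ultimately have sT: "2 * (\<Sum>\<kappa>\<in>W. T \<kappa>) \<le> N * C" using J by (simp add: algebra_simps)
  \<comment> \<open>Markov's inequality as one linear estimate per interval, so that no intervals
    need to be counted: either the whole demand is granted, or \<open>dm * T \<kappa>\<close> alone
    exceeds the left side.\<close>
  have pt: "dm * C \<le> C * grant B e \<kappa> + dm * T \<kappa>" if "\<kappa> \<in> W" for \<kappa>
  proof (cases "T \<kappa> \<le> C")
    case True
    then have "grant B e \<kappa> = demand B b e \<kappa>"
      unfolding grant_def grant_at_def T_def C_def b_def[symmetric] using b(3) by simp
    moreover have "dm \<le> demand B b e \<kappa>"
      using that unfolding demand_def dm_def W_def N_def x_def by (auto intro: div_le_mono)
    ultimately have "dm * C \<le> C * grant B e \<kappa>" by simp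
    then show ?thesis by (rule trans_le_add1)
  next
    case False
    then show ?thesis by (simp add: trans_le_add2)
  qed
  define G where "G = (\<Sum>\<kappa>\<in>W. grant B e \<kappa>)"
  have "N * (dm * C) \<le> C * G + dm * (\<Sum>\<kappa>\<in>W. T \<kappa>)"
    using sum_mono[of W "\<lambda>_. dm * C", OF pt] cardW
    by (simp add: G_def sum.distrib sum_distrib_left)
  moreover have "dm * (2 * (\<Sum>\<kappa>\<in>W. T \<kappa>)) \<le> dm * (N * C)" using sT by (rule mult_le_mono2)
  moreover have "dm * (2 * (\<Sum>\<kappa>\<in>W. T \<kappa>)) = 2 * (dm * (\<Sum>\<kappa>\<in>W. T \<kappa>))" "dm * (N * C) = N * (dm * C)"
    by simp_all
  ultimately have "N * (dm * C) \<le> 2 * (C * G)" by linarith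
  then have "C * (N * dm) \<le> C * (2 * G)" by (simp only: ac_simps)
  then have "N * dm \<le> 2 * G" using Cpos by simp
  moreover have "2 * x \<le> N * dm"
  proof -
    have "2 * x = N * (2 * x div N) + 2 * x mod N" by simp
    also have "\<dots> \<le> N * (2 * x div N) + N" using Npos by (intro add_left_mono less_imp_le mod_less_divisor)
    finally show ?thesis by (simp add: dm_def)
  qed
  ultimately have "x \<le> G" by simp
  then show ?thesis unfolding x_def G_def W_def b_def .
qed

section \<open>Greedy allocation of the capacity of an interval\<close>

lemma sum_greedy_le:
  fixes d :: "nat \<Rightarrow> nat"
  shows "(\<Sum>e\<in>{b..<n}. min (d e) (c - (\<Sum>e'\<in>{b..<e}. d e'))) \<le> c"
proof -
  \<comment> \<open>The total demand is carried along in the bound: while it does not exceed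
    \<open>c\<close>, the next grant fits; afterwards all grants are 0.\<close>
  have "(\<Sum>e\<in>{b..<n}. min (d e) (c - (\<Sum>e'\<in>{b..<e}. d e'))) \<le> min c (\<Sum>e\<in>{b..<n}. d e)"
  proof (induction n)
    case (Suc n)
    then show ?case by (cases "b \<le> n") auto
  qed simp
  then show ?thesis by simp
qed

text \<open>A loss of capacity is passed on along the priority order until it meets a demand that it cuts;
  a gain causes no loss. This is why the first summand is a one-sided difference.\<close>

lemma sum_greedy_loss:
  fixes d d' :: "nat \<Rightarrow> nat"
  shows "(\<Sum>e\<in>{b..<n}. min (d e) (c - (\<Sum>e'\<in>{b..<e}. d e')) - min (d' e) (c' - (\<Sum>e'\<in>{b..<e}. d' e')))
         \<le> (c - c') + (\<Sum>e\<in>{b..<n}. (d e - d' e) + (d' e - d e))"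
proof -
  let ?D = "\<lambda>n. \<Sum>e'\<in>{b..<n}. d e'" and ?D' = "\<lambda>n. \<Sum>e'\<in>{b..<n}. d' e'"
  \<comment> \<open>With demands \<open>x\<close>, \<open>x'\<close> and remaining capacities
    \<open>u\<close>, \<open>u'\<close>: the loss of grant and the loss of capacity handed to the
    next window together exceed the incoming loss by at most the change of the demand.\<close>
  have step: "(min x u - min x' u') + ((u - x) - (u' - x')) \<le> (u - u') + ((x - x') + (x' - x))"
    for x x' u u' :: nat
    by (auto simp: min_def split: nat_diff_split)
  have comb: "S + R \<le> K + Z \<Longrightarrow> m + R' \<le> R + \<delta> \<Longrightarrow> (S + m) + R' \<le> K + (Z + \<delta>)"
    for S R K Z m R' \<delta> :: nat by linarith
  have "(\<Sum>e\<in>{b..<n}. min (d e) (c - ?D e) - min (d' e) (c' - ?D' e)) + ((c - ?D n) - (c' - ?D' n))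
         \<le> (c - c') + (\<Sum>e\<in>{b..<n}. (d e - d' e) + (d' e - d e))"
  proof (induction n)
    case (Suc n)
    show ?case
    proof (cases "b \<le> n")
      case True
      show ?thesis
        unfolding sum.atLeastLessThan_Suc[OF True] diff_diff_left[symmetric]
        by (rule comb[OF Suc step])
    qed simp
  qed simp
  then show ?thesis by (rule add_leD1)
qed

lemma level_set:
  assumes "base b = b" "6 \<le> b"
  obtains n where "{e. base e = b} = {b..<n}"
proof -
  define S where "S = {e. base e = b}"
  have "e \<le> b + 2 ^ b" if "base e = b" for e
    using base_height(2)[of e] that assms base_le[of e] by auto
  then have fin: "finite S" unfolding S_def by (auto intro: finite_subset[of _ "{..b + 2 ^ b}"])
  have ne: "b \<in> S" using assms by (simp add: S_def)
  have "S = {b..<Suc (Max S)}"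
  proof (intro set_eqI iffI)
    fix e assume "e \<in> S"
    then show "e \<in> {b..<Suc (Max S)}" using fin base_le[of e] by (auto simp: S_def less_Suc_eq_le)
  next
    fix e assume e: "e \<in> {b..<Suc (Max S)}"
    have "Max S \<in> S" using fin ne by (intro Max_in) auto
    then have "base e \<le> b" using e base_mono[of e "Max S"] by (auto simp: S_def)
    moreover have "b \<le> base e" using e base_mono[of b e] assms by auto
    ultimately show "e \<in> S" by (simp add: S_def)
  qed
  then show thesis using that S_def by blast
qed

lemma sum_grant_level_le:
  assumes "base b = b" "6 \<le> b"
  shows "(\<Sum>e | base e = b. grant B e \<kappa>) \<le> 2 ^ b div 4"
proof -
  obtain n where n: "{e. base e = b} = {b..<n}" using level_set assms by blast
  have "(\<Sum>e | base e = b. grant B e \<kappa>) = (\<Sum>e\<in>{b..<n}. grant_at B b e \<kappa>)"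
    using n by (intro sum.cong) (auto simp: grant_def)
  also have "\<dots> \<le> 2 ^ b div 4 - low_load B b \<kappa>" unfolding grant_at_def by (rule sum_greedy_le)
  finally show ?thesis by simp
qed

subsection \<open>Moving and inserting single jobs\<close>

definition occupancy :: "djobs \<Rightarrow> (job \<Rightarrow> int) \<Rightarrow> nat \<Rightarrow> int \<Rightarrow> nat" where
  "occupancy B \<pi> e \<kappa> = card {j. \<exists>k. B j = Some (e, k) \<and> \<pi> j div 2 ^ base e = \<kappa>}"

text \<open>The jobs that a newcomer on the level starting at \<open>b\<close> must not displace.
  Jobs of higher levels in the interval are left out, since they give way.\<close>

definition crowd :: "djobs \<Rightarrow> (job \<Rightarrow> int) \<Rightarrow> nat \<Rightarrow> int \<Rightarrow> job set" where
  "crowd B \<pi> b \<kappa> = {j. \<exists>e k. B j = Some (e, k) \<and> base e \<le> b \<and> \<pi> j div 2 ^ b = \<kappa>}"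

definition placed :: "djobs \<Rightarrow> (job \<Rightarrow> int) \<Rightarrow> bool" where
  "placed B \<pi> \<longleftrightarrow> finite (dom B) \<and> inj_on \<pi> (dom B) \<and>
     (\<forall>j e k. B j = Some (e, k) \<longrightarrow> \<pi> j div 2 ^ e = k)"

lemma finite_crowd: "finite (dom B) \<Longrightarrow> finite (crowd B \<pi> b \<kappa>)"
  by (rule finite_subset[of _ "dom B"]) (auto simp: crowd_def)

lemma finite_occupants: "finite (dom B) \<Longrightarrow> finite {j. \<exists>k. B j = Some (e, k) \<and> P j}"
  by (rule finite_subset[of _ "dom B"]) auto

lemma sparse_exp_ge:
  assumes "sparse 64 B" "B j = Some (e, k)"
  shows "6 \<le> e"
proof -
  have "64 * card {j. \<exists>W. B j = Some W \<and> inside W (e, k)} \<le> 2 ^ e"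
    using assms(1) unfolding sparse_def by (auto dest!: conjunct2 spec[of _ "(e, k)"])
  moreover have "0 < card {j. \<exists>W. B j = Some W \<and> inside W (e, k)}"
  proof (subst card_gt_0_iff, intro conjI)
    show "finite {j. \<exists>W. B j = Some W \<and> inside W (e, k)}"
      using assms(1) unfolding sparse_def by (auto intro: finite_subset[of _ "dom B"])
    show "{j. \<exists>W. B j = Some W \<and> inside W (e, k)} \<noteq> {}" using assms(2) inside_refl by blast
  qed
  ultimately have "(2::nat) ^ 6 \<le> 2 ^ e" by simp
  then show ?thesis by (rule power_le_imp_le_exp[rotated]) simp
qed

text \<open>A job of exponent below \<open>b\<close> that sits in the interval has its window inside
  it, so there are at most 2 ^ b / 64 of these. The remaining members belong to the level of
  \<open>b\<close> itself and are counted by occupancies. The bound \<open>u\<close> is left open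
  because it is the grants in one use and the sum of old and new grants in the other.\<close>

lemma crowd_card_less:
  assumes pl: "placed B \<pi>" and dn: "sparse 64 B" and b: "base b = b" "6 \<le> b"
    and u: "\<And>e. occupancy B \<pi> e \<kappa> \<le> u e"
    and su: "(\<Sum>e | base e = b. u e) \<le> 2 ^ b div 2"
  shows "card (crowd B \<pi> b \<kappa>) < 2 ^ b"
proof -
  obtain n where n: "{e. base e = b} = {b..<n}" using level_set b by blast
  define S where "S e = {j. \<exists>k. B j = Some (e, k) \<and> \<pi> j div 2 ^ base e = \<kappa>}" for e
  define I where "I = {j. \<exists>W. B j = Some W \<and> inside W (b, \<kappa>)}"
  have fin: "finite (dom B)" using pl by (simp add: placed_def)
  have finI: "finite I" unfolding I_def by (rule finite_subset[OF _ fin]) auto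
  have finS: "finite (S e)" for e unfolding S_def using finite_occupants[OF fin] .
  have "crowd B \<pi> b \<kappa> \<subseteq> I \<union> (\<Union>e\<in>{e. base e = b}. S e)"
  proof
    fix j assume "j \<in> crowd B \<pi> b \<kappa>"
    then obtain e k where j: "B j = Some (e, k)" "base e \<le> b" "\<pi> j div 2 ^ b = \<kappa>"
      by (auto simp: crowd_def)
    show "j \<in> I \<union> (\<Union>e\<in>{e. base e = b}. S e)"
    proof (cases "e < b")
      case True
      have "\<pi> j div 2 ^ e = k" using pl j(1) by (simp add: placed_def)
      then have "inside (e, k) (b, \<kappa>)"
        using True j(3) div_power_div[of e b "\<pi> j"] by (simp add: inside_def)
      then show ?thesis using j(1) by (auto simp: I_def)
    next
      case False
      then have "base e = b" using base_mono[of b e] b j(2) by simp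
      then show ?thesis using j by (auto simp: S_def)
    qed
  qed
  then have "card (crowd B \<pi> b \<kappa>) \<le> card (I \<union> (\<Union>e\<in>{e. base e = b}. S e))"
    using finI finS n by (intro card_mono) auto
  also have "\<dots> \<le> card I + card (\<Union>e\<in>{e. base e = b}. S e)" by (rule card_Un_le)
  also have "card (\<Union>e\<in>{e. base e = b}. S e) \<le> (\<Sum>e | base e = b. card (S e))"
    using n by (intro card_UN_le) auto
  also have "(\<Sum>e | base e = b. card (S e)) \<le> (\<Sum>e | base e = b. u e)"
    using u by (intro sum_mono) (auto simp: S_def occupancy_def)
  finally have "card (crowd B \<pi> b \<kappa>) \<le> card I + (\<Sum>e | base e = b. u e)" by simp
  moreover have "64 * card I \<le> 2 ^ b"
    using dn unfolding sparse_def I_def by (auto dest!: conjunct2 spec[of _ "(b, \<kappa>)"])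
  moreover have "(0::nat) < 2 ^ b" by simp
  ultimately show ?thesis using su by linarith
qed

text \<open>Free only with respect to the crowd: a job of a higher level may hold the slot.\<close>

lemma free_slot:
  assumes "finite (dom B)" "card (crowd B \<pi> b \<kappa>) < 2 ^ b"
  obtains s where "s div 2 ^ b = \<kappa>" "\<And>j. j \<in> crowd B \<pi> b \<kappa> \<Longrightarrow> \<pi> j \<noteq> s"
proof -
  have "card (\<pi> ` crowd B \<pi> b \<kappa>) < card {s::int. s div 2 ^ b = \<kappa>}"
    using card_image_le[OF finite_crowd[OF assms(1)], of \<pi>] assms(2) by (metis card_div_power_fiber le_less_trans)
  then have "\<not> {s::int. s div 2 ^ b = \<kappa>} \<subseteq> \<pi> ` crowd B \<pi> b \<kappa>"
    using card_mono[OF finite_imageI[OF finite_crowd[OF assms(1)]]] by (metis leD)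
  then show thesis using that by blast
qed

text \<open>Exchanging the contents of two slots of a window moves a job of a higher level only inside its
  own interval, because that interval contains the whole window.\<close>

lemma placed_transpose:
  assumes pl: "placed B \<pi>" and j: "B j = Some (e, k)"
    and s': "s' div 2 ^ e = k" "\<And>i. i \<in> crowd B \<pi> (base e) (s' div 2 ^ base e) \<Longrightarrow> \<pi> i \<noteq> s'"
  defines "\<pi>' \<equiv> transpose (\<pi> j) s' \<circ> \<pi>"
  shows "placed B \<pi>'"
    and "\<And>i e' k'. i \<noteq> j \<Longrightarrow> B i = Some (e', k') \<Longrightarrow> \<pi>' i div 2 ^ base e' = \<pi> i div 2 ^ base e'"
    and "card {i \<in> dom B. \<pi>' i \<noteq> \<pi> i} \<le> 2"
proof -
  define s where "s = \<pi> j"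
  have fin: "finite (dom B)" and inj: "inj_on \<pi> (dom B)"
    and win: "\<And>j e k. B j = Some (e, k) \<Longrightarrow> \<pi> j div 2 ^ e = k"
    using pl by (auto simp: placed_def)
  have se: "s div 2 ^ e = k" using win j s_def by simp
  have oth: "e < base e'" if "i \<noteq> j" "B i = Some (e', k')" "\<pi> i = s'" for i e' k'
  proof -
    have "i \<notin> crowd B \<pi> (base e) (s' div 2 ^ base e)" using s'(2) that(3) by blast
    then have "base e < base e'" using that by (auto simp: crowd_def)
    then show ?thesis by (rule base_less_imp)
  qed
  have npj: "\<pi> i \<noteq> s" if "i \<noteq> j" "i \<in> dom B" for i
    using inj_onD[OF inj, of i j] that j s_def by blast
  show own: "\<pi>' i div 2 ^ base e' = \<pi> i div 2 ^ base e'" if "i \<noteq> j" "B i = Some (e', k')" for i e' k'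
  proof (cases "\<pi> i = s'")
    case True
    then have "\<pi>' i = s" by (simp add: \<pi>'_def s_def)
    moreover have "s div 2 ^ base e' = s' div 2 ^ base e'"
      by (rule div_power_eq_mono[OF _ less_imp_le[OF oth[OF that True]]]) (simp only: se s'(1))
    ultimately show ?thesis using True by simp
  next
    case False
    moreover have "\<pi> i \<noteq> s" using npj that by blast
    ultimately show ?thesis by (simp add: \<pi>'_def s_def)
  qed
  have "\<pi>' i div 2 ^ e' = k'" if "B i = Some (e', k')" for i e' k'
  proof (cases "i = j")
    case True
    then show ?thesis using that j s'(1) by (simp add: \<pi>'_def)
  next
    case False
    then show ?thesis using div_power_eq_mono[OF own[OF False that] base_le] win[OF that] by simp
  qed
  moreover have "inj_on \<pi>' (dom B)" unfolding \<pi>'_def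
    by (rule comp_inj_on[OF inj]) (rule inj_on_transpose)
  ultimately show "placed B \<pi>'" using fin by (simp add: placed_def)
  have "{i \<in> dom B. \<pi>' i \<noteq> \<pi> i} \<subseteq> {i \<in> dom B. \<pi> i \<in> {s, s'}}"
    by (auto simp: \<pi>'_def s_def transpose_def)
  then have "card {i \<in> dom B. \<pi>' i \<noteq> \<pi> i} \<le> card {i \<in> dom B. \<pi> i \<in> {s, s'}}"
    using fin by (intro card_mono) auto
  also have "\<dots> \<le> card {s, s'}"
    by (rule card_inj_on_le[OF inj_on_subset[OF inj]]) auto
  also have "\<dots> \<le> 2" by (simp add: card_insert_if)
  finally show "card {i \<in> dom B. \<pi>' i \<noteq> \<pi> i} \<le> 2" .
qed

text \<open>A finite index set for the sum in \<open>excess\<close>; with a placed assignment every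
  other pair has occupancy 0.\<close>

definition cells :: "djobs \<Rightarrow> (nat \<times> int) set" where
  "cells B = (\<Union>j\<in>dom B. case the (B j) of (e, k) \<Rightarrow> {e} \<times> {\<kappa>. \<kappa> div 2 ^ (e - base e) = k})"

lemma finite_cells: "finite (dom B) \<Longrightarrow> finite (cells B)"
  unfolding cells_def by (auto split: prod.split)

lemma cellsE:
  assumes "(e, \<kappa>) \<in> cells B"
  obtains j where "B j = Some (e, \<kappa> div 2 ^ (e - base e))"
  using assms unfolding cells_def by (auto split: prod.splits)

lemma cellsI: "B j = Some (e, k) \<Longrightarrow> \<kappa> div 2 ^ (e - base e) = k \<Longrightarrow> (e, \<kappa>) \<in> cells B"
  unfolding cells_def by (force split: prod.splits)

definition excess :: "djobs \<Rightarrow> (job \<Rightarrow> int) \<Rightarrow> (nat \<Rightarrow> int \<Rightarrow> nat) \<Rightarrow> nat" where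
  "excess B \<pi> g = (\<Sum>(e, \<kappa>)\<in>cells B. occupancy B \<pi> e \<kappa> - g e \<kappa>)"

lemma sum_occupancy:
  assumes "placed B \<pi>"
  shows "(\<Sum>\<kappa> | \<kappa> div 2 ^ (e - base e) = k. occupancy B \<pi> e \<kappa>) = weight B (e, k)"
proof -
  have fin: "finite (dom B)" and win: "\<And>j e k. B j = Some (e, k) \<Longrightarrow> \<pi> j div 2 ^ e = k"
    using assms by (auto simp: placed_def)
  have dd: "\<pi> j div 2 ^ base e div 2 ^ (e - base e) = \<pi> j div 2 ^ e" for j
    using div_power_div base_le by blast
  have finw: "finite {j. B j = Some (e, k)}" by (rule finite_subset[OF _ fin]) auto
  have "occupancy B \<pi> e \<kappa> = card {j \<in> {j. B j = Some (e, k)}. \<pi> j div 2 ^ base e = \<kappa>}"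
    if "\<kappa> div 2 ^ (e - base e) = k" for \<kappa>
    unfolding occupancy_def
  proof (rule arg_cong[of _ _ card], intro set_eqI iffI)
    fix j assume "j \<in> {j. \<exists>k. B j = Some (e, k) \<and> \<pi> j div 2 ^ base e = \<kappa>}"
    then obtain k' where "B j = Some (e, k')" "\<pi> j div 2 ^ base e = \<kappa>" by auto
    moreover from this have "k' = k" using win dd[of j] that by force
    ultimately show "j \<in> {j \<in> {j. B j = Some (e, k)}. \<pi> j div 2 ^ base e = \<kappa>}" by simp
  qed auto
  then have "(\<Sum>\<kappa> | \<kappa> div 2 ^ (e - base e) = k. occupancy B \<pi> e \<kappa>) =
    (\<Sum>\<kappa> | \<kappa> div 2 ^ (e - base e) = k. card {j \<in> {j. B j = Some (e, k)}. \<pi> j div 2 ^ base e = \<kappa>})"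
    by (intro sum.cong) auto
  also have "\<dots> = card {j \<in> {j. B j = Some (e, k)}. \<pi> j div 2 ^ base e \<in> {\<kappa>. \<kappa> div 2 ^ (e - base e) = k}}"
    using finw by (intro sum_card_fibers) auto
  also have "{j \<in> {j. B j = Some (e, k)}. \<pi> j div 2 ^ base e \<in> {\<kappa>. \<kappa> div 2 ^ (e - base e) = k}} =
    {j. B j = Some (e, k)}"
    using win dd by auto
  finally show ?thesis unfolding weight_def .
qed

text \<open>The bound \<open>u\<close> dominates both the old and the new grants, so that there is a free slot for each
  move although the jobs are moved one after the other.\<close>

lemma repair:
  assumes dn: "sparse 64 B" and gu: "\<And>e \<kappa>. g e \<kappa> \<le> u e \<kappa>"
    and su: "\<And>b \<kappa>. base b = b \<Longrightarrow> 6 \<le> b \<Longrightarrow> (\<Sum>e | base e = b. u e \<kappa>) \<le> 2 ^ b div 2"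
    and cov: "\<And>e k. 6 \<le> e \<Longrightarrow> weight B (e, k) \<le> (\<Sum>\<kappa> | \<kappa> div 2 ^ (e - base e) = k. g e \<kappa>)"
    and "placed B \<pi>" "\<And>e \<kappa>. occupancy B \<pi> e \<kappa> \<le> u e \<kappa>"
  shows "\<exists>\<pi>'. placed B \<pi>' \<and> (\<forall>e \<kappa>. occupancy B \<pi>' e \<kappa> \<le> g e \<kappa>) \<and>
               card {i \<in> dom B. \<pi>' i \<noteq> \<pi> i} \<le> 2 * excess B \<pi> g"
  using assms(5,6)
\<comment> \<open>Each move lowers the excess by at least one and changes at most two
  positions.\<close>
proof (induction "excess B \<pi> g" arbitrary: \<pi> rule: less_induct)
  case less
  note pl = less.prems(1) and ou = less.prems(2)
  have fin: "finite (dom B)" and win: "\<And>j e k. B j = Some (e, k) \<Longrightarrow> \<pi> j div 2 ^ e = k"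
    using pl by (auto simp: placed_def)
  show ?case
  proof (cases "\<forall>e \<kappa>. occupancy B \<pi> e \<kappa> \<le> g e \<kappa>")
    case True
    then show ?thesis using pl by (intro exI[of _ \<pi>]) simp
  next
    case False
    then obtain e \<kappa> where over: "g e \<kappa> < occupancy B \<pi> e \<kappa>" by (auto simp: not_le)
    then have "{j. \<exists>k. B j = Some (e, k) \<and> \<pi> j div 2 ^ base e = \<kappa>} \<noteq> {}"
      unfolding occupancy_def by (metis card.empty not_less_zero)
    then obtain j k where j: "B j = Some (e, k)" "\<pi> j div 2 ^ base e = \<kappa>" by auto
    have e6: "6 \<le> e" using sparse_exp_ge[OF dn j(1)] .
    have \<kappa>: "\<kappa> div 2 ^ (e - base e) = k"
      using j win[OF j(1)] div_power_div[OF base_le, of "\<pi> j" e] by simp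
    \<comment> \<open>If no interval of the window had a spare grant, the overfull one would push
      the sum of the occupancies, which is the number of jobs, above the sum of the grants, against
      \<open>cov\<close>.\<close>
    have "\<exists>\<kappa>'. \<kappa>' div 2 ^ (e - base e) = k \<and> occupancy B \<pi> e \<kappa>' < g e \<kappa>'"
    proof (rule ccontr)
      assume "\<not> ?thesis"
      then have "(\<Sum>\<kappa> | \<kappa> div 2 ^ (e - base e) = k. g e \<kappa>) < (\<Sum>\<kappa> | \<kappa> div 2 ^ (e - base e) = k. occupancy B \<pi> e \<kappa>)"
        using over \<kappa> by (intro sum_strict_mono_ex1) (auto simp: not_less)
      then show False using cov[OF e6, of k] sum_occupancy[OF pl, of e k] by simp
    qed
    then obtain \<kappa>' where \<kappa>': "\<kappa>' div 2 ^ (e - base e) = k" "occupancy B \<pi> e \<kappa>' < g e \<kappa>'" by blast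
    have "card (crowd B \<pi> (base e) \<kappa>') < 2 ^ base e"
      using pl dn base_base base_height(1)[OF e6] ou su by (intro crowd_card_less[of B \<pi> "base e" \<kappa>' "\<lambda>e. u e \<kappa>'"]) auto
    then obtain s' where s': "s' div 2 ^ base e = \<kappa>'" "\<And>i. i \<in> crowd B \<pi> (base e) \<kappa>' \<Longrightarrow> \<pi> i \<noteq> s'"
      using free_slot[OF fin] by blast
    have s'e: "s' div 2 ^ e = k" using s'(1) \<kappa>'(1) div_power_div[OF base_le, of s' e] by simp
    define \<pi>1 where "\<pi>1 = transpose (\<pi> j) s' \<circ> \<pi>"
    have pl1: "placed B \<pi>1"
      and own: "\<And>i e' k'. i \<noteq> j \<Longrightarrow> B i = Some (e', k') \<Longrightarrow> \<pi>1 i div 2 ^ base e' = \<pi> i div 2 ^ base e'"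
      and ch: "card {i \<in> dom B. \<pi>1 i \<noteq> \<pi> i} \<le> 2"
      using placed_transpose[OF pl j(1) s'e] s' unfolding \<pi>1_def by auto
    have p1j: "\<pi>1 j div 2 ^ base e = \<kappa>'" using s'(1) by (simp add: \<pi>1_def)
    let ?S = "\<lambda>\<pi> e \<kappa>. {j. \<exists>k. B j = Some (e, k) \<and> \<pi> j div 2 ^ base e = \<kappa>}"
    \<comment> \<open>By \<open>own\<close>, a swapped job of a higher level stays in its interval,
      so only the interval that \<open>j\<close> leaves and the one it enters change their
      occupancy.\<close>
    have sub: "?S \<pi>1 e1 \<kappa>1 - {j} = ?S \<pi> e1 \<kappa>1 - {j}" for e1 \<kappa>1 using own by auto
    have occ_from: "occupancy B \<pi>1 e \<kappa> < occupancy B \<pi> e \<kappa>"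
    proof -
      have "j \<notin> ?S \<pi>1 e \<kappa>" using p1j over \<kappa>'(2) by auto
      then have "?S \<pi>1 e \<kappa> = ?S \<pi> e \<kappa> - {j}" using sub[of e \<kappa>] by auto
      moreover have "card (?S \<pi> e \<kappa> - {j}) < card (?S \<pi> e \<kappa>)"
        using j by (intro card_Diff1_less[OF finite_occupants[OF fin]]) auto
      ultimately show ?thesis unfolding occupancy_def by simp
    qed
    have occ_to: "occupancy B \<pi>1 e \<kappa>' \<le> Suc (occupancy B \<pi> e \<kappa>')"
    proof -
      have "?S \<pi>1 e \<kappa>' \<subseteq> insert j (?S \<pi> e \<kappa>')" using sub[of e \<kappa>'] by blast
      then have "card (?S \<pi>1 e \<kappa>') \<le> card (insert j (?S \<pi> e \<kappa>'))"
        using finite_occupants[OF fin] by (intro card_mono) auto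
      also have "\<dots> \<le> Suc (card (?S \<pi> e \<kappa>'))" using finite_occupants[OF fin] by (simp add: card_insert_if)
      finally show ?thesis unfolding occupancy_def .
    qed
    have occ_oth: "occupancy B \<pi>1 e1 \<kappa>1 \<le> occupancy B \<pi> e1 \<kappa>1" if "(e1, \<kappa>1) \<noteq> (e, \<kappa>')" for e1 \<kappa>1
    proof -
      have "j \<notin> ?S \<pi>1 e1 \<kappa>1" using p1j j(1) that by auto
      then have "?S \<pi>1 e1 \<kappa>1 \<subseteq> ?S \<pi> e1 \<kappa>1" using sub[of e1 \<kappa>1] by blast
      then show ?thesis unfolding occupancy_def using finite_occupants[OF fin] by (intro card_mono) auto
    qed
    have ou1: "occupancy B \<pi>1 e1 \<kappa>1 \<le> u e1 \<kappa>1" for e1 \<kappa>1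
      using occ_oth[of e1 \<kappa>1] ou[of e1 \<kappa>1] occ_to \<kappa>'(2) gu[of e \<kappa>'] by (cases "(e1, \<kappa>1) = (e, \<kappa>')") auto
    have ex: "excess B \<pi>1 g < excess B \<pi> g"
      unfolding excess_def
    proof (rule sum_strict_mono_ex1)
      show "finite (cells B)" using finite_cells[OF fin] .
      show "\<forall>x\<in>cells B. (case x of (e, \<kappa>) \<Rightarrow> occupancy B \<pi>1 e \<kappa> - g e \<kappa>) \<le> (case x of (e, \<kappa>) \<Rightarrow> occupancy B \<pi> e \<kappa> - g e \<kappa>)"
      proof (intro ballI, clarify)
        fix e1 \<kappa>1
        show "occupancy B \<pi>1 e1 \<kappa>1 - g e1 \<kappa>1 \<le> occupancy B \<pi> e1 \<kappa>1 - g e1 \<kappa>1"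
          using occ_oth[of e1 \<kappa>1] occ_to \<kappa>'(2) by (cases "(e1, \<kappa>1) = (e, \<kappa>')") auto
      qed
      have "(e, \<kappa>) \<in> cells B" using cellsI[of B j e k \<kappa>] j(1) \<kappa> by simp
      moreover have "occupancy B \<pi>1 e \<kappa> - g e \<kappa> < occupancy B \<pi> e \<kappa> - g e \<kappa>" using over occ_from by linarith
      ultimately show "\<exists>x\<in>cells B. (case x of (e, \<kappa>) \<Rightarrow> occupancy B \<pi>1 e \<kappa> - g e \<kappa>) < (case x of (e, \<kappa>) \<Rightarrow> occupancy B \<pi> e \<kappa> - g e \<kappa>)"
        by (intro bexI[of _ "(e, \<kappa>)"]) auto
    qed
    obtain \<pi>' where \<pi>': "placed B \<pi>'" "\<forall>e \<kappa>. occupancy B \<pi>' e \<kappa> \<le> g e \<kappa>"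
      "card {i \<in> dom B. \<pi>' i \<noteq> \<pi>1 i} \<le> 2 * excess B \<pi>1 g"
      using less.hyps[OF ex pl1 ou1] by blast
    have "card {i \<in> dom B. \<pi>' i \<noteq> \<pi> i} \<le> card ({i \<in> dom B. \<pi>' i \<noteq> \<pi>1 i} \<union> {i \<in> dom B. \<pi>1 i \<noteq> \<pi> i})"
      using fin by (intro card_mono) auto
    also have "\<dots> \<le> card {i \<in> dom B. \<pi>' i \<noteq> \<pi>1 i} + card {i \<in> dom B. \<pi>1 i \<noteq> \<pi> i}" by (rule card_Un_le)
    also have "\<dots> \<le> 2 * excess B \<pi>1 g + 2" using \<pi>'(3) ch by (rule add_mono)
    also have "\<dots> \<le> 2 * excess B \<pi> g" using ex by simp
    finally show ?thesis using \<pi>'(1,2) by blast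
  qed
qed

text \<open>A displaced job is put back into the interval of its own level that it came from, so
  apart from \<open>f\<close> nothing changes for the occupancies. Its level is strictly higher than
  that of the job displacing it, so the cascade meets each higher level at most once.\<close>

lemma place_new:
  fixes M :: nat
  assumes "placed B \<pi>" "f \<notin> dom B" "\<kappa> div 2 ^ (e - base e) = k"
    and "\<And>b \<kappa>. base b = b \<Longrightarrow> base e \<le> b \<Longrightarrow> card (crowd B \<pi> b \<kappa>) < 2 ^ b"
    and "\<And>j e k. B j = Some (e, k) \<Longrightarrow> 2 ^ e \<le> M"
    and "2 ^ e \<le> M"
  shows "\<exists>\<pi>'. placed (B(f \<mapsto> (e, k))) \<pi>' \<and> \<pi>' f div 2 ^ base e = \<kappa> \<and>
     (\<forall>j e' k'. B j = Some (e', k') \<longrightarrow> \<pi>' j div 2 ^ base e' = \<pi> j div 2 ^ base e') \<and>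
     card {j \<in> dom B. \<pi>' j \<noteq> \<pi> j} \<le> card {b \<in> base ` {e. 2 ^ e \<le> M}. base e < b}"
  using assms
proof (induction "card {b \<in> base ` {e. 2 ^ e \<le> M}. base e < b}" arbitrary: B \<pi> f e k \<kappa> rule: less_induct)
  case less
  note pl = less.prems(1) and f = less.prems(2) and \<kappa> = less.prems(3)
    and cr = less.prems(4) and M = less.prems(5,6)
  have fin: "finite (dom B)" and inj: "inj_on \<pi> (dom B)"
    and win: "\<And>j e k. B j = Some (e, k) \<Longrightarrow> \<pi> j div 2 ^ e = k"
    using pl by (auto simp: placed_def)
  obtain s where s: "s div 2 ^ base e = \<kappa>" "\<And>i. i \<in> crowd B \<pi> (base e) \<kappa> \<Longrightarrow> \<pi> i \<noteq> s"
    using free_slot[OF fin cr[of "base e" \<kappa>]] base_base by blast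
  have se: "s div 2 ^ e = k" using s(1) \<kappa> div_power_div[OF base_le, of s e] by simp
  define \<pi>1 where "\<pi>1 = \<pi>(f := s)"
  show ?case
  proof (cases "s \<in> \<pi> ` dom B")
    case False
    have "placed (B(f \<mapsto> (e, k))) \<pi>1"
      unfolding placed_def \<pi>1_def using fin inj win se f False by (auto simp: inj_on_def)
    moreover have "{j \<in> dom B. \<pi>1 j \<noteq> \<pi> j} = {}" using f by (auto simp: \<pi>1_def)
    ultimately show ?thesis using s(1) f by (intro exI[of _ \<pi>1]) (auto simp: \<pi>1_def)
  next
    case True
    then obtain f2 e2 k2 where f2: "B f2 = Some (e2, k2)" "\<pi> f2 = s" by auto
    have ff2: "f2 \<noteq> f" using f f2 by auto
    have lv: "base e < base e2" using s f2 unfolding crowd_def by force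
    \<comment> \<open>\<open>f\<close> takes over the slot of \<open>f2\<close>, and
      \<open>f2\<close> becomes the newcomer for the induction hypothesis.\<close>
    define B1 where "B1 = (B(f2 := None))(f \<mapsto> (e, k))"
    have pl1: "placed B1 \<pi>1"
      unfolding placed_def
    proof (intro conjI allI impI)
      show "finite (dom B1)" using fin by (simp add: B1_def)
      show "inj_on \<pi>1 (dom B1)"
      proof (rule inj_onI)
        fix i i' assume i: "i \<in> dom B1" "i' \<in> dom B1" "\<pi>1 i = \<pi>1 i'"
        have ns: "\<pi> a \<noteq> s" if "a \<in> dom B" "a \<noteq> f2" for a
          using inj_onD[OF inj, of a f2] that f2 by auto
        have d: "a \<in> dom B \<and> a \<noteq> f2" if "a \<in> dom B1" "a \<noteq> f" for a
          using that by (auto simp: B1_def split: if_splits)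
        show "i = i'"
          using i d[of i] d[of i'] ns[of i] ns[of i'] inj_onD[OF inj, of i i']
          by (cases "i = f"; cases "i' = f") (auto simp: \<pi>1_def)
      qed
      fix i e' k' assume "B1 i = Some (e', k')"
      then show "\<pi>1 i div 2 ^ e' = k'" using win se by (auto simp: B1_def \<pi>1_def split: if_splits)
    qed
    \<comment> \<open>The slot \<open>s\<close> only changes its owner. From the level of
      \<open>f2\<close> upwards \<open>f2\<close> was itself a member of the crowd around
      \<open>s\<close>, so replacing it by \<open>f\<close> does not enlarge any crowd
      there.\<close>
    have cr1: "card (crowd B1 \<pi>1 b \<kappa>1) < 2 ^ b" if b: "base b = b" "base e2 \<le> b" for b \<kappa>1
    proof (cases "\<kappa>1 = s div 2 ^ b")
      case True
      have "crowd B1 \<pi>1 b \<kappa>1 \<subseteq> insert f (crowd B \<pi> b \<kappa>1 - {f2})"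
        by (auto simp: crowd_def B1_def \<pi>1_def split: if_splits)
      then have "card (crowd B1 \<pi>1 b \<kappa>1) \<le> card (insert f (crowd B \<pi> b \<kappa>1 - {f2}))"
        using finite_crowd[OF fin] by (intro card_mono) auto
      also have "\<dots> \<le> Suc (card (crowd B \<pi> b \<kappa>1 - {f2}))"
        using finite_crowd[OF fin] by (simp add: card_insert_if)
      also have "\<dots> = card (crowd B \<pi> b \<kappa>1)"
        using finite_crowd[OF fin] f2 b True by (intro card_Suc_Diff1) (auto simp: crowd_def)
      also have "\<dots> < 2 ^ b" using cr[of b \<kappa>1] b lv by simp
      finally show ?thesis .
    next
      case False
      then have "crowd B1 \<pi>1 b \<kappa>1 \<subseteq> crowd B \<pi> b \<kappa>1"
        by (auto simp: crowd_def B1_def \<pi>1_def split: if_splits)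
      then have "card (crowd B1 \<pi>1 b \<kappa>1) \<le> card (crowd B \<pi> b \<kappa>1)"
        using finite_crowd[OF fin] by (intro card_mono) auto
      also have "\<dots> < 2 ^ b" using cr[of b \<kappa>1] b lv by simp
      finally show ?thesis .
    qed
    have M2: "2 ^ e2 \<le> M" using M(1) f2 by blast
    define R where "R = base ` {e. 2 ^ e \<le> M}"
    have finR: "finite R" unfolding R_def using finite_exps by simp
    have "base e2 \<in> R" unfolding R_def using M2 by blast
    then have "{b \<in> R. base e2 < b} \<subseteq> {b \<in> R. base e < b} - {base e2}" "base e2 \<in> {b \<in> R. base e < b}"
      using lv by auto
    then have lt: "card {b \<in> R. base e2 < b} < card {b \<in> R. base e < b}"
      using finR by (intro psubset_card_mono) auto
    have \<kappa>2: "s div 2 ^ base e2 div 2 ^ (e2 - base e2) = k2"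
      using win[OF f2(1)] f2(2) div_power_div[OF base_le, of s e2] by simp
    have M1: "2 ^ e' \<le> M" if "B1 j = Some (e', k')" for j e' k'
      using that M by (auto simp: B1_def split: if_splits)
    have f21: "f2 \<notin> dom B1" using ff2 by (simp add: B1_def)
    have "\<exists>\<pi>'. placed (B1(f2 \<mapsto> (e2, k2))) \<pi>' \<and> \<pi>' f2 div 2 ^ base e2 = s div 2 ^ base e2 \<and>
      (\<forall>j e' k'. B1 j = Some (e', k') \<longrightarrow> \<pi>' j div 2 ^ base e' = \<pi>1 j div 2 ^ base e') \<and>
      card {j \<in> dom B1. \<pi>' j \<noteq> \<pi>1 j} \<le> card {b \<in> R. base e2 < b}"
      unfolding R_def
      by (rule less.hyps[OF lt[unfolded R_def] pl1 f21 \<kappa>2 _ _ M2]) (erule (1) cr1, erule M1)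
    then obtain \<pi>' where \<pi>': "placed (B1(f2 \<mapsto> (e2, k2))) \<pi>'" "\<pi>' f2 div 2 ^ base e2 = s div 2 ^ base e2"
      "\<And>j e' k'. B1 j = Some (e', k') \<Longrightarrow> \<pi>' j div 2 ^ base e' = \<pi>1 j div 2 ^ base e'"
      "card {j \<in> dom B1. \<pi>' j \<noteq> \<pi>1 j} \<le> card {b \<in> R. base e2 < b}"
      by blast
    have "B1(f2 \<mapsto> (e2, k2)) = B(f \<mapsto> (e, k))" using f2 ff2 by (auto simp: B1_def)
    then have "placed (B(f \<mapsto> (e, k))) \<pi>'" using \<pi>'(1) by simp
    moreover have "\<pi>' f div 2 ^ base e = \<kappa>" using \<pi>'(3)[of f e k] s(1) by (simp add: B1_def \<pi>1_def)
    moreover have "\<pi>' j div 2 ^ base e' = \<pi> j div 2 ^ base e'" if j: "B j = Some (e', k')" for j e' k'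
    proof (cases "j = f2")
      case True
      then show ?thesis using \<pi>'(2) f2 j by simp
    next
      case False
      moreover have "j \<noteq> f" using f j by auto
      ultimately show ?thesis using \<pi>'(3)[of j e' k'] j by (simp add: B1_def \<pi>1_def)
    qed
    moreover have "card {j \<in> dom B. \<pi>' j \<noteq> \<pi> j} \<le> card {b \<in> R. base e < b}"
    proof -
      have "{j \<in> dom B. \<pi>' j \<noteq> \<pi> j} \<subseteq> insert f2 {j \<in> dom B1. \<pi>' j \<noteq> \<pi>1 j}"
        using f by (auto simp: B1_def \<pi>1_def)
      then have "card {j \<in> dom B. \<pi>' j \<noteq> \<pi> j} \<le> card (insert f2 {j \<in> dom B1. \<pi>' j \<noteq> \<pi>1 j})"
        using fin by (intro card_mono) (auto simp: B1_def)
      also have "\<dots> \<le> Suc (card {j \<in> dom B1. \<pi>' j \<noteq> \<pi>1 j})"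
        using fin by (simp add: card_insert_if B1_def)
      finally show ?thesis using \<pi>'(4) lt by simp
    qed
    ultimately show ?thesis unfolding R_def by blast
  qed
qed

subsection \<open>Updates on one machine with dyadic windows\<close>

lemma sparse_mono:
  assumes "sparse K B" "A \<subseteq>\<^sub>m B"
  shows "sparse K A"
proof -
  have fin: "finite (dom B)" using assms(1) by (simp add: sparse_def)
  have "K * card {j. \<exists>W. A j = Some W \<and> inside W V} \<le> 2 ^ fst V" for V
  proof -
    have "{j. \<exists>W. A j = Some W \<and> inside W V} \<subseteq> {j. \<exists>W. B j = Some W \<and> inside W V}"
      using assms(2) by (auto simp: map_le_def dom_def)
    moreover have "finite {j. \<exists>W. B j = Some W \<and> inside W V}"
      by (rule finite_subset[OF _ fin]) auto
    ultimately have "K * card {j. \<exists>W. A j = Some W \<and> inside W V} \<le> K * card {j. \<exists>W. B j = Some W \<and> inside W V}"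
      by (intro mult_le_mono2 card_mono)
    also have "\<dots> \<le> 2 ^ fst V" using assms(1) unfolding sparse_def by blast
    finally show ?thesis .
  qed
  moreover have "finite (dom A)" using fin assms(2) by (meson finite_subset map_le_implies_dom_le)
  ultimately show ?thesis by (simp add: sparse_def)
qed

definition reserved :: "djobs \<Rightarrow> (job \<Rightarrow> int) \<Rightarrow> bool" where
  "reserved B \<pi> \<longleftrightarrow> placed B \<pi> \<and> (\<forall>e \<kappa>. occupancy B \<pi> e \<kappa> \<le> grant B e \<kappa>)"

abbreviation ndist :: "nat \<Rightarrow> nat \<Rightarrow> nat" where
  "ndist x y \<equiv> (x - y) + (y - x)"

lemma weight_upd:
  assumes "finite (dom B)" "j \<notin> dom B"
  shows "weight (B(j \<mapsto> V)) W = weight B W + (if W = V then 1 else 0)"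
proof (cases "W = V")
  case True
  have "{i. (B(j \<mapsto> V)) i = Some W} = insert j {i. B i = Some W}" using True assms(2) by auto
  then have "weight (B(j \<mapsto> V)) W = card (insert j {i. B i = Some W})"
    unfolding weight_def by (rule arg_cong)
  moreover have "finite {i. B i = Some W}" by (rule finite_subset[OF _ assms(1)]) auto
  moreover have "j \<notin> {i. B i = Some W}" using assms(2) by auto
  ultimately show ?thesis using True by (simp only: weight_def card_insert_disjoint) simp
next
  case False
  have "{i. (B(j \<mapsto> V)) i = Some W} = {i. B i = Some W}" using False assms(2) by auto
  then show ?thesis using False by (simp add: weight_def)
qed

lemma low_load_upd:
  assumes "finite (dom B)" "j \<notin> dom B"
  shows "ndist (low_load (B(j \<mapsto> (e0, k0))) b \<kappa>) (low_load B b \<kappa>)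
         \<le> (if e0 < b then (if \<kappa> = k0 div 2 ^ (b - e0) then 1 else 0) else 0)"
proof -
  let ?S = "\<lambda>B. {j. \<exists>e k. B j = Some (e, k) \<and> e < b \<and> inside (e, k) (b, \<kappa>)}"
  have fin: "finite (?S B)" by (rule finite_subset[OF _ assms(1)]) auto
  show ?thesis
  proof (cases "e0 < b \<and> inside (e0, k0) (b, \<kappa>)")
    case True
    then have "?S (B(j \<mapsto> (e0, k0))) = insert j (?S B)" using assms(2) by auto
    moreover have "j \<notin> ?S B" using assms(2) by auto
    ultimately have "low_load (B(j \<mapsto> (e0, k0))) b \<kappa> = Suc (low_load B b \<kappa>)" using fin by (simp add: low_load_def)
    then show ?thesis using True by (simp add: inside_def)
  next
    case False
    then have "?S (B(j \<mapsto> (e0, k0))) = ?S B" using assms(2) by auto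
    then show ?thesis by (simp add: low_load_def)
  qed
qed

text \<open>No demand falls when a job is added, so the sum of the changes is the change of the sum,
  which \<open>sum_demand\<close> gives exactly.\<close>

lemma sum_ndist_demand_upd:
  assumes "finite (dom B)" "j \<notin> dom B" "b \<le> e0" "finite Q"
  shows "(\<Sum>\<kappa>\<in>Q. ndist (demand (B(j \<mapsto> (e0, k0))) b e0 \<kappa>) (demand B b e0 \<kappa>)) \<le> 2"
proof -
  let ?B = "B(j \<mapsto> (e0, k0))"
  let ?W = "{\<kappa>::int. \<kappa> div 2 ^ (e0 - b) = k0}"
  have le: "demand B b e0 \<kappa> \<le> demand ?B b e0 \<kappa>" for \<kappa>
    unfolding demand_def by (simp add: weight_upd[OF assms(1,2)] div_le_mono)
  have eq: "demand ?B b e0 \<kappa> = demand B b e0 \<kappa>" if "\<kappa> \<notin> ?W" for \<kappa>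
    using that unfolding demand_def by (simp add: weight_upd[OF assms(1,2)])
  have "(\<Sum>\<kappa>\<in>Q. ndist (demand ?B b e0 \<kappa>) (demand B b e0 \<kappa>)) = (\<Sum>\<kappa>\<in>Q. demand ?B b e0 \<kappa> - demand B b e0 \<kappa>)"
    using le by simp
  also have "\<dots> = (\<Sum>\<kappa>\<in>Q \<inter> ?W. demand ?B b e0 \<kappa> - demand B b e0 \<kappa>)"
    using assms(4) eq by (intro sum.mono_neutral_right) auto
  also have "\<dots> \<le> (\<Sum>\<kappa>\<in>?W. demand ?B b e0 \<kappa> - demand B b e0 \<kappa>)"
    by (intro sum_mono2) auto
  also have "\<dots> = (\<Sum>\<kappa>\<in>?W. demand ?B b e0 \<kappa>) - (\<Sum>\<kappa>\<in>?W. demand B b e0 \<kappa>)"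
    using le by (intro sum_subtractf_nat) auto
  also have "\<dots> = 2"
    using sum_demand[OF assms(3), of ?B k0] sum_demand[OF assms(3), of B k0] weight_upd[OF assms(1,2), of "(e0, k0)" "(e0, k0)"]
    by simp
  finally show ?thesis .
qed

lemma sum_grant_loss_level:
  assumes b: "base b = b" "6 \<le> b"
  shows "(\<Sum>e | base e = b. grant X e \<kappa> - grant Y e \<kappa>)
    \<le> ndist (low_load X b \<kappa>) (low_load Y b \<kappa>) + (\<Sum>e | base e = b. ndist (demand X b e \<kappa>) (demand Y b e \<kappa>))"
proof -
  obtain n where n: "{e. base e = b} = {b..<n}" using level_set b by blast
  have "(\<Sum>e | base e = b. grant X e \<kappa> - grant Y e \<kappa>) = (\<Sum>e\<in>{b..<n}. grant_at X b e \<kappa> - grant_at Y b e \<kappa>)"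
    using n by (intro sum.cong) (auto simp: grant_def)
  also have "\<dots> \<le> ((2 ^ b div 4 - low_load X b \<kappa>) - (2 ^ b div 4 - low_load Y b \<kappa>))
     + (\<Sum>e\<in>{b..<n}. ndist (demand X b e \<kappa>) (demand Y b e \<kappa>))"
    unfolding grant_at_def by (rule sum_greedy_loss)
  also have "\<dots> \<le> ndist (low_load X b \<kappa>) (low_load Y b \<kappa>) + (\<Sum>e\<in>{b..<n}. ndist (demand X b e \<kappa>) (demand Y b e \<kappa>))"
    by (intro add_right_mono) linarith
  finally show ?thesis using n by simp
qed

text \<open>On each level above its own, a job of exponent \<open>e0\<close> changes
  \<open>low_load\<close> in one interval by 1; on its own level it changes the demands by 2 in
  total; lower levels do not notice it. The levels above are fewer than \<open>levels M\<close>, as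
  the own level is not among them. The symmetric hypothesis on \<open>X\<close> and \<open>Y\<close>
  serves insertion and deletion alike.\<close>

lemma sum_grant_loss:
  fixes M :: nat
  assumes fin: "finite (dom B)" and j: "j \<notin> dom B" and B': "B' = B(j \<mapsto> (e0, k0))"
    and XY: "(X = B \<and> Y = B') \<or> (X = B' \<and> Y = B)"
    and K: "finite K" "\<And>e \<kappa>. (e, \<kappa>) \<in> K \<Longrightarrow> 6 \<le> e \<and> 2 ^ e \<le> M"
    and e0: "2 ^ e0 \<le> M"
  shows "(\<Sum>(e, \<kappa>)\<in>K. grant X e \<kappa> - grant Y e \<kappa>) \<le> levels M + 1"
proof -
  define E where "E = {e. 6 \<le> e \<and> 2 ^ e \<le> M}"
  define Q where "Q = snd ` K"
  define R where "R = base ` {e. 2 ^ e \<le> M}"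
  let ?h = "\<lambda>e \<kappa>. grant X e \<kappa> - grant Y e \<kappa>"
  have finE: "finite E" unfolding E_def by (rule finite_subset[OF _ finite_exps[of M]]) auto
  have finQ: "finite Q" using K by (simp add: Q_def)
  have finR: "finite R" unfolding R_def using finite_exps by simp
  have sub: "base ` E \<subseteq> R" by (auto simp: E_def R_def)
  have level: "(\<Sum>e\<in>{e \<in> E. base e = b}. \<Sum>\<kappa>\<in>Q. ?h e \<kappa>)
      \<le> (if e0 < b then 1 else 0) + (if b = base e0 then 2 else 0)"
    if "b \<in> base ` E" for b
  proof -
    have b: "base b = b" "6 \<le> b" using that base_base base_height(1) by (auto simp: E_def)
    obtain n where n: "{e. base e = b} = {b..<n}" using level_set b by blast
    have finb: "finite {e. base e = b}" using n by simp
    have ndl: "ndist (low_load X b \<kappa>) (low_load Y b \<kappa>) \<le> (if e0 < b then (if \<kappa> = k0 div 2 ^ (b - e0) then 1 else 0) else 0)" for \<kappa>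
    proof -
      have "ndist (low_load X b \<kappa>) (low_load Y b \<kappa>) = ndist (low_load B' b \<kappa>) (low_load B b \<kappa>)"
        using XY by (elim disjE conjE) (simp_all only: add.commute)
      then show ?thesis using low_load_upd[OF fin j, of e0 k0 b \<kappa>] unfolding B' by (simp only:)
    qed
    have ndd: "ndist (demand X b e \<kappa>) (demand Y b e \<kappa>) = (if e = e0 then ndist (demand B' b e0 \<kappa>) (demand B b e0 \<kappa>) else 0)" for e \<kappa>
    proof (cases "e = e0")
      case False
      then have "demand B' b e \<kappa> = demand B b e \<kappa>" unfolding demand_def B' by (simp add: weight_upd[OF fin j])
      then show ?thesis using XY False by auto
    next
      case True
      then show ?thesis using XY by (auto simp: add.commute)
    qed
    have "(\<Sum>e\<in>{e \<in> E. base e = b}. \<Sum>\<kappa>\<in>Q. ?h e \<kappa>) \<le> (\<Sum>e | base e = b. \<Sum>\<kappa>\<in>Q. ?h e \<kappa>)"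
      using finb by (intro sum_mono2) auto
    also have "\<dots> = (\<Sum>\<kappa>\<in>Q. \<Sum>e | base e = b. ?h e \<kappa>)" by (rule sum.swap)
    also have "\<dots> \<le> (\<Sum>\<kappa>\<in>Q. ndist (low_load X b \<kappa>) (low_load Y b \<kappa>) + (\<Sum>e | base e = b. ndist (demand X b e \<kappa>) (demand Y b e \<kappa>)))"
      by (intro sum_mono sum_grant_loss_level b)
    also have "\<dots> = (\<Sum>\<kappa>\<in>Q. ndist (low_load X b \<kappa>) (low_load Y b \<kappa>)) + (\<Sum>\<kappa>\<in>Q. \<Sum>e | base e = b. ndist (demand X b e \<kappa>) (demand Y b e \<kappa>))"
      by (rule sum.distrib)
    also have "\<dots> \<le> (if e0 < b then 1 else 0) + (if b = base e0 then 2 else 0)"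
    proof (rule add_mono)
      have "(\<Sum>\<kappa>\<in>Q. ndist (low_load X b \<kappa>) (low_load Y b \<kappa>)) \<le> (\<Sum>\<kappa>\<in>Q. if e0 < b then (if \<kappa> = k0 div 2 ^ (b - e0) then 1 else 0) else 0)"
        by (rule sum_mono) (rule ndl)
      also have "\<dots> \<le> (if e0 < b then 1 else 0)"
        using finQ by (cases "e0 < b") (simp_all add: sum.delta)
      finally show "(\<Sum>\<kappa>\<in>Q. ndist (low_load X b \<kappa>) (low_load Y b \<kappa>)) \<le> (if e0 < b then 1 else 0)" .
      have "(\<Sum>e | base e = b. ndist (demand X b e \<kappa>) (demand Y b e \<kappa>)) =
            (if base e0 = b then ndist (demand B' b e0 \<kappa>) (demand B b e0 \<kappa>) else 0)" for \<kappa>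
        unfolding ndd using finb by (subst sum.delta) auto
      then have "(\<Sum>\<kappa>\<in>Q. \<Sum>e | base e = b. ndist (demand X b e \<kappa>) (demand Y b e \<kappa>)) =
        (\<Sum>\<kappa>\<in>Q. if base e0 = b then ndist (demand B' b e0 \<kappa>) (demand B b e0 \<kappa>) else 0)" by simp
      also have "\<dots> \<le> (if b = base e0 then 2 else 0)"
      proof (cases "b = base e0")
        case True
        then have "b \<le> e0" using base_le by simp
        then show ?thesis using sum_ndist_demand_upd[OF fin j _ finQ, of b e0 k0] True unfolding B' by simp
      qed auto
      finally show "(\<Sum>\<kappa>\<in>Q. \<Sum>e | base e = b. ndist (demand X b e \<kappa>) (demand Y b e \<kappa>)) \<le> (if b = base e0 then 2 else 0)" .
    qed
    finally show ?thesis .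
  qed
  have "K \<subseteq> E \<times> Q"
  proof
    fix x assume "x \<in> K"
    then show "x \<in> E \<times> Q" using K(2)[of "fst x" "snd x"] by (auto simp: E_def Q_def mem_Times_iff)
  qed
  then have "(\<Sum>(e, \<kappa>)\<in>K. ?h e \<kappa>) \<le> (\<Sum>(e, \<kappa>)\<in>E \<times> Q. ?h e \<kappa>)"
    using finE finQ by (intro sum_mono2) auto
  also have "\<dots> = (\<Sum>e\<in>E. \<Sum>\<kappa>\<in>Q. ?h e \<kappa>)" by (rule sum.cartesian_product[symmetric])
  also have "\<dots> = (\<Sum>b\<in>base ` E. \<Sum>e\<in>{e \<in> E. base e = b}. \<Sum>\<kappa>\<in>Q. ?h e \<kappa>)"
    using finE by (rule sum.image_gen)
  also have "\<dots> \<le> (\<Sum>b\<in>base ` E. (if e0 < b then 1 else 0) + (if b = base e0 then 2 else 0))"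
    by (intro sum_mono level)
  also have "\<dots> \<le> (\<Sum>b\<in>R. (if e0 < b then 1 else 0) + (if b = base e0 then 2 else 0))"
    using sub finR by (intro sum_mono2) auto
  also have "\<dots> = (\<Sum>b\<in>R. if e0 < b then 1 else 0) + (\<Sum>b\<in>R. if b = base e0 then 2 else 0)"
    by (rule sum.distrib)
  also have "(\<Sum>b\<in>R. if e0 < b then 1 else 0) = card {b \<in> R. e0 < b}"
    using finR by (simp add: sum.If_cases Int_def)
  also have "(\<Sum>b\<in>R. if b = base e0 then 2 else 0) \<le> (2::nat)"
    using finR by (simp add: sum.delta)
  finally have le: "(\<Sum>(e, \<kappa>)\<in>K. ?h e \<kappa>) \<le> card {b \<in> R. e0 < b} + 2" by simp
  have "base e0 \<in> R" using e0 by (auto simp: R_def)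
  moreover have "base e0 \<notin> {b \<in> R. e0 < b}" using base_le[of e0] by simp
  ultimately have "{b \<in> R. e0 < b} \<subset> R" by blast
  then have "card {b \<in> R. e0 < b} < card R" using finR by (rule psubset_card_mono[rotated])
  then have "card {b \<in> R. e0 < b} + 2 \<le> levels M + 1"
    unfolding levels_def R_def[symmetric] by linarith
  then show ?thesis using le by (rule le_trans[rotated])
qed

text \<open>Occupancies that respect the old grants exceed the new ones by no more than the grants
  lost.\<close>

lemma excess_le:
  assumes "placed B \<pi>" "sparse 64 B" "\<And>j e k. B j = Some (e, k) \<Longrightarrow> 2 ^ e \<le> M"
    and "\<And>e \<kappa>. occupancy B \<pi> e \<kappa> \<le> grant X e \<kappa>"
    and "finite (dom A)" "j \<notin> dom A" "B' = A(j \<mapsto> (e0, k0))" "2 ^ e0 \<le> M"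
    and "(X = A \<and> Y = B') \<or> (X = B' \<and> Y = A)"
  shows "excess B \<pi> (grant Y) \<le> levels M + 1"
proof -
  have fin: "finite (cells B)" using assms(1) finite_cells by (simp add: placed_def)
  have "excess B \<pi> (grant Y) \<le> (\<Sum>(e, \<kappa>)\<in>cells B. grant X e \<kappa> - grant Y e \<kappa>)"
    unfolding excess_def by (intro sum_mono) (auto intro: diff_le_mono assms(4))
  also have "\<dots> \<le> levels M + 1"
  proof (rule sum_grant_loss[OF assms(5,6,7,9) fin _ assms(8)])
    fix e \<kappa> assume "(e, \<kappa>) \<in> cells B"
    then show "6 \<le> e \<and> 2 ^ e \<le> M" using sparse_exp_ge[OF assms(2)] assms(3) by (metis cellsE)
  qed
  finally show ?thesis .
qed

lemma sum_grant_grant_le: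
  assumes "base b = b" "6 \<le> b"
  shows "(\<Sum>e | base e = b. grant X e \<kappa> + grant Y e \<kappa>) \<le> 2 ^ b div 2"
  unfolding sum.distrib
  using sum_grant_level_le[OF assms, of X \<kappa>] sum_grant_level_le[OF assms, of Y \<kappa>] by linarith

lemma reserved_delete:
  assumes reserved: "reserved B \<pi>" and dn: "sparse 64 B" and j: "j \<in> dom B"
    and M: "\<And>j e k. B j = Some (e, k) \<Longrightarrow> 2 ^ e \<le> M"
  shows "\<exists>\<pi>'. reserved (B(j := None)) \<pi>' \<and> card {i \<in> dom B - {j}. \<pi>' i \<noteq> \<pi> i} \<le> 3 * levels M + 2"
proof -
  let ?A = "B(j := None)"
  obtain e0 k0 where e0: "B j = Some (e0, k0)" using j by auto
  have BA: "B = ?A(j \<mapsto> (e0, k0))" using e0 by auto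
  have pl: "placed B \<pi>" and occupancy: "\<And>e \<kappa>. occupancy B \<pi> e \<kappa> \<le> grant B e \<kappa>" using reserved by (auto simp: reserved_def)
  have fin: "finite (dom B)" using pl by (simp add: placed_def)
  have dA: "sparse 64 ?A" by (rule sparse_mono[OF dn]) (auto simp: map_le_def)
  have plA: "placed ?A \<pi>" using pl by (auto simp: placed_def inj_on_def)
  have occA: "occupancy ?A \<pi> e \<kappa> \<le> grant B e \<kappa>" for e \<kappa>
  proof -
    have "occupancy ?A \<pi> e \<kappa> \<le> occupancy B \<pi> e \<kappa>"
      unfolding occupancy_def using finite_occupants[OF fin] by (intro card_mono) auto
    then show ?thesis using occupancy le_trans by blast
  qed
  have MA: "\<And>j' e k. ?A j' = Some (e, k) \<Longrightarrow> 2 ^ e \<le> M" using M by (auto split: if_splits)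
  have "excess ?A \<pi> (grant ?A) \<le> levels M + 1"
    by (rule excess_le[OF plA dA MA occA _ _ BA M[OF e0]]) (use fin in auto)
  moreover have "\<exists>\<pi>'. placed ?A \<pi>' \<and> (\<forall>e \<kappa>. occupancy ?A \<pi>' e \<kappa> \<le> grant ?A e \<kappa>) \<and>
      card {i \<in> dom ?A. \<pi>' i \<noteq> \<pi> i} \<le> 2 * excess ?A \<pi> (grant ?A)"
  proof (rule repair[OF dA, of "grant ?A" "\<lambda>e \<kappa>. grant B e \<kappa> + grant ?A e \<kappa>"])
    show "occupancy ?A \<pi> e \<kappa> \<le> grant B e \<kappa> + grant ?A e \<kappa>" for e \<kappa> using occA by (rule trans_le_add1)
  qed (use plA grants_cover[OF dA] sum_grant_grant_le in auto)
  ultimately obtain \<pi>' where "placed ?A \<pi>'" "\<forall>e \<kappa>. occupancy ?A \<pi>' e \<kappa> \<le> grant ?A e \<kappa>"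
    "card {i \<in> dom ?A. \<pi>' i \<noteq> \<pi> i} \<le> 3 * levels M + 2" by fastforce
  then show ?thesis by (intro exI[of _ \<pi>']) (simp add: reserved_def)
qed

text \<open>The old jobs are first fitted into the grants of the enlarged set. These also provide
  for the new job, so an interval with a spare grant is left for it; placing it there displaces at
  most one job per level and alters no other occupancy.\<close>

lemma reserved_insert:
  assumes reserved: "reserved B \<pi>" and j: "j \<notin> dom B" and dn: "sparse 64 (B(j \<mapsto> (e0, k0)))"
    and M: "\<And>j e k. B j = Some (e, k) \<Longrightarrow> 2 ^ e \<le> M" and M0: "2 ^ e0 \<le> M"
  shows "\<exists>\<pi>'. reserved (B(j \<mapsto> (e0, k0))) \<pi>' \<and> card {i \<in> dom B. \<pi>' i \<noteq> \<pi> i} \<le> 3 * levels M + 2"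
proof -
  let ?A = "B(j \<mapsto> (e0, k0))"
  have pl: "placed B \<pi>" and occupancy: "\<And>e \<kappa>. occupancy B \<pi> e \<kappa> \<le> grant B e \<kappa>" using reserved by (auto simp: reserved_def)
  have fin: "finite (dom B)" using pl by (simp add: placed_def)
  have dB: "sparse 64 B" by (rule sparse_mono[OF dn]) (use j in \<open>auto simp: map_le_def\<close>)
  have e6: "6 \<le> e0" using sparse_exp_ge[OF dn, of j] by simp
  have wt: "weight ?A W = weight B W + (if W = (e0, k0) then 1 else 0)" for W
    using weight_upd[OF fin j] .
  have ex: "excess B \<pi> (grant ?A) \<le> levels M + 1"
    by (rule excess_le[OF pl dB M occupancy fin j refl M0]) auto
  have "\<exists>\<pi>1. placed B \<pi>1 \<and> (\<forall>e \<kappa>. occupancy B \<pi>1 e \<kappa> \<le> grant ?A e \<kappa>) \<and>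
      card {i \<in> dom B. \<pi>1 i \<noteq> \<pi> i} \<le> 2 * excess B \<pi> (grant ?A)"
  proof (rule repair[OF dB, of "grant ?A" "\<lambda>e \<kappa>. grant B e \<kappa> + grant ?A e \<kappa>"])
    show "occupancy B \<pi> e \<kappa> \<le> grant B e \<kappa> + grant ?A e \<kappa>" for e \<kappa> using occupancy by (rule trans_le_add1)
    show "weight B (e, k) \<le> (\<Sum>\<kappa> | \<kappa> div 2 ^ (e - base e) = k. grant ?A e \<kappa>)" if "6 \<le> e" for e k
      using grants_cover[OF dn that, of k] wt[of "(e, k)"] by linarith
  qed (use pl sum_grant_grant_le in auto)
  then obtain \<pi>1 where pl1: "placed B \<pi>1" and occ1: "\<And>e \<kappa>. occupancy B \<pi>1 e \<kappa> \<le> grant ?A e \<kappa>"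
    and ch1: "card {i \<in> dom B. \<pi>1 i \<noteq> \<pi> i} \<le> 2 * levels M + 2" using ex by fastforce
  \<comment> \<open>The old jobs of this window are one fewer than the new grants cover.\<close>
  have "\<exists>\<kappa>. \<kappa> div 2 ^ (e0 - base e0) = k0 \<and> occupancy B \<pi>1 e0 \<kappa> < grant ?A e0 \<kappa>"
  proof (rule ccontr)
    assume "\<not> ?thesis"
    then have "(\<Sum>\<kappa> | \<kappa> div 2 ^ (e0 - base e0) = k0. grant ?A e0 \<kappa>) \<le> (\<Sum>\<kappa> | \<kappa> div 2 ^ (e0 - base e0) = k0. occupancy B \<pi>1 e0 \<kappa>)"
      by (intro sum_mono) (auto simp: not_less)
    then show False
      using grants_cover[OF dn e6, of k0] sum_occupancy[OF pl1, of e0 k0] wt[of "(e0, k0)"] by simp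
  qed
  then obtain \<kappa> where \<kappa>: "\<kappa> div 2 ^ (e0 - base e0) = k0" "occupancy B \<pi>1 e0 \<kappa> < grant ?A e0 \<kappa>" by blast
  have "\<exists>\<pi>'. placed ?A \<pi>' \<and> \<pi>' j div 2 ^ base e0 = \<kappa> \<and>
     (\<forall>i e' k'. B i = Some (e', k') \<longrightarrow> \<pi>' i div 2 ^ base e' = \<pi>1 i div 2 ^ base e') \<and>
     card {i \<in> dom B. \<pi>' i \<noteq> \<pi>1 i} \<le> card {b \<in> base ` {e. 2 ^ e \<le> M}. base e0 < b}"
  proof (rule place_new[OF pl1 j \<kappa>(1) _ M M0])
    fix b \<kappa>1 assume b: "base b = b" "base e0 \<le> b"
    have b6: "6 \<le> b" using base_height(1)[OF e6] b by simp
    have half: "2 ^ b div 4 \<le> 2 ^ b div (2::nat)" by (rule div_le_mono2) auto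
    show "card (crowd B \<pi>1 b \<kappa>1) < 2 ^ b"
      by (rule crowd_card_less[OF pl1 dB b(1) b6 occ1 le_trans[OF sum_grant_level_le[OF b(1) b6] half]])
  qed
  then obtain \<pi>' where \<pi>': "placed ?A \<pi>'" "\<pi>' j div 2 ^ base e0 = \<kappa>"
     "\<And>i e' k'. B i = Some (e', k') \<Longrightarrow> \<pi>' i div 2 ^ base e' = \<pi>1 i div 2 ^ base e'"
     "card {i \<in> dom B. \<pi>' i \<noteq> \<pi>1 i} \<le> card {b \<in> base ` {e. 2 ^ e \<le> M}. base e0 < b}" by blast
  have "occupancy ?A \<pi>' e \<kappa>' \<le> grant ?A e \<kappa>'" for e \<kappa>'
  proof -
    let ?S = "{i. \<exists>k. B i = Some (e, k) \<and> \<pi>1 i div 2 ^ base e = \<kappa>'}"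
    let ?S' = "{i. \<exists>k. ?A i = Some (e, k) \<and> \<pi>' i div 2 ^ base e = \<kappa>'}"
    have sub: "?S' \<subseteq> insert j ?S" using \<pi>'(3) by auto
    show ?thesis
    proof (cases "(e, \<kappa>') = (e0, \<kappa>)")
      case True
      have "card ?S' \<le> card (insert j ?S)" using finite_occupants[OF fin] sub by (intro card_mono) auto
      also have "\<dots> \<le> Suc (card ?S)" using finite_occupants[OF fin] by (simp add: card_insert_if)
      finally have "occupancy ?A \<pi>' e \<kappa>' \<le> Suc (occupancy B \<pi>1 e \<kappa>')" unfolding occupancy_def .
      then show ?thesis using \<kappa>(2) True by simp
    next
      case False
      then have "j \<notin> ?S'" using \<pi>'(2) by auto
      then have "?S' \<subseteq> ?S" using sub by blast
      then have "card ?S' \<le> card ?S" by (intro card_mono finite_occupants[OF fin])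
      then have "occupancy ?A \<pi>' e \<kappa>' \<le> occupancy B \<pi>1 e \<kappa>'" unfolding occupancy_def .
      then show ?thesis using occ1 le_trans by blast
    qed
  qed
  then have "reserved ?A \<pi>'" using \<pi>'(1) by (simp add: reserved_def)
  moreover have "card {i \<in> dom B. \<pi>' i \<noteq> \<pi> i} \<le> 3 * levels M + 2"
  proof -
    have "card {b \<in> base ` {e. 2 ^ e \<le> M}. base e0 < b} \<le> levels M"
      unfolding levels_def using finite_exps by (intro card_mono) auto
    then have ch: "card {i \<in> dom B. \<pi>' i \<noteq> \<pi>1 i} \<le> levels M" using \<pi>'(4) by simp
    have "card {i \<in> dom B. \<pi>' i \<noteq> \<pi> i} \<le> card ({i \<in> dom B. \<pi>' i \<noteq> \<pi>1 i} \<union> {i \<in> dom B. \<pi>1 i \<noteq> \<pi> i})"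
      using fin by (intro card_mono) auto
    also have "\<dots> \<le> card {i \<in> dom B. \<pi>' i \<noteq> \<pi>1 i} + card {i \<in> dom B. \<pi>1 i \<noteq> \<pi> i}" by (rule card_Un_le)
    finally show ?thesis using ch ch1 by simp
  qed
  ultimately show ?thesis by blast
qed

subsection \<open>Trimming long windows\<close>

text \<open>With the factor 128, the jobs trimmed to exponents up to v have numbers below 2 ^ v /
  128 and use as much density as the untrimmed windows do. Minimality bounds the trimmed length by
  \<open>256 * (q + 1)\<close>.\<close>

definition trim_exp :: "nat \<Rightarrow> nat" where
  "trim_exp q = (LEAST t. 128 * (q + 1) \<le> 2 ^ t)"

lemma trim_exp_ge: "128 * (q + 1) \<le> 2 ^ trim_exp q"
  unfolding trim_exp_def by (rule LeastI[of _ "128 * (q + 1)"]) (rule less_imp_le[OF less_exp])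

lemma trim_exp_le: "2 ^ trim_exp q \<le> 256 * (q + 1)"
proof (cases "trim_exp q")
  case (Suc t)
  then have "\<not> 128 * (q + 1) \<le> 2 ^ t" 
    using not_less_Least[of t "\<lambda>t. 128 * (q + 1) \<le> 2 ^ t"] unfolding trim_exp_def by simp
  then show ?thesis using Suc by simp
qed simp

definition trim :: "nat \<Rightarrow> nat \<times> int \<Rightarrow> nat \<times> int" where
  "trim q W = (if trim_exp q \<le> fst W then (trim_exp q, snd W * 2 ^ (fst W - trim_exp q)) else W)"

lemma inside_trim: "inside (trim q W) W"
  by (simp add: inside_def trim_def)

lemma trim_bound: "2 ^ fst (trim q W) \<le> 256 * (q + 1)"
proof (cases "trim_exp q \<le> fst W")
  case True
  then show ?thesis using trim_exp_le[of q] by (simp add: trim_def)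
next
  case False
  then have "(2::nat) ^ fst W \<le> 2 ^ trim_exp q" by (intro power_increasing) auto
  then have "2 ^ fst W \<le> 256 * (q + 1)" using trim_exp_le[of q] by (rule le_trans)
  then show ?thesis using False by (simp add: trim_def)
qed

definition trimmed :: "djobs \<Rightarrow> (job \<Rightarrow> nat) \<Rightarrow> djobs" where
  "trimmed A num = (\<lambda>j. map_option (trim (num j)) (A j))"

lemma dom_trimmed [simp]: "dom (trimmed A num) = dom A"
  by (auto simp: trimmed_def)

text \<open>Since the job numbers are distinct, at most \<open>2 ^ v div 128\<close> jobs are trimmed to an exponent
  \<open>\<le> v\<close> in total; so trimming them all into the same place does no harm.\<close>

lemma sparse_trimmed:
  assumes "sparse 128 A" "inj_on num (dom A)"
  shows "sparse 64 (trimmed A num)"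
proof -
  have fin: "finite (dom A)" using assms(1) by (simp add: sparse_def)
  have "64 * card {j. \<exists>W. trimmed A num j = Some W \<and> inside W V} \<le> 2 ^ fst V" for V
  proof -
    let ?I = "{j. \<exists>W. A j = Some W \<and> inside W V}"
    let ?T = "{j \<in> dom A. 128 * (num j + 1) \<le> 2 ^ fst V}"
    have "{j. \<exists>W. trimmed A num j = Some W \<and> inside W V} \<subseteq> ?I \<union> ?T"
    proof
      fix j assume "j \<in> {j. \<exists>W. trimmed A num j = Some W \<and> inside W V}"
      then obtain W where W: "A j = Some W" "inside (trim (num j) W) V" by (auto simp: trimmed_def)
      show "j \<in> ?I \<union> ?T"
      proof (cases "trim_exp (num j) \<le> fst W")
        case True
        then have "trim_exp (num j) \<le> fst V" using W(2) by (simp add: inside_def trim_def)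
        then have "(2::nat) ^ trim_exp (num j) \<le> 2 ^ fst V" by (intro power_increasing) auto
        then have "128 * (num j + 1) \<le> 2 ^ fst V" using trim_exp_ge le_trans by blast
        then show ?thesis using W(1) by blast
      next
        case False
        then have "inside W V" using W(2) by (simp add: trim_def)
        then show ?thesis using W(1) by blast
      qed
    qed
    moreover have finI: "finite ?I" by (rule finite_subset[OF _ fin]) auto
    ultimately have "card {j. \<exists>W. trimmed A num j = Some W \<and> inside W V} \<le> card (?I \<union> ?T)"
      using fin by (intro card_mono) auto
    also have "\<dots> \<le> card ?I + card ?T" by (rule card_Un_le)
    finally have c: "card {j. \<exists>W. trimmed A num j = Some W \<and> inside W V} \<le> card ?I + card ?T" .
    have "card ?T \<le> card {..<2 ^ fst V div (128::nat)}"
    proof (rule card_inj_on_le)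
      show "inj_on num ?T" by (rule inj_on_subset[OF assms(2)]) auto
      show "num ` ?T \<subseteq> {..<2 ^ fst V div 128}"
        by (auto simp: less_eq_div_iff_mult_less_eq Suc_le_eq[symmetric])
    qed simp
    then have "128 * card ?T \<le> 2 ^ fst V" by simp
    moreover have "128 * card ?I \<le> 2 ^ fst V" using assms(1) unfolding sparse_def by blast
    ultimately show ?thesis using c by linarith
  qed
  then show ?thesis using fin by (simp only: sparse_def dom_trimmed) simp
qed

definition machine_inv :: "djobs \<Rightarrow> (job \<Rightarrow> nat) \<Rightarrow> (job \<Rightarrow> int) \<Rightarrow> bool" where
  "machine_inv A num \<pi> \<longleftrightarrow> inj_on num (dom A) \<and> num ` dom A \<subseteq> {..<card (dom A)} \<and> reserved (trimmed A num) \<pi>"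

lemma machine_inv_finite: "machine_inv A num \<pi> \<Longrightarrow> finite (dom A)"
  by (simp add: machine_inv_def reserved_def placed_def)

lemma trimmed_exp_bound:
  assumes "num ` dom A \<subseteq> {..<n}" "\<And>j e k. A j = Some (e, k) \<Longrightarrow> 2 ^ e \<le> D"
    and "trimmed A num j = Some (e, k)"
  shows "2 ^ e \<le> min D (256 * n)"
proof -
  obtain e' k' where j: "A j = Some (e', k')" "(e, k) = trim (num j) (e', k')"
    using assms(3) by (auto simp: trimmed_def)
  have "e \<le> e'" using inside_trim[of "num j" "(e', k')"] j(2) by (metis fst_conv inside_def)
  then have "(2::nat) ^ e \<le> 2 ^ e'" by (intro power_increasing) auto
  also have "\<dots> \<le> D" using assms(2)[OF j(1)] .
  finally have "2 ^ e \<le> D" .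
  moreover have "num j + 1 \<le> n" using assms(1) j(1) by (force simp: Suc_le_eq)
  then have "256 * (num j + 1) \<le> 256 * n" by (rule mult_le_mono2)
  then have "2 ^ e \<le> 256 * n" using trim_bound[of "num j" "(e', k')"] j(2)[symmetric] by simp
  ultimately show ?thesis by simp
qed

lemma machine_inv_insert:
  assumes s: "machine_inv A num \<pi>" and j: "j \<notin> dom A" and dn: "sparse 128 (A(j \<mapsto> W))"
    and D: "\<And>i e k. (A(j \<mapsto> W)) i = Some (e, k) \<Longrightarrow> 2 ^ e \<le> D"
    and n: "card (dom (A(j \<mapsto> W))) \<le> n"
  shows "\<exists>num' \<pi>'. machine_inv (A(j \<mapsto> W)) num' \<pi>' \<and>
           card {i \<in> dom A. \<pi>' i \<noteq> \<pi> i} \<le> 3 * levels (min D (256 * n)) + 2"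
proof -
  let ?A = "A(j \<mapsto> W)"
  define num' where "num' = num(j := card (dom A))"
  have fin: "finite (dom A)" using machine_inv_finite[OF s] .
  have cA: "card (dom ?A) = Suc (card (dom A))" using fin j by simp
  have num: "inj_on num (dom A)" "num ` dom A \<subseteq> {..<card (dom A)}" and reserved: "reserved (trimmed A num) \<pi>"
    using s by (auto simp: machine_inv_def)
  have inj': "inj_on num' (dom ?A)"
  proof (rule inj_onI)
    fix x y assume xy: "x \<in> dom ?A" "y \<in> dom ?A" "num' x = num' y"
    have lt: "num z < card (dom A)" if "z \<in> dom ?A" "z \<noteq> j" for z using that num(2) by auto
    show "x = y" using xy lt[of x] lt[of y] inj_onD[OF num(1), of x y]
      by (cases "x = j"; cases "y = j") (auto simp: num'_def)
  qed
  have im': "num' ` dom ?A \<subseteq> {..<card (dom ?A)}"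
    unfolding cA using num(2) by (force simp: num'_def)
  have im'n: "num' ` dom ?A \<subseteq> {..<n}" using im' n by (meson lessThan_subset_iff subset_trans)
  obtain e0 k0 where t: "trim (num' j) W = (e0, k0)" by force
  have eq: "trimmed ?A num' = (trimmed A num)(j \<mapsto> (e0, k0))" using j t by (auto simp: trimmed_def num'_def)
  have M: "2 ^ e \<le> min D (256 * n)" if "trimmed ?A num' i = Some (e, k)" for i e k
    using trimmed_exp_bound[OF im'n D that] .
  have "\<exists>\<pi>'. reserved ((trimmed A num)(j \<mapsto> (e0, k0))) \<pi>' \<and>
    card {i \<in> dom (trimmed A num). \<pi>' i \<noteq> \<pi> i} \<le> 3 * levels (min D (256 * n)) + 2"
  proof (rule reserved_insert[OF reserved])
    show "j \<notin> dom (trimmed A num)" using j by simp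
    show "sparse 64 ((trimmed A num)(j \<mapsto> (e0, k0)))" using sparse_trimmed[OF dn inj'] eq by simp
    show "2 ^ e0 \<le> min D (256 * n)" using M[of j e0 k0] eq by simp
    show "2 ^ e \<le> min D (256 * n)" if i: "trimmed A num i = Some (e, k)" for i e k
    proof -
      have "i \<noteq> j" using i j by (auto simp: trimmed_def)
      then show ?thesis using M[of i e k] i eq by simp
    qed
  qed
  then obtain \<pi>' where "reserved (trimmed ?A num') \<pi>'"
    "card {i \<in> dom A. \<pi>' i \<noteq> \<pi> i} \<le> 3 * levels (min D (256 * n)) + 2"
    unfolding eq dom_trimmed by blast
  then show ?thesis using inj' im' by (intro exI[of _ num'] exI[of _ \<pi>']) (simp only: machine_inv_def simp_thms)
qed

lemma card_changes_trans:
  assumes "finite S"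
  shows "card {i \<in> S. h i \<noteq> f i} \<le> card {i \<in> S. h i \<noteq> g i} + card {i \<in> S. g i \<noteq> f i}"
proof -
  have "card {i \<in> S. h i \<noteq> f i} \<le> card ({i \<in> S. h i \<noteq> g i} \<union> {i \<in> S. g i \<noteq> f i})"
    using assms by (intro card_mono) auto
  also have "\<dots> \<le> card {i \<in> S. h i \<noteq> g i} + card {i \<in> S. g i \<noteq> f i}" by (rule card_Un_le)
  finally show ?thesis .
qed

text \<open>The gap in the numbering is closed by the job \<open>l\<close> with the largest number.
  Its trimmed window may change, so \<open>l\<close> is deleted and inserted again: three updates at
  \<open>3 * levels + 2\<close> each, and 1 for \<open>l\<close> itself.\<close>

lemma machine_inv_delete:
  assumes s: "machine_inv A num \<pi>" and j: "j \<in> dom A" and dn: "sparse 128 A"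
    and D: "\<And>i e k. A i = Some (e, k) \<Longrightarrow> 2 ^ e \<le> D"
    and n: "card (dom A) \<le> n"
  shows "\<exists>num' \<pi>'. machine_inv (A(j := None)) num' \<pi>' \<and>
           card {i \<in> dom A - {j}. \<pi>' i \<noteq> \<pi> i} \<le> 9 * levels (min D (256 * n)) + 7"
proof -
  let ?A = "A(j := None)"
  let ?M = "min D (256 * n)"
  let ?B = "trimmed A num"
  have fin: "finite (dom A)" using machine_inv_finite[OF s] .
  have num: "inj_on num (dom A)" "num ` dom A \<subseteq> {..<card (dom A)}" and reserved: "reserved ?B \<pi>"
    using s by (auto simp: machine_inv_def)
  have numn: "num ` dom A \<subseteq> {..<n}" using num(2) n by (meson lessThan_subset_iff subset_trans)
  have dB: "sparse 64 ?B" using sparse_trimmed[OF dn num(1)] .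
  have M: "2 ^ e \<le> ?M" if "?B i = Some (e, k)" for i e k
    using trimmed_exp_bound[OF numn D that] .
  have "num ` dom A = {..<card (dom A)}"
    using num fin by (intro card_subset_eq) (auto simp: card_image)
  moreover have "0 < card (dom A)" using j fin by (auto simp: card_gt_0_iff)
  ultimately have "card (dom A) - 1 \<in> num ` dom A" by simp
  then obtain l where l: "l \<in> dom A" "num l = card (dom A) - 1" by (metis imageE)
  define num' where "num' = num(l := num j)"
  have cA: "card (dom ?A) = card (dom A) - 1" using fin j by simp
  have inj': "inj_on num' (dom ?A)"
  proof (rule inj_onI)
    fix x y assume xy: "x \<in> dom ?A" "y \<in> dom ?A" "num' x = num' y"
    have x: "x \<in> dom A" "x \<noteq> j" and y: "y \<in> dom A" "y \<noteq> j" using xy(1,2) by auto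
    \<comment> \<open>Renaming \<open>l\<close> to \<open>j\<close> turns \<open>num'\<close> into
      \<open>num\<close>, and the renaming is injective on jobs other than \<open>j\<close>.\<close>
    have "num' z = num (if z = l then j else z)" for z by (simp add: num'_def)
    then have "num (if x = l then j else x) = num (if y = l then j else y)" using xy(3) by simp
    moreover have "(if x = l then j else x) \<in> dom A" "(if y = l then j else y) \<in> dom A"
      using x y j by (simp_all split: if_split)
    ultimately have "(if x = l then j else x) = (if y = l then j else y)" by (rule inj_onD[OF num(1)])
    then show "x = y" using x(2) y(2) by (simp split: if_split_asm)
  qed
  have im': "num' ` dom ?A \<subseteq> {..<card (dom ?A)}"
  proof
    fix q assume "q \<in> num' ` dom ?A"
    then obtain x where x: "x \<in> dom A" "x \<noteq> j" "q = num' x" by auto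
    have "num' x < card (dom A)" using num(2) x j by (auto simp: num'_def)
    moreover have "num' x \<noteq> card (dom A) - 1"
    proof (cases "x = l")
      case True
      then show ?thesis using inj_onD[OF num(1), of j l] j l x by (auto simp: num'_def)
    next
      case False
      then show ?thesis using inj_onD[OF num(1), of x l] l x by (auto simp: num'_def)
    qed
    ultimately show "q \<in> {..<card (dom ?A)}" using x(3) cA by simp
  qed
  have jB: "j \<in> dom ?B" using j by simp
  obtain \<pi>1 where \<pi>1: "reserved (?B(j := None)) \<pi>1" "card {i \<in> dom A - {j}. \<pi>1 i \<noteq> \<pi> i} \<le> 3 * levels ?M + 2"
    using reserved_delete[OF reserved dB jB, of ?M] M unfolding dom_trimmed by blast
  show ?thesis
  proof (cases "l = j")
    case True
    then have "trimmed ?A num' = ?B(j := None)" by (auto simp: trimmed_def num'_def)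
    then have "machine_inv ?A num' \<pi>1" using inj' im' \<pi>1(1) by (simp add: machine_inv_def)
    then show ?thesis using \<pi>1(2) by (intro exI[of _ num'] exI[of _ \<pi>1]) simp
  next
    case False
    let ?B1 = "?B(j := None)"
    let ?B2 = "?B1(l := None)"
    obtain W where W: "A l = Some W" using l by auto
    obtain e0 k0 where t: "trim (num j) W = (e0, k0)" by force
    have eq: "trimmed ?A num' = ?B2(l \<mapsto> (e0, k0))"
      using W t False by (auto simp: trimmed_def num'_def)
    have d1: "sparse 64 ?B1" by (rule sparse_mono[OF dB]) (auto simp: map_le_def)
    have M1: "2 ^ e \<le> ?M" if "?B1 i = Some (e, k)" for i e k using M[of i e k] that by (auto split: if_splits)
    have M2: "2 ^ e \<le> ?M" if "?B2 i = Some (e, k)" for i e k using M[of i e k] that by (auto split: if_splits)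
    have l1: "l \<in> dom ?B1" using l False by simp
    obtain \<pi>2 where \<pi>2: "reserved ?B2 \<pi>2" "card {i \<in> dom ?B1 - {l}. \<pi>2 i \<noteq> \<pi>1 i} \<le> 3 * levels ?M + 2"
      using reserved_delete[OF \<pi>1(1) d1 l1, of ?M] M1 by blast
    have "card (dom ?A) \<le> n" using cA n by linarith
    then have im'n: "num' ` dom ?A \<subseteq> {..<n}" using im' by (meson lessThan_subset_iff subset_trans)
    have DA: "2 ^ e \<le> D" if "?A i = Some (e, k)" for i e k using D[of i e k] that by (auto split: if_splits)
    have M0: "2 ^ e0 \<le> ?M"
    proof (rule trimmed_exp_bound[OF im'n])
      show "trimmed ?A num' l = Some (e0, k0)" using eq by simp
    qed (rule DA)
    have l2: "l \<notin> dom ?B2" by simp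
    have dA: "sparse 128 ?A" by (rule sparse_mono[OF dn]) (auto simp: map_le_def)
    have d3: "sparse 64 (?B2(l \<mapsto> (e0, k0)))" using sparse_trimmed[OF dA inj'] eq by simp
    obtain \<pi>3 where \<pi>3: "reserved (?B2(l \<mapsto> (e0, k0))) \<pi>3" "card {i \<in> dom ?B2. \<pi>3 i \<noteq> \<pi>2 i} \<le> 3 * levels ?M + 2"
      using reserved_insert[OF \<pi>2(1) l2 d3 _ M0] M2 by blast
    define S where "S = dom A - {j, l}"
    have finS: "finite S" using fin by (simp add: S_def)
    have c1: "card {i \<in> S. \<pi>1 i \<noteq> \<pi> i} \<le> 3 * levels ?M + 2"
      by (rule le_trans[OF card_mono \<pi>1(2)]) (use fin in \<open>auto simp: S_def\<close>)
    have "dom ?B1 - {l} = S" "dom ?B2 = S" by (auto simp: S_def)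
    then have c2: "card {i \<in> S. \<pi>2 i \<noteq> \<pi>1 i} \<le> 3 * levels ?M + 2"
      and c3: "card {i \<in> S. \<pi>3 i \<noteq> \<pi>2 i} \<le> 3 * levels ?M + 2" using \<pi>2(2) \<pi>3(2) by auto
    have "card {i \<in> S. \<pi>3 i \<noteq> \<pi> i} \<le> 9 * levels ?M + 6"
      using card_changes_trans[OF finS, of \<pi>3 \<pi> \<pi>2] card_changes_trans[OF finS, of \<pi>2 \<pi> \<pi>1] c1 c2 c3
      by linarith
    moreover have "card {i \<in> dom A - {j}. \<pi>3 i \<noteq> \<pi> i} \<le> card (insert l {i \<in> S. \<pi>3 i \<noteq> \<pi> i})"
      using finS by (intro card_mono) (auto simp: S_def)
    moreover have "\<dots> \<le> Suc (card {i \<in> S. \<pi>3 i \<noteq> \<pi> i})" using finS by (simp add: card_insert_if)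
    ultimately have "card {i \<in> dom A - {j}. \<pi>3 i \<noteq> \<pi> i} \<le> 9 * levels ?M + 7" by linarith
    moreover have "machine_inv ?A num' \<pi>3" using inj' im' \<pi>3(1) eq by (simp add: machine_inv_def)
    ultimately show ?thesis by blast
  qed
qed

subsection \<open>Several machines\<close>

definition msparse :: "nat \<Rightarrow> djobs \<Rightarrow> bool" where
  "msparse m A \<longleftrightarrow> finite (dom A) \<and> (\<forall>j e k. A j = Some (e, k) \<longrightarrow> 9 \<le> e) \<and>
     (\<forall>V. 256 * card {j. \<exists>W. A j = Some W \<and> inside W V} \<le> m * 2 ^ fst V)"

definition on_machine :: "djobs \<Rightarrow> (job \<Rightarrow> nat) \<Rightarrow> nat \<Rightarrow> djobs" where
  "on_machine A mach p = A |` {j. mach j = p}"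

definition balanced :: "nat \<Rightarrow> djobs \<Rightarrow> (job \<Rightarrow> nat) \<Rightarrow> bool" where
  "balanced m A mach \<longleftrightarrow>
     (\<forall>W. \<forall>p<m. \<forall>q<m. weight (on_machine A mach p) W \<le> weight (on_machine A mach q) W + 1)"

lemma on_machine_Some: "on_machine A mach p j = Some W \<longleftrightarrow> A j = Some W \<and> mach j = p"
  by (auto simp: on_machine_def restrict_map_def)

lemma dom_on_machine: "dom (on_machine A mach p) = {j \<in> dom A. mach j = p}"
  by (auto simp: on_machine_def)

lemma sum_weight_on_machine:
  assumes "finite (dom A)" "\<And>j. j \<in> dom A \<Longrightarrow> mach j < m"
  shows "(\<Sum>q<m. weight (on_machine A mach q) W) = weight A W"
proof -
  have fin: "finite {j. A j = Some W}" by (rule finite_subset[OF _ assms(1)]) auto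
  have "(\<Sum>q<m. weight (on_machine A mach q) W) = (\<Sum>q<m. card {j \<in> {j. A j = Some W}. mach j = q})"
    unfolding weight_def on_machine_Some by (intro sum.cong) auto
  also have "\<dots> = card {j \<in> {j. A j = Some W}. mach j \<in> {..<m}}"
    using fin by (intro sum_card_fibers) auto
  also have "{j \<in> {j. A j = Some W}. mach j \<in> {..<m}} = {j. A j = Some W}" using assms(2) by auto
  finally show ?thesis unfolding weight_def .
qed

lemma sum_weight_inside:
  assumes "finite (dom B)" "e \<le> v"
  shows "(\<Sum>k | k div 2 ^ (v - e) = c. weight B (e, k)) =
         card {j. \<exists>W. B j = Some W \<and> inside W (v, c) \<and> fst W = e}"
proof -
  define J where "J = {j. \<exists>W. B j = Some W \<and> inside W (v, c) \<and> fst W = e}"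
  have fin: "finite J" unfolding J_def by (rule finite_subset[OF _ assms(1)]) auto
  have "weight B (e, k) = card {j \<in> J. snd (the (B j)) = k}" if "k div 2 ^ (v - e) = c" for k
  proof -
    have "inside (e, k) (v, c)" using that assms(2) by (simp add: inside_def)
    then have "{j. B j = Some (e, k)} = {j \<in> J. snd (the (B j)) = k}" by (auto simp: J_def)
    then show ?thesis by (simp add: weight_def)
  qed
  then have "(\<Sum>k | k div 2 ^ (v - e) = c. weight B (e, k)) =
      (\<Sum>k | k div 2 ^ (v - e) = c. card {j \<in> J. snd (the (B j)) = k})"
    by (intro sum.cong) auto
  also have "\<dots> = card {j \<in> J. snd (the (B j)) \<in> {k. k div 2 ^ (v - e) = c}}"
    using fin by (intro sum_card_fibers) auto
  also have "{j \<in> J. snd (the (B j)) \<in> {k. k div 2 ^ (v - e) = c}} = J"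
    by (auto simp: J_def inside_def)
  finally show ?thesis unfolding J_def .
qed

lemma card_inside_eq_sum:
  assumes fin: "finite (dom B)" and ge: "\<And>j e k. B j = Some (e, k) \<Longrightarrow> 9 \<le> e"
  shows "card {j. \<exists>W. B j = Some W \<and> inside W (v, c)} =
         (\<Sum>e\<in>{9..v}. \<Sum>k | k div 2 ^ (v - e) = c. weight B (e, k))"
proof -
  define J where "J = {j. \<exists>W. B j = Some W \<and> inside W (v, c)}"
  have finJ: "finite J" unfolding J_def by (rule finite_subset[OF _ fin]) auto
  have "(\<Sum>e\<in>{9..v}. \<Sum>k | k div 2 ^ (v - e) = c. weight B (e, k)) =
        (\<Sum>e\<in>{9..v}. card {j \<in> J. fst (the (B j)) = e})"
  proof (rule sum.cong[OF refl])
    fix e assume "e \<in> {9..v}"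
    then have "e \<le> v" by simp
    have "{j. \<exists>W. B j = Some W \<and> inside W (v, c) \<and> fst W = e} = {j \<in> J. fst (the (B j)) = e}"
      by (auto simp: J_def)
    then show "(\<Sum>k | k div 2 ^ (v - e) = c. weight B (e, k)) = card {j \<in> J. fst (the (B j)) = e}"
      using sum_weight_inside[OF fin \<open>e \<le> v\<close>, of c] by simp
  qed
  also have "\<dots> = card {j \<in> J. fst (the (B j)) \<in> {9..v}}"
    using finJ by (intro sum_card_fibers) auto
  also have "{j \<in> J. fst (the (B j)) \<in> {9..v}} = J"
    using ge by (auto simp: J_def inside_def)
  finally show ?thesis unfolding J_def by simp
qed

lemma sum_powers_le: "256 * (\<Sum>e\<in>{9..v}. (2::nat) ^ (v - e)) \<le> 2 ^ v"
proof (cases "8 \<le> v")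
  case True
  \<comment> \<open>The extra 256 makes the induction work: from \<open>v\<close> to
    \<open>Suc v\<close> the sum doubles and grows by 1.\<close>
  then have "256 * (\<Sum>e\<in>{9..v}. (2::nat) ^ (v - e)) + 256 \<le> 2 ^ v"
  proof (induction v rule: dec_induct)
    case (step v)
    have "(\<Sum>e\<in>{9..Suc v}. (2::nat) ^ (Suc v - e)) = (\<Sum>e\<in>{9..v}. 2 ^ (Suc v - e)) + 1"
      using step(1) by simp
    also have "(\<Sum>e\<in>{9..v}. (2::nat) ^ (Suc v - e)) = 2 * (\<Sum>e\<in>{9..v}. 2 ^ (v - e))"
      unfolding sum_distrib_left by (intro sum.cong) (auto simp: Suc_diff_le)
    finally show ?case using step(3) by simp
  qed simp
  then show ?thesis by linarith
qed simp

text \<open>A machine has at most a fair share of the jobs of each window, plus one for rounding. An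
  interval of length 2 ^ v contains 2 ^ (v - e) windows of exponent e; from exponent 9 on, these
  rounding errors form a geometric sum of at most 2 ^ v / 256. Share and error together give
  1/128.\<close>

lemma balanced_sparse:
  assumes md: "msparse m A" and bal: "balanced m A mach" and p: "p < m"
    and mach: "\<And>j. j \<in> dom A \<Longrightarrow> mach j < m"
  shows "sparse 128 (on_machine A mach p)"
proof -
  have fin: "finite (dom A)" using md by (simp add: msparse_def)
  have ge: "9 \<le> e" if "A j = Some (e, k)" for j e k using md that unfolding msparse_def by blast
  have finp: "finite (dom (on_machine A mach p))" using fin by (simp add: dom_on_machine)
  have gep: "9 \<le> e" if "on_machine A mach p j = Some (e, k)" for j e k using ge that unfolding on_machine_Some by blast
  have wp: "m * weight (on_machine A mach p) W \<le> weight A W + m" for W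
  proof -
    have "m * weight (on_machine A mach p) W = (\<Sum>q<m. weight (on_machine A mach p) W)" by simp
    also have "\<dots> \<le> (\<Sum>q<m. weight (on_machine A mach q) W + 1)"
      using bal p unfolding balanced_def by (intro sum_mono) blast
    also have "\<dots> = (\<Sum>q<m. weight (on_machine A mach q) W) + m" by (simp only: sum.distrib) simp
    also have "\<dots> = weight A W + m" using sum_weight_on_machine[OF fin, of mach m W] mach by (simp add: sum.distrib del: add_Suc_right)
    finally show ?thesis .
  qed
  have "128 * card {j. \<exists>W. on_machine A mach p j = Some W \<and> inside W (v, c)} \<le> 2 ^ v" for v c
  proof -
    let ?Jp = "card {j. \<exists>W. on_machine A mach p j = Some W \<and> inside W (v, c)}"
    let ?J = "card {j. \<exists>W. A j = Some W \<and> inside W (v, c)}"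
    have "m * ?Jp = (\<Sum>e\<in>{9..v}. \<Sum>k | k div 2 ^ (v - e) = c. m * weight (on_machine A mach p) (e, k))"
    proof -
      have "?Jp = (\<Sum>e\<in>{9..v}. \<Sum>k | k div 2 ^ (v - e) = c. weight (on_machine A mach p) (e, k))"
        by (rule card_inside_eq_sum[OF finp]) (rule gep)
      then show ?thesis by (simp only: sum_distrib_left)
    qed
    also have "\<dots> \<le> (\<Sum>e\<in>{9..v}. \<Sum>k | k div 2 ^ (v - e) = c. weight A (e, k) + m)"
      using wp by (intro sum_mono) auto
    also have "\<dots> = ?J + m * (\<Sum>e\<in>{9..v}. 2 ^ (v - e))"
    proof -
      have "?J = (\<Sum>e\<in>{9..v}. \<Sum>k | k div 2 ^ (v - e) = c. weight A (e, k))"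
        by (rule card_inside_eq_sum[OF fin]) (rule ge)
      then show ?thesis by (simp add: sum.distrib sum_distrib_left mult.commute)
    qed
    finally have "m * ?Jp \<le> ?J + m * (\<Sum>e\<in>{9..v}. 2 ^ (v - e))" .
    moreover have "256 * ?J \<le> m * 2 ^ v"
    proof -
      have "256 * ?J \<le> m * 2 ^ fst (v, c)" using md unfolding msparse_def by blast
      then show ?thesis by (simp only: fst_conv)
    qed
    moreover have "m * (256 * (\<Sum>e\<in>{9..v}. 2 ^ (v - e))) \<le> m * 2 ^ v"
      by (rule mult_le_mono2[OF sum_powers_le])
    moreover have "m * (256 * (\<Sum>e\<in>{9..v}. 2 ^ (v - e))) = 256 * (m * (\<Sum>e\<in>{9..v}. 2 ^ (v - e)))"
      by (rule mult.left_commute)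
    ultimately have "128 * (m * ?Jp) \<le> m * 2 ^ v" by linarith
    then have "m * (128 * ?Jp) \<le> m * 2 ^ v" by (simp only: mult.left_commute)
    then show ?thesis using p by (simp only: nat_mult_le_cancel1)
  qed
  from this[of "fst V" "snd V" for V]
  have "128 * card {j. \<exists>W. on_machine A mach p j = Some W \<and> inside W V} \<le> 2 ^ fst V" for V
    by (simp only: prod.collapse)
  then show ?thesis using finp unfolding sparse_def by blast
qed

definition system_inv :: "nat \<Rightarrow> djobs \<Rightarrow> (job \<Rightarrow> nat) \<Rightarrow> (nat \<Rightarrow> job \<Rightarrow> nat) \<Rightarrow> (nat \<Rightarrow> job \<Rightarrow> int) \<Rightarrow> bool" where
  "system_inv m A mach num \<pi> \<longleftrightarrow> (\<forall>j\<in>dom A. mach j < m) \<and> balanced m A mach \<and>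
     (\<forall>p<m. machine_inv (on_machine A mach p) (num p) (\<pi> p))"

lemma system_inv_insert:
  assumes mi: "system_inv m A mach num \<pi>" and m: "0 < m" and j: "j \<notin> dom A"
    and md: "msparse m (A(j \<mapsto> W))"
    and D: "\<And>i e k. (A(j \<mapsto> W)) i = Some (e, k) \<Longrightarrow> 2 ^ e \<le> D"
    and n: "card (dom (A(j \<mapsto> W))) \<le> n"
  shows "\<exists>mach' num' \<pi>'. system_inv m (A(j \<mapsto> W)) mach' num' \<pi>' \<and> (\<forall>i\<in>dom A. mach' i = mach i) \<and>
     card {i \<in> dom A. (mach' i, \<pi>' (mach' i) i) \<noteq> (mach i, \<pi> (mach i) i)}
       \<le> 3 * levels (min D (256 * n)) + 2"
proof -
  let ?A = "A(j \<mapsto> W)"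
  have fA: "finite (dom ?A)" using md unfolding msparse_def by blast
  have fin: "finite (dom A)" using fA by simp
  have mach: "\<And>i. i \<in> dom A \<Longrightarrow> mach i < m" and bal: "balanced m A mach"
    and si: "\<And>p. p < m \<Longrightarrow> machine_inv (on_machine A mach p) (num p) (\<pi> p)" using mi by (auto simp: system_inv_def)
  define w where "w q = weight (on_machine A mach q) W" for q
  \<comment> \<open>A machine with the fewest jobs of the window \<open>W\<close> can take one more
    without any migration.\<close>
  obtain p where p: "p < m" "\<And>q. q < m \<Longrightarrow> w p \<le> w q"
    using ex_min_if_finite[of "w ` {..<m}"] m by (force simp: not_less)
  define mach' where "mach' = mach(j := p)"
  have onp: "on_machine ?A mach' p = (on_machine A mach p)(j \<mapsto> W)"
    by (auto simp: on_machine_def restrict_map_def mach'_def)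
  have jN: "A j = None" using j by blast
  have onq: "on_machine ?A mach' q = on_machine A mach q" if "q \<noteq> p" for q
    by (rule ext) (use that jN in \<open>auto simp: on_machine_def restrict_map_def mach'_def\<close>)
  have jp: "j \<notin> dom (on_machine A mach p)" using j by (simp add: dom_on_machine)
  have finp: "finite (dom (on_machine A mach q))" for q using fin by (simp add: dom_on_machine)
  have wt: "weight (on_machine ?A mach' q) V = weight (on_machine A mach q) V + (if q = p \<and> V = W then 1 else 0)" for q V
    using weight_upd[OF finp jp, of W V] onp onq by (cases "q = p") auto
  have bal': "balanced m ?A mach'"
    unfolding balanced_def
  proof (intro allI impI)
    fix V q r assume qr: "q < m" "r < m"
    have "weight (on_machine A mach q) V \<le> weight (on_machine A mach r) V + 1" using bal qr unfolding balanced_def by blast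
    moreover have "V = W \<Longrightarrow> q = p \<Longrightarrow> weight (on_machine A mach q) V \<le> weight (on_machine A mach r) V"
      using p(2)[OF qr(2)] by (simp add: w_def)
    ultimately show "weight (on_machine ?A mach' q) V \<le> weight (on_machine ?A mach' r) V + 1" unfolding wt by auto
  qed
  have mach'm: "mach' i < m" if "i \<in> dom ?A" for i using that mach p(1) by (auto simp: mach'_def)
  have dp: "sparse 128 ((on_machine A mach p)(j \<mapsto> W))"
    using balanced_sparse[OF md bal' p(1) mach'm] onp by simp
  have Dp: "2 ^ e \<le> D" if "((on_machine A mach p)(j \<mapsto> W)) i = Some (e, k)" for i e k
    using D[of i e k] that unfolding onp[symmetric] on_machine_Some by simp
  have "card (dom ((on_machine A mach p)(j \<mapsto> W))) \<le> card (dom ?A)"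
    using fA unfolding onp[symmetric] dom_on_machine by (intro card_mono) auto
  then have np: "card (dom ((on_machine A mach p)(j \<mapsto> W))) \<le> n" using n by (rule le_trans)
  obtain num1 \<pi>1 where s1: "machine_inv ((on_machine A mach p)(j \<mapsto> W)) num1 \<pi>1"
    "card {i \<in> dom (on_machine A mach p). \<pi>1 i \<noteq> \<pi> p i} \<le> 3 * levels (min D (256 * n)) + 2"
    using machine_inv_insert[OF si[OF p(1)] jp dp _ np, of D] Dp by blast
  define num' where "num' = num(p := num1)"
  define \<pi>' where "\<pi>' = \<pi>(p := \<pi>1)"
  have "system_inv m ?A mach' num' \<pi>'"
    unfolding system_inv_def
  proof (intro conjI ballI allI impI)
    fix q assume q: "q < m"
    show "machine_inv (on_machine ?A mach' q) (num' q) (\<pi>' q)"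
    proof (cases "q = p")
      case True
      then show ?thesis using s1(1) unfolding num'_def \<pi>'_def by (simp add: onp)
    next
      case False
      then show ?thesis using si[OF q] unfolding num'_def \<pi>'_def by (simp add: onq)
    qed
  qed (use mach'm bal' in blast)+
  moreover have mm: "\<forall>i\<in>dom A. mach' i = mach i" using j by (auto simp: mach'_def)
  moreover have "card {i \<in> dom A. (mach' i, \<pi>' (mach' i) i) \<noteq> (mach i, \<pi> (mach i) i)}
       \<le> 3 * levels (min D (256 * n)) + 2"
  proof (rule le_trans[OF card_mono s1(2)])
    show "finite {i \<in> dom (on_machine A mach p). \<pi>1 i \<noteq> \<pi> p i}" using finp by simp
    show "{i \<in> dom A. (mach' i, \<pi>' (mach' i) i) \<noteq> (mach i, \<pi> (mach i) i)}
      \<subseteq> {i \<in> dom (on_machine A mach p). \<pi>1 i \<noteq> \<pi> p i}"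
      using mm by (auto simp: \<pi>'_def dom_on_machine split: if_splits)
  qed
  ultimately show ?thesis by blast
qed

text \<open>In the worse case two jobs are deleted and one is inserted on single machines, which
  costs 9 + 3 + 9 times the number of levels and 7 + 2 + 7 in addition; the migrating job adds
  1.\<close>

lemma system_inv_delete:
  assumes mi: "system_inv m A mach num \<pi>" and j: "A j = Some W"
    and md: "msparse m A" "msparse m (A(j := None))"
    and D: "\<And>i e k. A i = Some (e, k) \<Longrightarrow> 2 ^ e \<le> D"
    and n: "card (dom A) \<le> n"
  shows "\<exists>mach' num' \<pi>'. system_inv m (A(j := None)) mach' num' \<pi>' \<and>
     card {i \<in> dom A - {j}. mach' i \<noteq> mach i} \<le> 1 \<and>
     card {i \<in> dom A - {j}. (mach' i, \<pi>' (mach' i) i) \<noteq> (mach i, \<pi> (mach i) i)}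
       \<le> 21 * levels (min D (256 * n)) + 17"
proof -
  let ?A = "A(j := None)"
  let ?L = "levels (min D (256 * n))"
  define p where "p = mach j"
  have fin: "finite (dom A)" using md by (simp add: msparse_def)
  have mach: "\<And>i. i \<in> dom A \<Longrightarrow> mach i < m" and bal: "balanced m A mach"
    and si: "\<And>p. p < m \<Longrightarrow> machine_inv (on_machine A mach p) (num p) (\<pi> p)" using mi by (auto simp: system_inv_def)
  have p: "p < m" using mach j by (auto simp: p_def)
  have finp: "finite (dom (on_machine A mach q))" for q using fin by (simp add: dom_on_machine)
  have jp: "j \<in> dom (on_machine A mach p)" using j by (auto simp: dom_on_machine p_def)
  have dq: "sparse 128 (on_machine A mach q)" if "q < m" for q using balanced_sparse[OF md(1) bal that mach] .
  have Dq: "2 ^ e \<le> D" if "on_machine A mach q i = Some (e, k)" for q i e k using D[of i e k] that by (simp add: on_machine_Some)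
  have nq: "card (dom (on_machine A mach q)) \<le> n" for q
    by (rule le_trans[OF card_mono n]) (use fin in \<open>auto simp: dom_on_machine\<close>)
  let ?w = "\<lambda>q. weight (on_machine A mach q)"
  have wdel: "?w q V = weight ((on_machine A mach q)(i := None)) V + (if V = W then 1 else 0)"
    if "on_machine A mach q i = Some W" for q i V
  proof -
    have "on_machine A mach q = ((on_machine A mach q)(i := None))(i \<mapsto> W)" using that by auto
    then show ?thesis using weight_upd[of "(on_machine A mach q)(i := None)" i W V] finp by simp
  qed
  have balw: "?w q V \<le> ?w r V + 1" if "q < m" "r < m" for q r V using bal that unfolding balanced_def by blast
  have onj: "on_machine A mach p j = Some W" using j by (simp add: on_machine_Some p_def)
  obtain num1 \<pi>1 where s1: "machine_inv ((on_machine A mach p)(j := None)) num1 \<pi>1"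
    "card {i \<in> dom (on_machine A mach p) - {j}. \<pi>1 i \<noteq> \<pi> p i} \<le> 9 * ?L + 7"
    using machine_inv_delete[OF si[OF p] jp dq[OF p] _ nq, of D] Dq by blast
  show ?thesis
  \<comment> \<open>If \<open>p\<close> has the maximal number of jobs of \<open>W\<close>, it can
    lose one. Otherwise some \<open>q\<close> has exactly one more than \<open>p\<close> by balance,
    and handing one of them to \<open>p\<close> evens this out.\<close>
  proof (cases "\<forall>q<m. ?w q W \<le> ?w p W")
    case True
    have onp: "on_machine ?A mach p = (on_machine A mach p)(j := None)"
      by (auto simp: on_machine_def restrict_map_def)
    have onq: "on_machine ?A mach q = on_machine A mach q" if "q \<noteq> p" for q
      using that by (auto simp: on_machine_def restrict_map_def p_def)
    have wt: "?w q V = weight (on_machine ?A mach q) V + (if q = p \<and> V = W then 1 else 0)" for q V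
      using wdel[OF onj, of V] onp onq by (cases "q = p") auto
    have "balanced m ?A mach"
      unfolding balanced_def
    proof (intro allI impI)
      fix V q r assume qr: "q < m" "r < m"
      have le: "weight (on_machine ?A mach q) V \<le> ?w q V" using wt[of q V] by linarith
      show "weight (on_machine ?A mach q) V \<le> weight (on_machine ?A mach r) V + 1"
      proof (cases "r = p \<and> V = W")
        case rp: True
        then have "?w q V \<le> ?w r V" using True qr by simp
        moreover have "?w r V = weight (on_machine ?A mach r) V + 1" by (rule trans[OF wt]) (use rp in simp)
        ultimately show ?thesis using le by linarith
      next
        case False
        then have "?w r V = weight (on_machine ?A mach r) V" using wt[of r V] by auto
        then show ?thesis using le balw[OF qr, of V] by linarith
      qed
    qed
    moreover have "machine_inv (on_machine ?A mach q) ((num(p := num1)) q) ((\<pi>(p := \<pi>1)) q)" if "q < m" for q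
      using s1(1) si[OF that] by (cases "q = p") (simp_all add: onp onq)
    ultimately have "system_inv m ?A mach (num(p := num1)) (\<pi>(p := \<pi>1))"
      using mach by (auto simp: system_inv_def)
    moreover have "card {i \<in> dom A - {j}. (mach i, (\<pi>(p := \<pi>1)) (mach i) i) \<noteq> (mach i, \<pi> (mach i) i)} \<le> 9 * ?L + 7"
    proof (rule le_trans[OF card_mono s1(2)])
      show "finite {i \<in> dom (on_machine A mach p) - {j}. \<pi>1 i \<noteq> \<pi> p i}" using finp by simp
    qed (auto simp: dom_on_machine split: if_splits)
    ultimately show ?thesis
      by (intro exI[of _ mach] exI[of _ "num(p := num1)"] exI[of _ "\<pi>(p := \<pi>1)"]) auto
  next
    case False
    then obtain q where q: "q < m" "?w p W < ?w q W" by (auto simp: not_le)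
    have qp: "q \<noteq> p" using q by auto
    have "{i. on_machine A mach q i = Some W} \<noteq> {}"
    proof
      assume "{i. on_machine A mach q i = Some W} = {}"
      then have "?w q W = 0" unfolding weight_def by (simp only: card.empty)
      then show False using q(2) by simp
    qed
    then obtain k where onk: "on_machine A mach q k = Some W" by auto
    then have k: "A k = Some W" "mach k = q" by (auto simp: on_machine_Some)
    have kj: "k \<noteq> j" using k qp by (auto simp: p_def)
    have kq: "k \<in> dom (on_machine A mach q)" using onk by auto
    define mach' where "mach' = mach(k := p)"
    have onp: "on_machine ?A mach' p = ((on_machine A mach p)(j := None))(k \<mapsto> W)"
      using k kj by (auto simp: on_machine_def restrict_map_def mach'_def)
    have onq: "on_machine ?A mach' q = (on_machine A mach q)(k := None)"
      using qp k by (auto simp: on_machine_def restrict_map_def mach'_def p_def)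
    have onr: "on_machine ?A mach' r = on_machine A mach r" if "r \<noteq> p" "r \<noteq> q" for r
      using that k by (auto simp: on_machine_def restrict_map_def mach'_def p_def)
    have kp: "k \<notin> dom ((on_machine A mach p)(j := None))" using k qp by (auto simp: dom_on_machine)
    have wp: "weight (on_machine ?A mach' p) V = ?w p V" for V
      using wdel[OF onj, of V] weight_upd[of "(on_machine A mach p)(j := None)" k W V] kp finp by (simp add: onp)
    have wq: "?w q V = weight (on_machine ?A mach' q) V + (if V = W then 1 else 0)" for V
      using wdel[OF onk, of V] onq by simp
    have wt: "?w r V = weight (on_machine ?A mach' r) V + (if r = q \<and> V = W then 1 else 0)" for r V
      using wp[of V] wq[of V] onr[of r] qp by (cases "r = p"; cases "r = q") auto
    have bal': "balanced m ?A mach'"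
      unfolding balanced_def
    proof (intro allI impI)
      fix V r r' assume rr: "r < m" "r' < m"
      have le: "weight (on_machine ?A mach' r) V \<le> ?w r V" using wt[of r V] by linarith
      show "weight (on_machine ?A mach' r) V \<le> weight (on_machine ?A mach' r') V + 1"
      proof (cases "r' = q \<and> V = W")
        case rq: True
        then have "?w r V \<le> ?w r' V" using balw[OF rr(1) p, of W] q(2) by simp
        moreover have "?w r' V = weight (on_machine ?A mach' r') V + 1" by (rule trans[OF wt]) (use rq in simp)
        ultimately show ?thesis using le by linarith
      next
        case False
        then have "?w r' V = weight (on_machine ?A mach' r') V" using wt[of r' V] by auto
        then show ?thesis using le balw[OF rr, of V] by linarith
      qed
    qed
    have mach'm: "mach' i < m" if "i \<in> dom ?A" for i using that mach p by (auto simp: mach'_def)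
    have dp: "sparse 128 (((on_machine A mach p)(j := None))(k \<mapsto> W))"
      using balanced_sparse[OF md(2) bal' p mach'm] onp by simp
    have Dp: "2 ^ e \<le> D" if "(((on_machine A mach p)(j := None))(k \<mapsto> W)) i = Some (e, k')" for i e k'
      using D[of i e k'] that unfolding onp[symmetric] on_machine_Some by (auto split: if_splits)
    have np: "card (dom (((on_machine A mach p)(j := None))(k \<mapsto> W))) \<le> n"
      unfolding onp[symmetric] dom_on_machine by (rule le_trans[OF card_mono n]) (use fin in auto)
    obtain num2 \<pi>2 where s2: "machine_inv (((on_machine A mach p)(j := None))(k \<mapsto> W)) num2 \<pi>2"
      "card {i \<in> dom ((on_machine A mach p)(j := None)). \<pi>2 i \<noteq> \<pi>1 i} \<le> 3 * ?L + 2"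
      using machine_inv_insert[OF s1(1) kp dp _ np, of D] Dp by blast
    obtain num3 \<pi>3 where s3: "machine_inv ((on_machine A mach q)(k := None)) num3 \<pi>3"
      "card {i \<in> dom (on_machine A mach q) - {k}. \<pi>3 i \<noteq> \<pi> q i} \<le> 9 * ?L + 7"
      using machine_inv_delete[OF si[OF q(1)] kq dq[OF q(1)] _ nq, of D] Dq by blast
    define num' where "num' = num(p := num2, q := num3)"
    define \<pi>' where "\<pi>' = \<pi>(p := \<pi>2, q := \<pi>3)"
    have "machine_inv (on_machine ?A mach' r) (num' r) (\<pi>' r)" if "r < m" for r
    proof (cases "r = p")
      case True
      then show ?thesis using s2(1) qp unfolding num'_def \<pi>'_def by (simp add: onp)
    next
      case rp: False
      show ?thesis
      proof (cases "r = q")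
        case True
        then show ?thesis using s3(1) unfolding num'_def \<pi>'_def by (simp add: onq)
      next
        case False
        then show ?thesis using si[OF that] rp unfolding num'_def \<pi>'_def by (simp add: onr)
      qed
    qed
    then have "system_inv m ?A mach' num' \<pi>'" using bal' mach'm unfolding system_inv_def by blast
    moreover have "card {i \<in> dom A - {j}. mach' i \<noteq> mach i} \<le> 1"
    proof -
      have "{i \<in> dom A - {j}. mach' i \<noteq> mach i} \<subseteq> {k}" by (auto simp: mach'_def)
      then show ?thesis using card_mono[of "{k}"] by fastforce
    qed
    moreover have "card {i \<in> dom A - {j}. (mach' i, \<pi>' (mach' i) i) \<noteq> (mach i, \<pi> (mach i) i)} \<le> 21 * ?L + 17"
    proof -
      let ?P = "dom (on_machine A mach p) - {j}"
      let ?P1 = "{i \<in> ?P. \<pi>2 i \<noteq> \<pi> p i}" and ?Q1 = "{i \<in> dom (on_machine A mach q) - {k}. \<pi>3 i \<noteq> \<pi> q i}"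
      have "{i \<in> dom A - {j}. (mach' i, \<pi>' (mach' i) i) \<noteq> (mach i, \<pi> (mach i) i)} \<subseteq> insert k (?P1 \<union> ?Q1)"
        using qp by (auto simp: mach'_def \<pi>'_def dom_on_machine split: if_splits)
      then have "card {i \<in> dom A - {j}. (mach' i, \<pi>' (mach' i) i) \<noteq> (mach i, \<pi> (mach i) i)} \<le> card (insert k (?P1 \<union> ?Q1))"
        using finp by (intro card_mono) auto
      moreover have "\<dots> \<le> Suc (card (?P1 \<union> ?Q1))" using finp by (simp add: card_insert_if)
      moreover have "card (?P1 \<union> ?Q1) \<le> card ?P1 + card ?Q1" by (rule card_Un_le)
      moreover have "card ?P1 \<le> card {i \<in> ?P. \<pi>2 i \<noteq> \<pi>1 i} + card {i \<in> ?P. \<pi>1 i \<noteq> \<pi> p i}"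
        using finp by (intro card_changes_trans) simp
      moreover have "card {i \<in> ?P. \<pi>2 i \<noteq> \<pi>1 i} \<le> 3 * ?L + 2" using s2(2) by simp
      ultimately show ?thesis using s1(2) s3(2) by linarith
    qed
    ultimately show ?thesis by blast
  qed
qed

subsection \<open>Arbitrary windows and the scheduler\<close>

text \<open>The last two clauses lead back from \<open>W\<close> to \<open>w\<close>: the original
  window starts less than one length of \<open>W\<close> earlier and is less than four times as
  long. This is how underallocation becomes a density of aligned windows.\<close>

definition aligned_in :: "int \<times> int \<Rightarrow> nat \<times> int \<Rightarrow> bool" where
  "aligned_in w W \<longleftrightarrow> fst w \<le> snd W * 2 ^ fst W \<and> snd W * 2 ^ fst W + 2 ^ fst W \<le> snd w \<and>
     snd W * 2 ^ fst W < fst w + 2 ^ fst W \<and> snd w - fst w < 4 * 2 ^ fst W"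

definition align :: "int \<times> int \<Rightarrow> nat \<times> int" where
  "align w = (SOME W. aligned_in w W)"

lemma aligned_in_align:
  assumes "2 \<le> d - a"
  shows "aligned_in (a, d) (align (a, d))"
proof -
  define s where "s = nat (d - a) div 2"
  have "1 \<le> s" using assms by (simp add: s_def)
  then obtain e where e: "2 ^ e \<le> s" "s < 2 ^ (e + 1)" using ex_power_ivl1[of 2 s] by auto
  define p :: int where "p = 2 ^ e"
  have p0: "0 < p" by (simp add: p_def)
  have ps: "int (2 ^ e) = p" by (simp add: p_def)
  have "p \<le> int s" using e(1) ps by (metis of_nat_le_iff)
  moreover have "int s < 2 * p" using e(2) ps by (simp add: p_def) (metis of_nat_less_iff of_nat_mult of_nat_numeral of_nat_power)
  moreover have "2 * int s \<le> d - a" "d - a < 2 * int s + 2" using assms by (auto simp: s_def)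
  ultimately have span: "2 * p \<le> d - a" "d - a < 4 * p" by linarith+
  define k where "k = - ((- a) div p)"
  define r where "r = (- a) mod p"
  have r: "0 \<le> r" "r < p" using p0 by (simp_all add: r_def)
  have "k * p = a + r"
  proof -
    have "k * p = - ((- a) div p * p)" by (simp add: k_def)
    then show ?thesis using div_mult_mod_eq[of "- a" p] unfolding r_def by linarith
  qed
  then have "aligned_in (a, d) (e, k)"
    using r span unfolding aligned_in_def fst_conv snd_conv p_def[symmetric] by linarith
  then show ?thesis unfolding align_def by (rule someI)
qed

definition aligned :: "jobs \<Rightarrow> djobs" where
  "aligned A = (\<lambda>j. map_option align (A j))"

lemma dom_aligned [simp]: "dom (aligned A) = dom A"
  by (auto simp: aligned_def)

text \<open>Measured in units of \<gamma>, stretched jobs have length 1, and on each machine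
  rounding their start times down is injective.\<close>

lemma underallocated_density:
  assumes ua: "underallocated m \<gamma> A" and \<gamma>: "0 < \<gamma>" and S: "S \<subseteq> dom A"
    and w: "\<And>j a d. j \<in> S \<Longrightarrow> A j = Some (a, d) \<Longrightarrow> lo \<le> a \<and> d \<le> hi" and "lo \<le> hi"
  shows "\<gamma> * real (card S) \<le> real m * real_of_int (hi - lo)"
proof -
  obtain mach start where
    win: "\<And>j a d. A j = Some (a, d) \<Longrightarrow>
          mach j < m \<and> real_of_int a \<le> start j \<and> start j + \<gamma> \<le> real_of_int d" and
    sep: "\<And>j k. j \<in> dom A \<Longrightarrow> k \<in> dom A \<Longrightarrow> j \<noteq> k \<Longrightarrow> mach j = mach k \<Longrightarrow>
          start j + \<gamma> \<le> start k \<or> start k + \<gamma> \<le> start j"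
    using ua unfolding underallocated_def by blast
  define h where "h j = (start j - real_of_int lo) / \<gamma>" for j
  define N where "N = \<lfloor>real_of_int (hi - lo) / \<gamma>\<rfloor>"
  have hb: "mach j < m \<and> 0 \<le> h j \<and> h j + 1 \<le> real_of_int (hi - lo) / \<gamma>" if jS: "j \<in> S" for j
  proof -
    obtain w where "A j = Some w" using subsetD[OF S jS] by blast
    then obtain a d where A: "A j = Some (a, d)" by (cases w) blast
    have "lo \<le> a" "d \<le> hi" using w[OF jS A] by auto
    then have "real_of_int lo \<le> start j" "start j + \<gamma> \<le> real_of_int hi" using win[OF A] by linarith+
    then have "0 \<le> h j" "(start j - real_of_int lo + \<gamma>) / \<gamma> \<le> real_of_int (hi - lo) / \<gamma>"
      using \<gamma> by (auto simp: h_def intro: divide_right_mono)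
    moreover have "(start j - real_of_int lo + \<gamma>) / \<gamma> = h j + 1"
      using \<gamma> by (simp add: h_def add_divide_distrib)
    ultimately show ?thesis using win[OF A] by simp
  qed
  have "card S \<le> card ({..<m} \<times> {0..<N})"
  proof (rule card_inj_on_le[of "\<lambda>j. (mach j, \<lfloor>h j\<rfloor>)"])
    show "inj_on (\<lambda>j. (mach j, \<lfloor>h j\<rfloor>)) S"
    proof (rule inj_onI, rule ccontr)
      fix i j assume ij: "i \<in> S" "j \<in> S" "(mach i, \<lfloor>h i\<rfloor>) = (mach j, \<lfloor>h j\<rfloor>)" "i \<noteq> j"
      then have "start i + \<gamma> \<le> start j \<or> start j + \<gamma> \<le> start i" using S by (intro sep) auto
      moreover have "h x + 1 \<le> h y" if "start x + \<gamma> \<le> start y" for x y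
      proof -
        have "h x + 1 = (start x - real_of_int lo + \<gamma>) / \<gamma>"
          using \<gamma> by (simp add: h_def add_divide_distrib)
        also have "\<dots> \<le> h y" unfolding h_def using that \<gamma> by (intro divide_right_mono) auto
        finally show ?thesis .
      qed
      ultimately have "h i + 1 \<le> h j \<or> h j + 1 \<le> h i" by blast
      moreover have "\<lfloor>h i\<rfloor> = \<lfloor>h j\<rfloor>" using ij by simp
      ultimately show False by linarith
    qed
    show "(\<lambda>j. (mach j, \<lfloor>h j\<rfloor>)) ` S \<subseteq> {..<m} \<times> {0..<N}"
    proof clarify
      fix j assume "j \<in> S"
      then have "mach j < m" "0 \<le> h j" "h j + 1 \<le> real_of_int (hi - lo) / \<gamma>" using hb by auto
      then have "mach j < m" "0 \<le> \<lfloor>h j\<rfloor>" "\<lfloor>h j\<rfloor> < N" unfolding N_def by linarith+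
      then show "mach j \<in> {..<m} \<and> \<lfloor>h j\<rfloor> \<in> {0..<N}" by simp
    qed
  qed simp
  then have "real (card S) \<le> real m * real (nat N)"
    by (metis card_atLeastLessThan_int card_cartesian_product card_lessThan diff_zero of_nat_le_iff of_nat_mult)
  also have "real (nat N) \<le> real_of_int (hi - lo) / \<gamma>"
  proof -
    have "0 \<le> N" using assms(5) \<gamma> by (simp add: N_def)
    then have "real (nat N) = real_of_int N" by simp
    then show ?thesis unfolding N_def by linarith
  qed
  finally have "real (card S) \<le> real m * (real_of_int (hi - lo) / \<gamma>)" by (simp add: mult_left_mono)
  then show ?thesis using \<gamma> by (simp add: field_simps)
qed

lemma underallocated_span:
  assumes "underallocated m \<gamma> A" "A j = Some (a, d)"
  shows "\<gamma> \<le> real_of_int (d - a)"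
proof -
  obtain start :: "job \<Rightarrow> real" where "real_of_int a \<le> start j" "start j + \<gamma> \<le> real_of_int d"
    using assms unfolding underallocated_def by blast
  then show ?thesis by simp
qed

lemma msparse_aligned:
  assumes ua: "underallocated m 2048 A" and fin: "finite (dom A)"
  shows "msparse m (aligned A)"
proof -
  have al: "aligned_in (a, d) (align (a, d)) \<and> 2048 \<le> d - a" if "A j = Some (a, d)" for j a d
  proof -
    have "2048 \<le> d - a" using underallocated_span[OF ua that] by linarith
    then show ?thesis using aligned_in_align[of d a] by simp
  qed
  have ge: "9 \<le> e" if j: "aligned A j = Some (e, k)" for j e k
  proof -
    obtain a d where ad: "A j = Some (a, d)" "align (a, d) = (e, k)" using j by (auto simp: aligned_def)
    \<comment> \<open>2048 = 4 * 2 ^ 9 guarantees the exponent 9 on which the rounding estimate of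
      \<open>balanced_sparse\<close> relies.\<close>
    have "d - a < 4 * 2 ^ e" "2048 \<le> d - a" using al[OF ad(1)] ad(2) by (auto simp: aligned_in_def)
    then have "(2::int) ^ 9 < 2 ^ e" by simp
    then show ?thesis using power_less_imp_less_exp[of "2::int" 9 e] by simp
  qed
  have "256 * card {j. \<exists>W. aligned A j = Some W \<and> inside W V} \<le> m * 2 ^ fst V" for V
  proof -
    obtain v c where V: "V = (v, c)" by force
    define J where "J = {j. \<exists>W. aligned A j = Some W \<and> inside W V}"
    define P :: int where "P = 2 ^ v"
    have P0: "0 < P" by (simp add: P_def)
    \<comment> \<open>The original window starts less than \<open>P\<close> before the aligned one
      and is shorter than \<open>4 * P\<close>. The range has length \<open>5 * P\<close>, and 5 *
      256 = 1280 is below 2048.\<close>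
    have wJ: "c * P - P \<le> a \<and> d \<le> c * P + 4 * P" if "j \<in> J" "A j = Some (a, d)" for j a d
    proof -
      obtain e k where ek: "align (a, d) = (e, k)" by force
      have ins: "inside (e, k) (v, c)" using that ek V by (auto simp: J_def aligned_def)
      have ev: "e \<le> v" using ins by (simp add: inside_def)
      define p :: int where "p = 2 ^ e"
      define q :: int where "q = 2 ^ (v - e)"
      have pq: "P = q * p" using ev by (simp add: p_def q_def P_def power_add[symmetric])
      have p0: "0 < p" and q1: "1 \<le> q" by (simp_all add: p_def q_def)
      have "k \<in> {k. k div q = c}" using ins by (simp add: inside_def q_def)
      then have "c * q \<le> k" "k + 1 \<le> c * q + q" using q1 by (simp_all add: div_fiber_eq)
      then have "c * q * p \<le> k * p" "(k + 1) * p \<le> (c * q + q) * p"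
        using p0 by (simp_all only: mult_le_cancel_right) auto
      then have kp: "c * P \<le> k * p" "k * p + p \<le> c * P + P" unfolding pq by (simp_all add: algebra_simps)
      have pP: "p \<le> P" using q1 p0 by (simp add: pq)
      have "k * p < a + p" "d - a < 4 * p" "a \<le> k * p"
        using al[OF that(2)] ek by (simp_all add: aligned_in_def p_def)
      then show ?thesis using kp pP by linarith
    qed
    have "2048 * real (card J) \<le> real m * real_of_int ((c * P + 4 * P) - (c * P - P))"
    proof (rule underallocated_density[OF ua])
      show "J \<subseteq> dom A" by (auto simp: J_def aligned_def)
    qed (use wJ P0 in auto)
    also have "(c * P + 4 * P) - (c * P - P) = 5 * P" by simp
    also have "real_of_int (5 * P) = 5 * 2 ^ v" by (simp add: P_def)
    finally have "1280 * real (card J) \<le> 5 * (real m * 2 ^ v)" by simp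
    then have "256 * real (card J) \<le> real m * 2 ^ v" by simp
    also have "\<dots> = real (m * 2 ^ v)" by simp
    finally have "real (256 * card J) \<le> real (m * 2 ^ v)" by simp
    then show ?thesis unfolding J_def V fst_conv of_nat_le_iff .
  qed
  then show ?thesis using fin ge unfolding msparse_def dom_aligned by blast
qed

section \<open>States, single requests and the scheduler\<close>

type_synonym state = "(job \<Rightarrow> nat) \<times> (nat \<Rightarrow> job \<Rightarrow> nat) \<times> (nat \<Rightarrow> job \<Rightarrow> int)"

definition good :: "nat \<Rightarrow> jobs \<Rightarrow> state \<Rightarrow> bool" where
  "good m A st \<longleftrightarrow> (case st of (mach, num, \<pi>) \<Rightarrow> system_inv m (aligned A) mach num \<pi>)"

definition pos :: "state \<Rightarrow> job \<Rightarrow> nat \<times> int" where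
  "pos st j = (case st of (mach, num, \<pi>) \<Rightarrow> (mach j, \<pi> (mach j) j))"

definition sched :: "jobs \<Rightarrow> state \<Rightarrow> schedule" where
  "sched A st = (\<lambda>j. if j \<in> dom A then Some (pos st j) else None)"

lemma good_feasible:
  assumes "good m A st" "underallocated m 2048 A"
  shows "feasible m A (sched A st)"
proof -
  obtain mach num \<pi> where st: "st = (mach, num, \<pi>)" by (cases st)
  have mi: "system_inv m (aligned A) mach num \<pi>" using assms(1) st by (simp add: good_def)
  have pl: "placed (trimmed (on_machine (aligned A) mach p) (num p)) (\<pi> p)" if "p < m" for p
    using mi that by (simp add: system_inv_def machine_inv_def reserved_def)
  have mach: "mach j < m" if "j \<in> dom A" for j using mi that by (simp add: system_inv_def)
  have d: "dom (sched A st) = dom A" by (auto simp: sched_def split: if_splits)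
  have win: "p < m \<and> a \<le> t \<and> t + 1 \<le> d" if j: "A j = Some (a, d)" "sched A st j = Some (p, t)" for j a d p t
  proof -
    have jd: "j \<in> dom A" using j(1) by auto
    have pt: "p = mach j" "t = \<pi> p j" using j(2) jd by (auto simp: sched_def pos_def st)
    have "2048 \<le> d - a" using underallocated_span[OF assms(2) j(1)] by linarith
    then have al: "aligned_in (a, d) (align (a, d))" by (intro aligned_in_align) simp
    obtain e k where ek: "align (a, d) = (e, k)" by force
    obtain e' k' where ek': "trim (num p j) (e, k) = (e', k')" by force
    have "on_machine (aligned A) mach p j = Some (e, k)" using j(1) ek pt(1) by (simp add: on_machine_Some aligned_def)
    then have "trimmed (on_machine (aligned A) mach p) (num p) j = Some (e', k')" using ek' by (simp add: trimmed_def)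
    then have "t div 2 ^ e' = k'" using pl[of p] mach[OF jd] pt unfolding placed_def by blast
    moreover have "inside (e', k') (e, k)" using inside_trim[of "num p j" "(e, k)"] ek' by simp
    ultimately have "t \<in> {t. t div 2 ^ e = k}" using inside_slot by blast
    then have "k * 2 ^ e \<le> t" "t + 1 \<le> k * 2 ^ e + 2 ^ e" unfolding div_power_fiber_eq by auto
    then have "a \<le> t \<and> t + 1 \<le> d" using al ek unfolding aligned_in_def by simp
    then show ?thesis using mach[OF jd] pt(1) by simp
  qed
  have "inj_on (sched A st) (dom A)"
  proof (rule inj_onI)
    fix i j assume ij: "i \<in> dom A" "j \<in> dom A" "sched A st i = sched A st j"
    then have eq: "mach i = mach j" "\<pi> (mach j) i = \<pi> (mach j) j" by (auto simp: sched_def pos_def st)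
    have "inj_on (\<pi> (mach j)) (dom (trimmed (on_machine (aligned A) mach (mach j)) (num (mach j))))"
      using pl[OF mach[OF ij(2)]] by (simp add: placed_def)
    moreover have "i \<in> dom (on_machine (aligned A) mach (mach j))" "j \<in> dom (on_machine (aligned A) mach (mach j))"
      using ij eq(1) unfolding dom_on_machine dom_aligned by blast+
    ultimately show "i = j" using eq(2) unfolding dom_trimmed by (meson inj_onD)
  qed
  then show ?thesis using d win unfolding feasible_def d by blast
qed

definition span_bound :: "jobs \<Rightarrow> jobs \<Rightarrow> nat" where
  "span_bound A A' = nat (Max ((\<lambda>(a, d). d - a) ` ran (A ++ A')))"

definition step :: "nat \<Rightarrow> jobs \<Rightarrow> jobs \<Rightarrow> state \<Rightarrow> state \<Rightarrow> bool" where
  "step m A A' st st' \<longleftrightarrow> good m A' st' \<and>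
     card {i \<in> dom A \<inter> dom A'. fst (pos st' i) \<noteq> fst (pos st i)} \<le> 1 \<and>
     card {i \<in> dom A \<inter> dom A'. pos st' i \<noteq> pos st i}
       \<le> 21 * levels (min (span_bound A A') (256 * card (dom (A ++ A')))) + 17"

lemma aligned_exp_le:
  assumes ua: "underallocated m 2048 A" and fin: "finite (dom A)"
    and j: "aligned A j = Some (e, k)"
  shows "2 ^ e \<le> nat (Max ((\<lambda>(a, d). d - a) ` ran A))"
proof -
  obtain a d where ad: "A j = Some (a, d)" "align (a, d) = (e, k)" using j by (auto simp: aligned_def)
  have "2048 \<le> d - a" using underallocated_span[OF ua ad(1)] by linarith
  then have "aligned_in (a, d) (e, k)" using aligned_in_align[of d a] ad(2) by simp
  then have "2 ^ e \<le> d - a" by (auto simp: aligned_in_def)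
  also have "d - a \<le> Max ((\<lambda>(a, d). d - a) ` ran A)"
  proof (rule Max_ge)
    show "finite ((\<lambda>(a, d). d - a) ` ran A)" using fin by (simp add: finite_ran)
    show "d - a \<in> (\<lambda>(a, d). d - a) ` ran A" using ad(1) by (force simp: ran_def)
  qed
  finally have "2 ^ e \<le> Max ((\<lambda>(a, d). d - a) ` ran A)" .
  then have "nat (2 ^ e) \<le> nat (Max ((\<lambda>(a, d). d - a) ` ran A))" by (rule nat_mono)
  then show ?thesis by (simp add: nat_power_eq)
qed

lemma step_exists:
  assumes m: "1 \<le> m" and g: "good m A st" and vr: "valid_request A r" and fin: "finite (dom A)"
    and ua: "underallocated m 2048 A" "underallocated m 2048 (process r A)"
  shows "\<exists>st'. step m A (process r A) st st'"
proof -
  obtain mach num \<pi> where st: "st = (mach, num, \<pi>)" by (cases st)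
  have mi: "system_inv m (aligned A) mach num \<pi>" using g st by (simp add: good_def)
  show ?thesis
  proof (cases r)
    case (InsertJob j a d)
    let ?A = "A(j \<mapsto> (a, d))"
    have pr: "process r A = ?A" using InsertJob by simp
    have j: "j \<notin> dom A" using vr InsertJob by simp
    have AL: "aligned ?A = (aligned A)(j \<mapsto> align (a, d))" by (auto simp: aligned_def)
    have jN: "A j = None" using j by blast
    have add: "A ++ ?A = ?A"
      by (rule ext) (simp add: map_add_def split: option.split)
    have di: "dom A \<inter> dom ?A = dom A" by auto
    have fA: "finite (dom ?A)" using fin by simp
    let ?D = "nat (Max ((\<lambda>(a, d). d - a) ` ran ?A))"
    have uA: "underallocated m 2048 ?A" using ua(2) pr by simp
    have md: "msparse m ((aligned A)(j \<mapsto> align (a, d)))" using msparse_aligned[OF uA fA] AL by simp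
    have D: "2 ^ e \<le> ?D" if "((aligned A)(j \<mapsto> align (a, d))) i = Some (e, k)" for i e k
      using aligned_exp_le[OF uA fA, of i e k] that AL by simp
    have jA: "j \<notin> dom (aligned A)" using j by simp
    have n: "card (dom ((aligned A)(j \<mapsto> align (a, d)))) \<le> card (dom ?A)"
      unfolding AL[symmetric] dom_aligned ..
    have m0: "0 < m" using m by simp
    obtain mach' num' \<pi>' where st': "system_inv m ((aligned A)(j \<mapsto> align (a, d))) mach' num' \<pi>'"
      "\<forall>i\<in>dom (aligned A). mach' i = mach i"
      "card {i \<in> dom (aligned A). (mach' i, \<pi>' (mach' i) i) \<noteq> (mach i, \<pi> (mach i) i)}
        \<le> 3 * levels (min ?D (256 * card (dom ?A))) + 2"
      using system_inv_insert[OF mi m0 jA md _ n, of ?D] D by blast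
    have "step m A ?A st (mach', num', \<pi>')"
      unfolding step_def add di span_bound_def
    proof (intro conjI)
      show "good m ?A (mach', num', \<pi>')" using st'(1) by (simp add: good_def AL)
      have "{i \<in> dom A. fst (pos (mach', num', \<pi>') i) \<noteq> fst (pos st i)} = {}"
        using st'(2) by (auto simp: pos_def st)
      then show "card {i \<in> dom A. fst (pos (mach', num', \<pi>') i) \<noteq> fst (pos st i)} \<le> 1"
        by (simp only: card.empty)
      have "card {i \<in> dom A. pos (mach', num', \<pi>') i \<noteq> pos st i}
          \<le> 3 * levels (min ?D (256 * card (dom ?A))) + 2"
        using st'(3) unfolding pos_def st prod.case dom_aligned .
      then show "card {i \<in> dom A. pos (mach', num', \<pi>') i \<noteq> pos st i}
          \<le> 21 * levels (min ?D (256 * card (dom ?A))) + 17" by linarith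
    qed
    then show ?thesis unfolding pr by blast
  next
    case (DeleteJob j)
    let ?A = "A(j := None)"
    have pr: "process r A = ?A" using DeleteJob by simp
    obtain w where w: "A j = Some w" using vr DeleteJob by auto
    have AL: "aligned ?A = (aligned A)(j := None)" by (auto simp: aligned_def)
    have add: "A ++ ?A = A"
      by (rule ext) (simp add: map_add_def split: option.split)
    have di: "dom A \<inter> dom ?A = dom A - {j}" by auto
    have fA: "finite (dom ?A)" using fin by simp
    let ?D = "nat (Max ((\<lambda>(a, d). d - a) ` ran A))"
    have uA: "underallocated m 2048 ?A" using ua(2) pr by simp
    have md: "msparse m ((aligned A)(j := None))" using msparse_aligned[OF uA fA] AL by simp
    have D: "2 ^ e \<le> ?D" if "aligned A i = Some (e, k)" for i e k
      using aligned_exp_le[OF ua(1) fin that] .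
    have jA: "aligned A j = Some (align w)" using w by (simp add: aligned_def)
    have n: "card (dom (aligned A)) \<le> card (dom A)" by simp
    obtain mach' num' \<pi>' where st': "system_inv m ((aligned A)(j := None)) mach' num' \<pi>'"
      "card {i \<in> dom (aligned A) - {j}. mach' i \<noteq> mach i} \<le> 1"
      "card {i \<in> dom (aligned A) - {j}. (mach' i, \<pi>' (mach' i) i) \<noteq> (mach i, \<pi> (mach i) i)}
        \<le> 21 * levels (min ?D (256 * card (dom A))) + 17"
      using system_inv_delete[OF mi jA msparse_aligned[OF ua(1) fin] md _ n, of ?D] D by blast
    have "step m A ?A st (mach', num', \<pi>')"
      unfolding step_def add di span_bound_def
    proof (intro conjI)
      show "good m ?A (mach', num', \<pi>')" using st'(1) by (simp add: good_def AL)
      show "card {i \<in> dom A - {j}. fst (pos (mach', num', \<pi>') i) \<noteq> fst (pos st i)} \<le> 1"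
        using st'(2) unfolding pos_def st prod.case dom_aligned fst_conv .
      show "card {i \<in> dom A - {j}. pos (mach', num', \<pi>') i \<noteq> pos st i}
          \<le> 21 * levels (min ?D (256 * card (dom A))) + 17"
        using st'(3) unfolding pos_def st prod.case dom_aligned .
    qed
    then show ?thesis unfolding pr by blast
  qed
qed

text \<open>The list holds the latest request first, so that the recursion removes the most recent
  one and each state depends on the past only.\<close>

primrec run :: "nat \<Rightarrow> request list \<Rightarrow> state" where
  "run m [] = (\<lambda>_. 0, \<lambda>_ _. 0, \<lambda>_ _. 0)"
| "run m (r # rs) =
     (SOME st. step m (active (rev rs)) (active (rev (r # rs))) (run m rs) st)"

lemma active_snoc: "active (rs @ [r]) = process r (active rs)"
  by (simp add: active_def)

lemma finite_dom_process: "finite (dom A) \<Longrightarrow> finite (dom (process r A))"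
  by (cases r) auto

lemma finite_dom_active: "finite (dom (active rs))"
  by (induction rs rule: rev_induct) (simp add: active_def, simp only: active_snoc finite_dom_process)

lemma request_sequence_snoc:
  "request_sequence (rs @ [r]) \<longleftrightarrow> request_sequence rs \<and> valid_request (active rs) r"
  unfolding request_sequence_def by (auto simp: less_Suc_eq nth_append)

lemma underallocated_sequence_snoc:
  "underallocated_sequence m \<gamma> (rs @ [r]) \<longleftrightarrow>
     underallocated_sequence m \<gamma> rs \<and> underallocated m \<gamma> (active (rs @ [r]))"
  unfolding underallocated_sequence_def by (auto simp: le_Suc_eq)

lemma underallocated_sequence_last:
  "underallocated_sequence m \<gamma> rs \<Longrightarrow> underallocated m \<gamma> (active rs)"
  unfolding underallocated_sequence_def by (metis order.refl take_all)

lemma good_empty: "good m (active []) (run m [])"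
proof -
  have "on_machine (aligned Map.empty) mach p = Map.empty" for mach p by (auto simp: on_machine_def aligned_def)
  moreover have "trimmed Map.empty num = Map.empty" for num by (auto simp: trimmed_def)
  ultimately show ?thesis
    by (simp add: good_def active_def system_inv_def balanced_def machine_inv_def reserved_def placed_def occupancy_def weight_def)
qed

lemma run_step_if_good:
  assumes "1 \<le> m" "request_sequence (rs @ [r])" "underallocated_sequence m 2048 (rs @ [r])"
    and "good m (active rs) (run m (rev rs))"
  shows "step m (active rs) (active (rs @ [r])) (run m (rev rs)) (run m (rev (rs @ [r])))"
proof -
  have "underallocated m 2048 (active rs)" "underallocated m 2048 (process r (active rs))"
    using assms(3) underallocated_sequence_last[of m 2048 rs]
    unfolding underallocated_sequence_snoc active_snoc by blast+
  moreover have "valid_request (active rs) r" using assms(2) by (simp add: request_sequence_snoc)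
  ultimately have "\<exists>st. step m (active rs) (active (rs @ [r])) (run m (rev rs)) st"
    unfolding active_snoc using assms(1,4) finite_dom_active by (intro step_exists)
  moreover have "run m (rev (rs @ [r])) = (SOME st. step m (active rs) (active (rs @ [r])) (run m (rev rs)) st)"
    by simp
  ultimately show ?thesis using someI_ex by (simp only:)
qed

lemma run_good:
  assumes "1 \<le> m" "request_sequence rs" "underallocated_sequence m 2048 rs"
  shows "good m (active rs) (run m (rev rs))"
  using assms(2,3)
proof (induction rs rule: rev_induct)
  case Nil
  then show ?case using good_empty by simp
next
  case (snoc r rs)
  then have "good m (active rs) (run m (rev rs))"
    by (simp only: request_sequence_snoc underallocated_sequence_snoc)
  then show ?case using run_step_if_good[OF assms(1) snoc.prems] unfolding step_def by blast
qed

text \<open>Sequences that can be scheduled but are not 2048-underallocated still require feasible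
  schedules, though without a bound on the cost; any choice will do for them.\<close>

definition scheduler :: scheduler where
  "scheduler m rs =
     (if request_sequence rs \<and> underallocated_sequence m 2048 rs
      then sched (active rs) (run m (rev rs)) else (SOME \<sigma>. feasible m (active rs) \<sigma>))"

lemma reallocating_scheduler: "reallocating_scheduler scheduler"
  unfolding reallocating_scheduler_def
proof (intro allI impI)
  fix m :: nat and rs assume a: "1 \<le> m" "request_sequence rs" "\<exists>\<sigma>. feasible m (active rs) \<sigma>"
  show "feasible m (active rs) (scheduler m rs)"
  proof (cases "underallocated_sequence m 2048 rs")
    case True
    then show ?thesis
      using good_feasible[OF run_good[OF a(1,2) True] underallocated_sequence_last[OF True]] a(2)
      by (simp add: scheduler_def)
  next
    case False
    then show ?thesis using someI_ex[OF a(3)] by (simp add: scheduler_def)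
  qed
qed

lemma scheduler_cost:
  assumes m: "1 \<le> m" and rs: "request_sequence rs" "underallocated_sequence m 2048 rs"
    and i: "i < length rs"
  shows "real (reallocation_cost (scheduler m (take i rs)) (scheduler m (take (Suc i) rs)))
           \<le> 164 * real (max 1 (min (log_star (real (num_jobs rs i)))
                                     (log_star (real_of_int (max_span rs i)))))"
    and "migration_cost (scheduler m (take i rs)) (scheduler m (take (Suc i) rs)) \<le> 1"
proof -
  define us where "us = take i rs"
  define r where "r = rs ! i"
  have us': "take (Suc i) rs = us @ [r]" using i by (simp add: us_def r_def take_Suc_conv_app_nth)
  have seq: "request_sequence (us @ [r])" "underallocated_sequence m 2048 (us @ [r])"
  proof -
    show "request_sequence (us @ [r])"
      using rs(1) i unfolding us'[symmetric] request_sequence_def by (simp add: min_def)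
    show "underallocated_sequence m 2048 (us @ [r])"
      using rs(2) i unfolding us'[symmetric] underallocated_sequence_def by (simp add: min_def)
  qed
  then have seq0: "request_sequence us" "underallocated_sequence m 2048 us"
    by (simp_all add: request_sequence_snoc underallocated_sequence_snoc)
  let ?A = "active us" and ?A' = "active (us @ [r])"
  let ?st = "run m (rev us)" and ?st' = "run m (rev (us @ [r]))"
  have S: "scheduler m us = sched ?A ?st" "scheduler m (us @ [r]) = sched ?A' ?st'"
    using seq seq0 by (simp_all only: scheduler_def simp_thms if_True)
  have st: "step m ?A ?A' ?st ?st'" using run_step_if_good[OF m seq run_good[OF m seq0]] .
  have dS: "dom (sched X s) = dom X" for X s by (auto simp: sched_def split: if_splits)
  have mig: "migration_cost (scheduler m us) (scheduler m (us @ [r])) =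
      card {i \<in> dom ?A \<inter> dom ?A'. fst (pos ?st' i) \<noteq> fst (pos ?st i)}"
    unfolding migration_cost_def S dS
    by (rule arg_cong[of _ _ card]) (auto simp: sched_def)
  have rea: "reallocation_cost (scheduler m us) (scheduler m (us @ [r])) =
      card {i \<in> dom ?A \<inter> dom ?A'. pos ?st' i \<noteq> pos ?st i}"
    unfolding reallocation_cost_def S dS
    by (rule arg_cong[of _ _ card]) (auto simp: sched_def)
  show "migration_cost (scheduler m (take i rs)) (scheduler m (take (Suc i) rs)) \<le> 1"
    using st mig unfolding us' us_def[symmetric] step_def by simp
  have pres: "present rs i = ?A ++ ?A'" unfolding present_def us' us_def ..
  define n where "n = num_jobs rs i"
  define D where "D = max_span rs i"
  let ?M = "min (nat D) (256 * n)"
  have "span_bound ?A ?A' = nat D" "card (dom (?A ++ ?A')) = n"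
    unfolding span_bound_def D_def n_def max_span_def num_jobs_def pres by simp_all
  then have cost: "reallocation_cost (scheduler m us) (scheduler m (us @ [r])) \<le> 21 * levels ?M + 17"
    using st rea unfolding step_def by metis
  have fin: "finite (dom (?A ++ ?A'))" using finite_dom_active by (simp add: dom_map_add)
  \<comment> \<open>The inserted or deleted job is present, so the maximum of the spans is taken
    over a nonempty set and the number of jobs is positive.\<close>
  have ne: "dom (?A ++ ?A') \<noteq> {}"
  proof (cases r)
    case (InsertJob j a d)
    then show ?thesis by (simp add: active_snoc)
  next
    case (DeleteJob j)
    then have "j \<in> dom ?A" using seq(1) by (simp add: request_sequence_snoc)
    then show ?thesis by auto
  qed
  have n1: "1 \<le> n" using fin ne by (simp add: n_def num_jobs_def pres Suc_le_eq card_gt_0_iff)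
  have D1: "1 \<le> D"
  proof -
    obtain j where "j \<in> dom (?A ++ ?A')" using ne unfolding ex_in_conv[symmetric] by (rule exE)
    then have "\<exists>w. (?A ++ ?A') j = Some w" by (rule domD)
    then obtain w where w: "(?A ++ ?A') j = Some w" by (rule exE)
    obtain a d where "w = (a, d)" by (rule prod.exhaust)
    then have j: "(?A ++ ?A') j = Some (a, d)" using w by (simp only:)
    then have "?A j = Some (a, d) \<or> ?A' j = Some (a, d)" by (auto simp: map_add_Some_iff)
    then have "2048 \<le> real_of_int (d - a)"
      using underallocated_span[OF underallocated_sequence_last[OF seq0(2)]]
        underallocated_span[OF underallocated_sequence_last[OF seq(2)]] by blast
    then have "1 \<le> d - a" by linarith
    also have "d - a \<le> D"
      unfolding D_def max_span_def pres
    proof (rule Max_ge)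
      show "finite ((\<lambda>(a, d). d - a) ` ran (?A ++ ?A'))" using fin by (simp add: finite_ran del: dom_map_add)
      show "d - a \<in> (\<lambda>(a, d). d - a) ` ran (?A ++ ?A')"
        by (rule image_eqI[of _ _ "(a, d)"]) (simp, rule ranI[of "?A ++ ?A'" j, OF j])
    qed
    finally show ?thesis .
  qed
  have "levels ?M \<le> 2 * min (log_star (real n)) (log_star (real_of_int D)) + 5"
    using n1 D1 by (intro levels_le_log_star) (auto simp: min_def)
  \<comment> \<open>With x for the minimum, 21 * (2 * x + 5) + 17 = 42 * x + 122, which is at most
    164 times the maximum of 1 and x.\<close>
  then have "reallocation_cost (scheduler m us) (scheduler m (us @ [r]))
      \<le> 164 * max 1 (min (log_star (real n)) (log_star (real_of_int D)))"
    using cost by linarith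
  then show "real (reallocation_cost (scheduler m (take i rs)) (scheduler m (take (Suc i) rs)))
           \<le> 164 * real (max 1 (min (log_star (real (num_jobs rs i)))
                                     (log_star (real_of_int (max_span rs i)))))"
    unfolding us' us_def[symmetric] n_def D_def by (metis of_nat_le_iff of_nat_mult of_nat_numeral)
qed

theorem theorem1:
  "\<exists>\<gamma>::real. \<gamma> \<ge> 1 \<and>
     (\<exists>S. reallocating_scheduler S \<and>
       (\<exists>C::real. \<forall>m\<ge>1. \<forall>rs. request_sequence rs \<and> underallocated_sequence m \<gamma> rs \<longrightarrow>
         (\<forall>i<length rs.
            real (reallocation_cost (S m (take i rs)) (S m (take (Suc i) rs)))
              \<le> C * real (max 1 (min (log_star (real (num_jobs rs i)))
                                      (log_star (real_of_int (max_span rs i))))) \<and>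
            migration_cost (S m (take i rs)) (S m (take (Suc i) rs)) \<le> 1)))"
  by (rule exI[of _ 2048], rule conjI, simp, rule exI[of _ scheduler], rule conjI,
      rule reallocating_scheduler, rule exI[of _ 164]) (use scheduler_cost in blast)

end
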